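(* Let $X$ be an infinite-dimensional $L_1$-predual. Then each of the following conditions implies that $X$ has the convex-DLD2P: (a) $\mathrm{ext}(B_{X^*})$ is weak-star closed (in particular, $X=C(K)$ for some compact Hausdorff space $K$); (b) $S_X$ contains a $\Delta$-point at which the norm is smooth; (c) $X=C_0(L)$ for some locally compact Hausdorff space $L$ containing an accumulation point.
   Context: Banach spaces are over $\mathbb{R}$ or $\mathbb{C}$; $B_X$, $S_X$ are the closed unit ball and unit sphere; $\mathrm{ext}(C)$ is the set of extreme points of $C$. An $L_1$-predual is a Banach space whose dual is isometrically isomorphic to $L_1(\mu)$ for some positive measure $\mu$. A point $x\in S_X$ is a $\Delta$-point if for every $\varepsilon>0$ and every slice $S$ of $B_X$ containing $x$ (a slice being a set $\{y\in B_X\colon \mathrm{Re}\,x^*(y)>\sup\mathrm{Re}\,x^*(B_X)-\alpha\}$ with $x^*\in X^*$, $\alpha>0$) there is $y\in S$ with $\|x-y\|>2-\varepsilon$. $X$ has the convex diametral local diameter two property (convex-DLD2P) if $B_X=\overline{\mathrm{conv}}(\Delta_X)$, where $\Delta_X$ is the set of $\Delta$-points of $S_X$. The norm is smooth at $x\in S_X$ if there is exactly one $x^*\in S_{X^*}$ with $x^*(x)=1$. *)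

theory Defs
  imports "HOL-Analysis.Analysis"
begin

text \<open>
  The scalar field. The axioms below hold exactly for the real numbers (\<open>rc_unit = 0\<close>) and
  for the complex numbers (\<open>rc_unit = \<i>\<close>, up to conjugation), and they determine \<open>rc_re\<close> as the
  real part.
\<close>

class real_or_complex = real_normed_field + euclidean_space +
  fixes rc_re :: "'a \<Rightarrow> real"
    and rc_im :: "'a \<Rightarrow> real"
    and rc_unit :: 'a
  assumes rc_decomp: "z = rc_re z *\<^sub>R 1 + rc_im z *\<^sub>R rc_unit"
    and rc_unit_cases: "rc_unit = 0 \<or> rc_unit * rc_unit = - 1"

instantiation real :: real_or_complex
begin

definition "rc_re (z::real) = z"
definition "rc_im (z::real) = (0::real)"
definition "rc_unit = (0::real)"

instance
  by standard (simp_all add: rc_re_real_def rc_im_real_def rc_unit_real_def)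

end

instantiation complex :: real_or_complex
begin

definition "rc_re z = Re z"
definition "rc_im z = Im z"
definition "rc_unit = \<i>"

instance
  by standard (simp_all add: rc_re_complex_def rc_im_complex_def rc_unit_complex_def
      complex_eq_iff)

end

text \<open>
  A normed space over \<open>'k\<close> is a real normed space together with a multiplication by scalars
  from \<open>'k\<close> that extends the real one and for which the norm is absolutely homogeneous.
  For \<open>'k = real\<close> this forces \<open>smul = scaleR\<close>.
\<close>

locale normed_space_over = vector_space smul
  for smul :: "'k::real_or_complex \<Rightarrow> 'a::real_normed_vector \<Rightarrow> 'a" +
  assumes smul_of_real: "smul (of_real r) x = r *\<^sub>R x"
    and norm_smul: "norm (smul c x) = norm c * norm x"

definition infinite_dimensional ::
  "('k::real_or_complex \<Rightarrow> 'a::real_normed_vector \<Rightarrow> 'a) \<Rightarrow> bool" where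
  "infinite_dimensional smul \<longleftrightarrow> \<not> (\<exists>B. finite B \<and> module.span smul B = UNIV)"

text \<open>
  The dual is the set of those bounded real-linear maps into \<open>'k\<close> that are homogeneous over \<open>'k\<close>;
  the dual norm is the operator norm.
\<close>

definition dual_space ::
  "('k::real_or_complex \<Rightarrow> 'a::real_normed_vector \<Rightarrow> 'a) \<Rightarrow> ('a \<Rightarrow>\<^sub>L 'k) set" where
  "dual_space smul = {f. \<forall>c x. blinfun_apply f (smul c x) = c * blinfun_apply f x}"

definition dual_ball ::
  "('k::real_or_complex \<Rightarrow> 'a::real_normed_vector \<Rightarrow> 'a) \<Rightarrow> ('a \<Rightarrow>\<^sub>L 'k) set" where
  "dual_ball smul = {f \<in> dual_space smul. norm f \<le> 1}"

text \<open>
  The strong operator topology is the topology of pointwise convergence on \<open>'a\<close>, so on scalar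
  valued maps it is the weak-star topology.
\<close>

definition weak_star_topology ::
  "('k::real_or_complex \<Rightarrow> 'a::real_normed_vector \<Rightarrow> 'a) \<Rightarrow> ('a \<Rightarrow>\<^sub>L 'k) topology" where
  "weak_star_topology smul = subtopology strong_operator_topology (dual_space smul)"

definition dual_extreme_points ::
  "('k::real_or_complex \<Rightarrow> 'a::real_normed_vector \<Rightarrow> 'a) \<Rightarrow> ('a \<Rightarrow>\<^sub>L 'k) set" where
  "dual_extreme_points smul = {f. f extreme_point_of dual_ball smul}"

text \<open>
  The map \<open>T\<close> is a linear isometry of \<open>L\<^sub>1(M)\<close> onto the dual, written on integrable functions.
  The norm condition makes its value depend only on the class of a function modulo equality
  almost everywhere, and makes the map on classes injective.
\<close>

definition L1_predual ::
  "('k::real_or_complex \<Rightarrow> 'a::real_normed_vector \<Rightarrow> 'a) \<Rightarrow> 'm measure \<Rightarrow> bool" where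
  "L1_predual smul M \<longleftrightarrow>
    (\<exists>T :: ('m \<Rightarrow> 'k) \<Rightarrow> ('a \<Rightarrow>\<^sub>L 'k).
      T ` {g. integrable M g} = dual_space smul \<and>
      (\<forall>g h. integrable M g \<longrightarrow> integrable M h \<longrightarrow> T (\<lambda>t. g t + h t) = T g + T h) \<and>
      (\<forall>c g. integrable M g \<longrightarrow>
        (\<forall>x. blinfun_apply (T (\<lambda>t. c * g t)) x = c * blinfun_apply (T g) x)) \<and>
      (\<forall>g. integrable M g \<longrightarrow> norm (T g) = (\<integral>t. norm (g t) \<partial>M)))"

definition slice :: "('a::real_normed_vector \<Rightarrow>\<^sub>L 'k::real_or_complex) \<Rightarrow> real \<Rightarrow> 'a set" where
  "slice f \<alpha> = {y \<in> cball 0 1.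
    rc_re (blinfun_apply f y) > (SUP z\<in>cball 0 1. rc_re (blinfun_apply f z)) - \<alpha>}"

definition delta_point ::
  "('k::real_or_complex \<Rightarrow> 'a::real_normed_vector \<Rightarrow> 'a) \<Rightarrow> 'a \<Rightarrow> bool" where
  "delta_point smul x \<longleftrightarrow> x \<in> sphere 0 1 \<and>
    (\<forall>\<epsilon>>0. \<forall>f\<in>dual_space smul. \<forall>\<alpha>>0.
      x \<in> slice f \<alpha> \<longrightarrow> (\<exists>y\<in>slice f \<alpha>. norm (x - y) > 2 - \<epsilon>))"

definition convex_DLD2P ::
  "('k::real_or_complex \<Rightarrow> 'a::real_normed_vector \<Rightarrow> 'a) \<Rightarrow> bool" where
  "convex_DLD2P smul \<longleftrightarrow> cball 0 1 = closure (convex hull {x. delta_point smul x})"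

definition smooth_norm_at ::
  "('k::real_or_complex \<Rightarrow> 'a::real_normed_vector \<Rightarrow> 'a) \<Rightarrow> 'a \<Rightarrow> bool" where
  "smooth_norm_at smul x \<longleftrightarrow> x \<in> sphere 0 1 \<and>
    (\<exists>!f. f \<in> dual_space smul \<and> norm f = 1 \<and> blinfun_apply f x = 1)"

definition C0 :: "('t::topological_space \<Rightarrow>\<^sub>C 'k::real_or_complex) set" where
  "C0 = {u. \<forall>e>0. compact {t. e \<le> norm (apply_bcontfun u t)}}"

definition isometrically_isomorphic_to ::
  "('k::real_or_complex \<Rightarrow> 'a::real_normed_vector \<Rightarrow> 'a) \<Rightarrow>
    ('t::topological_space \<Rightarrow>\<^sub>C 'k) set \<Rightarrow> bool" where
  "isometrically_isomorphic_to smul F \<longleftrightarrow>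
    (\<exists>J :: 'a \<Rightarrow> ('t \<Rightarrow>\<^sub>C 'k).
      range J = F \<and>
      (\<forall>x y. J (x + y) = J x + J y) \<and>
      (\<forall>c x t. apply_bcontfun (J (smul c x)) t = c * apply_bcontfun (J x) t) \<and>
      (\<forall>x. norm (J x) = norm x))"

end

theory Submission
  imports Defs
begin

text \<open>
  An extreme point \<open>e\<close> of the unit ball of a space \<open>L\<^sub>1(\<mu>)\<close> is a normalized atom, so its line is an
  L-summand: every functional is \<open>h = a(h)e + h'\<close> with \<open>\<parallel>h\<parallel> = \<bar>a(h)\<bar> + \<parallel>h'\<parallel>\<close>
  (\<open>L1_predual_extreme_coefficient\<close>). Extreme points on different lines are disjoint atoms, so the
  coefficients of a fixed functional along different lines are absolutely summable.

  This gives many \<open>\<Delta>\<close>-points. Suppose that for every \<open>\<delta> > 0\<close> infinitely many lines contain extreme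
  points \<open>e\<close> with \<open>\<bar>e(x)\<bar> > 1 - \<delta>\<close>. A slice through \<open>x\<close> is given by a functional \<open>f\<close>, and among these
  lines there is one along which the coefficient of \<open>f\<close> is tiny. Flipping the sign of \<open>x\<close> on that
  line alone is a contraction in the bidual; it stays in the slice and moves \<open>x\<close> by almost \<open>2\<close>. By
  Goldstine's theorem it can be approximated in \<open>X\<close> (\<open>delta_point_if_infinitely_many_lines\<close>).

  On the other hand the face \<open>{y. \<parallel>y\<parallel> \<le> 1, e(y) = 1}\<close> of one extreme point \<open>e\<close> is already large:
  functionals \<open>f\<close> satisfy \<open>sup Re f = Re a(f) + \<parallel>f - a(f)e\<parallel>\<close> on it (\<open>face_norming\<close>), so by the
  Hahn-Banach theorem its unimodular multiples have the unit ball as closed convex hull. Hence it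
  suffices to find one extreme point \<open>e\<close> all of whose face satisfies the criterion above
  (\<open>convex_DLD2P_if_delta_face\<close>).

  If the set of extreme points is weak-star closed, it is compact, and it meets infinitely many lines
  because the space is infinite-dimensional; any point at which these lines accumulate will do. If the
  norm is smooth at a \<open>\<Delta>\<close>-point \<open>x\<close>, its norming functional \<open>e\<close> is extreme. Applying the
  \<open>\<Delta>\<close>-condition to slices defined by \<open>e\<close> gives extreme points on infinitely many other lines that
  almost norm \<open>x\<close>, and smoothness makes them converge weak-star to \<open>e\<close>. In \<open>C\<^sub>0(L)\<close> all evaluations are
  extreme, and evaluation at an accumulation point of \<open>L\<close> will do. For compact \<open>K\<close> the extreme points
  are the unimodular multiples of evaluations, which form a weak-star compact set.

  Separation of points from convex sets and the existence of extreme functionals that norm a given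
  vector both come from one lemma on sublinear functionals
  (\<open>extreme_linear_below_sublinear\<close>).
\<close>

section \<open>The scalar field\<close>

lemma rc_basis_indep:
  fixes a b :: real
  assumes u: "rc_unit * rc_unit = (- 1 :: 'k::real_or_complex)"
    and eq: "of_real a + of_real b * rc_unit = (0::'k)"
  shows "a = 0 \<and> b = 0"
proof -
  have "of_real a = - (of_real b * rc_unit :: 'k)"
    using eq by (simp add: add_eq_0_iff2)
  then have "(of_real a :: 'k) * of_real a = of_real b * of_real b * (rc_unit * rc_unit)"
    by simp
  then have "(of_real (a * a) :: 'k) = of_real (- (b * b))"
    by (simp add: u)
  then have "a * a = - (b * b)"
    by (simp only: of_real_eq_iff)
  then have "a * a + b * b = 0" by simp
  then show ?thesis by (simp add: sum_squares_eq_zero_iff)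
qed

lemma rc_decomp': "(z::'k::real_or_complex) = of_real (rc_re z) + of_real (rc_im z) * rc_unit"
  using rc_decomp[of z] by (simp add: scaleR_conv_of_real)

lemma rc_re_eqI:
  fixes z :: "'k::real_or_complex"
  assumes "z = of_real a + of_real b * rc_unit"
  shows "rc_re z = a"
proof (cases "(rc_unit::'k) = 0")
  case True
  then have "(of_real (rc_re z) :: 'k) = of_real a"
    using rc_decomp'[of z] assms by simp
  then show ?thesis by (simp only: of_real_eq_iff)
next
  case False
  then have u: "rc_unit * rc_unit = (- 1 :: 'k)" using rc_unit_cases by blast
  have "of_real (rc_re z) + of_real (rc_im z) * rc_unit = of_real a + of_real b * (rc_unit::'k)"
    using assms rc_decomp'[of z] by simp
  then have "of_real (rc_re z - a) + of_real (rc_im z - b) * rc_unit = (0::'k)"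
    by (simp add: algebra_simps)
  from rc_basis_indep[OF u this] show ?thesis by simp
qed

lemma linear_rc_re: "linear (rc_re :: 'k::real_or_complex \<Rightarrow> real)"
proof
  fix x y :: 'k and r :: real
  show "rc_re (x + y) = rc_re x + rc_re y"
  proof (rule rc_re_eqI)
    show "x + y = of_real (rc_re x + rc_re y) + of_real (rc_im x + rc_im y) * rc_unit"
      using rc_decomp'[of x] rc_decomp'[of y] by (simp add: algebra_simps)
  qed
  show "rc_re (r *\<^sub>R x) = r *\<^sub>R rc_re x"
  proof (rule rc_re_eqI)
    have "r *\<^sub>R x = of_real r * (of_real (rc_re x) + of_real (rc_im x) * rc_unit)"
      using rc_decomp'[of x] by (simp add: scaleR_conv_of_real)
    then show "r *\<^sub>R x = of_real (r *\<^sub>R rc_re x) + of_real (r * rc_im x) * rc_unit"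
      by (simp add: algebra_simps)
  qed
qed

lemmas rc_re_add [simp] = linear_add[OF linear_rc_re]
  and rc_re_diff [simp] = linear_diff[OF linear_rc_re]
  and rc_re_minus [simp] = linear_neg[OF linear_rc_re]
  and rc_re_0 [simp] = linear_0[OF linear_rc_re]
  and rc_re_scaleR [simp] = linear_scale[OF linear_rc_re]

lemma rc_re_of_real [simp]: "rc_re (of_real r :: 'k::real_or_complex) = r"
  by (rule rc_re_eqI[where b = 0]) simp

lemma rc_re_1 [simp]: "rc_re (1 :: 'k::real_or_complex) = 1"
  using rc_re_of_real[of 1, where 'k = 'k] by simp

lemma rc_re_of_real_mult [simp]: "rc_re (of_real r * z :: 'k::real_or_complex) = r * rc_re z"
  by (simp flip: scaleR_conv_of_real)

text \<open>Multiplicativity of the norm makes \<open>1\<close> and \<open>rc_unit\<close> orthonormal: for \<open>i = rc_unit\<close> the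
  numbers \<open>\<bar>1 + i\<bar>\<^sup>2\<close> and \<open>\<bar>1 - i\<bar>\<^sup>2\<close> have sum \<open>4\<close> (parallelogram law) and product \<open>4\<close>.\<close>

lemma inner_1_rc_unit:
  assumes u: "rc_unit * rc_unit = (- 1 :: 'k::real_or_complex)"
  shows "inner 1 (rc_unit::'k) = 0"
proof -
  let ?u = "rc_unit :: 'k"
  have "norm ?u * norm ?u = 1"
    by (metis u norm_minus_cancel norm_mult norm_one)
  then have nu: "inner ?u ?u = 1"
    by (simp add: dot_square_norm power2_eq_square)
  have n1: "inner 1 (1::'k) = 1"
    by (simp add: dot_square_norm)
  have "(1 + ?u) * (1 - ?u) = 2"
    using u by (simp add: algebra_simps)
  then have "norm (1 + ?u) * norm (1 - ?u) = 2"
    by (metis norm_mult norm_numeral)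
  then have "(norm (1 + ?u))\<^sup>2 * (norm (1 - ?u))\<^sup>2 = 4"
    by (simp flip: power_mult_distrib)
  moreover have "(norm (1 + ?u))\<^sup>2 = 2 + 2 * inner 1 ?u"
    using nu n1 by (simp add: power2_norm_eq_inner inner_simps inner_commute)
  moreover have "(norm (1 - ?u))\<^sup>2 = 2 - 2 * inner 1 ?u"
    using nu n1 by (simp add: power2_norm_eq_inner inner_simps inner_commute)
  ultimately show ?thesis
    by (simp add: algebra_simps)
qed

lemma inner_1_eq_rc_re: "inner 1 z = rc_re (z::'k::real_or_complex)"
proof -
  have n1: "inner 1 (1::'k) = 1"
    by (simp add: dot_square_norm)
  show ?thesis
  proof (cases "(rc_unit::'k) = 0")
    case True
    show ?thesis
      by (subst rc_decomp[of z]) (simp add: inner_simps n1 True)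
  next
    case False
    then have u: "rc_unit * rc_unit = (- 1 :: 'k)" using rc_unit_cases by blast
    show ?thesis
      by (subst rc_decomp[of z]) (simp add: inner_simps inner_1_rc_unit[OF u] n1)
  qed
qed

lemma rc_re_le_norm: "\<bar>rc_re z\<bar> \<le> norm (z::'k::real_or_complex)"
  using Cauchy_Schwarz_ineq2[of 1 z] by (simp add: inner_1_eq_rc_re)

lemma rc_re_le: "rc_re z \<le> norm (z::'k::real_or_complex)"
  using rc_re_le_norm[of z] by simp

lemma rc_re_ge: "- norm z \<le> rc_re (z::'k::real_or_complex)"
  using rc_re_le_norm[of z] by simp

lemma ex_unit_rotation:
  fixes z :: "'k::real_or_complex"
  obtains c :: 'k where "norm c = 1" "c * z = of_real (norm z)"
proof (cases "z = 0")
  case True then show ?thesis using that[of 1] by simp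
next
  case False
  then show ?thesis using that[of "of_real (norm z) / z"] by (simp add: norm_divide)
qed

lemma norm_diff_1_sq_le:
  fixes z :: "'k::real_or_complex"
  assumes "norm z \<le> 1" "rc_re z \<ge> 1 - \<alpha>"
  shows "(norm (z - 1))\<^sup>2 \<le> 2 * \<alpha>"
proof -
  have n1: "inner 1 (1::'k) = 1"
    by (simp add: dot_square_norm)
  have "(norm (z - 1))\<^sup>2 = (norm z)\<^sup>2 + 1 - 2 * rc_re z"
    using inner_1_eq_rc_re[of z] by (simp add: power2_norm_eq_inner inner_simps inner_commute n1)
  moreover have "(norm z)\<^sup>2 \<le> 1"
    using assms(1) by (simp add: power_le_one)
  ultimately show ?thesis using assms(2) by simp
qed

lemma eq_1_if_rc_re_eq_1:
  fixes z :: "'k::real_or_complex"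
  assumes "norm z \<le> 1" "rc_re z = 1"
  shows "z = 1"
  using norm_diff_1_sq_le[of z 0] assms by simp

text \<open>Every real-linear functional on the scalar field is the real part of a multiplication; this turns
  separating hyperplanes in \<open>'k \<times> 'k\<close> into functionals that are linear over \<open>'k\<close>.\<close>

lemma real_functional_rep:
  fixes l :: "'k::real_or_complex \<Rightarrow> real"
  assumes "linear l"
  obtains \<alpha> where "\<And>z. l z = rc_re (\<alpha> * z)"
proof
  fix z :: 'k
  let ?\<alpha> = "of_real (l 1) - of_real (l rc_unit) * rc_unit :: 'k"
  have lz: "l z = rc_re z * l 1 + rc_im z * l rc_unit"
    by (subst rc_decomp[of z]) (simp only: linear_add[OF assms] linear_scale[OF assms] real_scaleR_def)
  have "?\<alpha> * z = ?\<alpha> * (of_real (rc_re z) + of_real (rc_im z) * rc_unit)"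
    by (subst rc_decomp'[of z]) (rule refl)
  also have "\<dots> = of_real (l 1 * rc_re z)
      + of_real (l 1 * rc_im z - l rc_unit * rc_re z) * rc_unit
      - of_real (l rc_unit * rc_im z) * (rc_unit * rc_unit)"
    by (simp add: algebra_simps)
  finally have e: "?\<alpha> * z = \<dots>" .
  show "l z = rc_re (?\<alpha> * z)"
  proof (cases "(rc_unit::'k) = 0")
    case True
    then have "l rc_unit = 0" using linear_0[OF assms] by simp
    then show ?thesis using lz True by (simp add: mult.commute[of "rc_re z"])
  next
    case False
    then have u: "rc_unit * rc_unit = (- 1 :: 'k)" using rc_unit_cases by blast
    have "?\<alpha> * z = of_real (l 1 * rc_re z + l rc_unit * rc_im z)
       + of_real (l 1 * rc_im z - l rc_unit * rc_re z) * rc_unit"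
      unfolding e u by simp
    from rc_re_eqI[OF this] lz show ?thesis by (simp add: mult.commute)
  qed
qed

section \<open>Extreme linear functionals below a sublinear one\<close>

definition sublinear :: "('a::real_vector \<Rightarrow> real) \<Rightarrow> bool" where
  "sublinear p \<longleftrightarrow> (\<forall>x y. p (x + y) \<le> p x + p y) \<and> (\<forall>t\<ge>0. \<forall>x. p (t *\<^sub>R x) = t * p x)"

lemma sublinearD:
  assumes "sublinear p"
  shows sublinear_add: "p (x + y) \<le> p x + p y"
    and sublinear_scale: "t \<ge> 0 \<Longrightarrow> p (t *\<^sub>R x) = t * p x"
    and sublinear_0: "p 0 = 0" and sublinear_neg: "- p (- x) \<le> p x"
proof -
  show "p (x + y) \<le> p x + p y" "t \<ge> 0 \<Longrightarrow> p (t *\<^sub>R x) = t * p x"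
    using assms by (auto simp: sublinear_def)
  have "p (0 *\<^sub>R 0) = 0 * p 0" using assms unfolding sublinear_def by blast
  then show 0: "p 0 = 0" by simp
  have "p (x + - x) \<le> p x + p (- x)" using assms unfolding sublinear_def by blast
  then show "- p (- x) \<le> p x" by (simp add: 0)
qed

text \<open>Pointwise infima are not sublinear in general; the two hypotheses on sums and positive multiples
  express that the family is directed enough.\<close>

lemma sublinearI_INF:
  assumes ne: "I \<noteq> {}"
    and bdd: "\<And>x i. i \<in> I \<Longrightarrow> b x \<le> q i x"
    and add: "\<And>i j x y. i \<in> I \<Longrightarrow> j \<in> I \<Longrightarrow> \<exists>k\<in>I. q k (x + y) \<le> q i x + q j y"
    and scale: "\<And>i t x. i \<in> I \<Longrightarrow> t > 0 \<Longrightarrow> \<exists>k\<in>I. q k (t *\<^sub>R x) \<le> t * q i x"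
    and zero: "(INF i\<in>I. q i 0) = (0::real)"
  shows "sublinear (\<lambda>x. INF i\<in>I. q i x)"
proof -
  have bb: "bdd_below ((\<lambda>i. q i x) ` I)" for x
    by (rule bdd_belowI2[where m = "b x"]) (rule bdd)
  have addI: "(INF i\<in>I. q i (x + y)) \<le> (INF i\<in>I. q i x) + (INF i\<in>I. q i y)" for x y
  proof -
    have "(INF i\<in>I. q i (x + y)) - q j y \<le> (INF i\<in>I. q i x)" if j: "j \<in> I" for j
    proof (rule cINF_greatest[OF ne])
      fix i assume "i \<in> I"
      then obtain k where "k \<in> I" "q k (x + y) \<le> q i x + q j y" using add j by blast
      then show "(INF i\<in>I. q i (x + y)) - q j y \<le> q i x"
        using cINF_lower[OF bb, of k "x + y"] by linarith
    qed
    then have "(INF i\<in>I. q i (x + y)) - (INF i\<in>I. q i x) \<le> q j y" if "j \<in> I" for j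
      using that by (simp add: algebra_simps)
    then have "(INF i\<in>I. q i (x + y)) - (INF i\<in>I. q i x) \<le> (INF j\<in>I. q j y)"
      by (rule cINF_greatest[OF ne])
    then show ?thesis by simp
  qed
  have le: "(INF i\<in>I. q i (t *\<^sub>R x)) \<le> t * (INF i\<in>I. q i x)" if "t > 0" for t x
  proof -
    have "(INF i\<in>I. q i (t *\<^sub>R x)) / t \<le> (INF i\<in>I. q i x)"
    proof (rule cINF_greatest[OF ne])
      fix i assume "i \<in> I"
      then obtain k where "k \<in> I" "q k (t *\<^sub>R x) \<le> t * q i x" using scale \<open>t > 0\<close> by blast
      then show "(INF i\<in>I. q i (t *\<^sub>R x)) / t \<le> q i x"
        using cINF_lower[OF bb, of k "t *\<^sub>R x"] \<open>t > 0\<close> by (simp add: field_simps)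
    qed
    then show ?thesis using \<open>t > 0\<close> by (simp add: field_simps)
  qed
  have "(INF i\<in>I. q i (t *\<^sub>R x)) = t * (INF i\<in>I. q i x)" if "t \<ge> 0" for t x
  proof (cases "t = 0")
    case True then show ?thesis using zero by simp
  next
    case False
    then have "t > 0" using that by simp
    moreover have "(INF i\<in>I. q i ((1 / t) *\<^sub>R (t *\<^sub>R x))) \<le> (1 / t) * (INF i\<in>I. q i (t *\<^sub>R x))"
      by (rule le) (use \<open>t > 0\<close> in simp)
    then have "(INF i\<in>I. q i x) \<le> (1 / t) * (INF i\<in>I. q i (t *\<^sub>R x))"
      using \<open>t > 0\<close> by simp
    ultimately show ?thesis using le[of t x] by (simp add: field_simps)
  qed
  then show ?thesis using addI by (auto simp: sublinear_def)
qed

text \<open>The support functional of the face on which evaluation at \<open>y\<close> attains \<open>q y\<close>.\<close>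

definition face_sublinear :: "('a::real_vector \<Rightarrow> real) \<Rightarrow> 'a \<Rightarrow> 'a \<Rightarrow> real" where
  "face_sublinear q y x = (INF t\<in>{0..}. q (x + t *\<^sub>R y) - t * q y)"

context
  fixes q :: "'a::real_vector \<Rightarrow> real"
  assumes q: "sublinear q"
begin

lemma face_sublinear_lower: "t \<ge> 0 \<Longrightarrow> - q (- x) \<le> q (x + t *\<^sub>R y) - t * q y"
  using sublinear_add[OF q, of "x + t *\<^sub>R y" "- x"] sublinear_scale[OF q, of t y]
  by (simp add: algebra_simps)

lemma face_sublinear_le: "t \<ge> 0 \<Longrightarrow> face_sublinear q y x \<le> q (x + t *\<^sub>R y) - t * q y"
  unfolding face_sublinear_def
  by (rule cINF_lower) (auto intro: bdd_belowI2 face_sublinear_lower)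

lemma face_sublinear_le_self: "face_sublinear q y x \<le> q x"
  using face_sublinear_le[of 0] by simp

lemma face_sublinear_neg: "face_sublinear q y (- y) \<le> - q y"
  using face_sublinear_le[of 1 y "- y"] sublinear_0[OF q] by simp

lemma sublinear_face_sublinear: "sublinear (face_sublinear q y)"
  unfolding face_sublinear_def
proof (rule sublinearI_INF)
  fix x x' :: 'a and s t :: real
  show "s \<in> {0..} \<Longrightarrow> - q (- x) \<le> q (x + s *\<^sub>R y) - s * q y"
    by (simp add: face_sublinear_lower)
  show "\<exists>k\<in>{0..}. q (x + x' + k *\<^sub>R y) - k * q y
      \<le> q (x + s *\<^sub>R y) - s * q y + (q (x' + t *\<^sub>R y) - t * q y)" if "s \<in> {0..}" "t \<in> {0..}"
    using that sublinear_add[OF q, of "x + s *\<^sub>R y" "x' + t *\<^sub>R y"]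
    by (intro bexI[of _ "s + t"]) (auto simp: algebra_simps)
  show "\<exists>k\<in>{0..}. q (t *\<^sub>R x + k *\<^sub>R y) - k * q y \<le> t * (q (x + s *\<^sub>R y) - s * q y)"
    if "s \<in> {0..}" "t > 0"
    using that sublinear_scale[OF q, of t "x + s *\<^sub>R y"]
    by (intro bexI[of _ "t * s"]) (auto simp: algebra_simps)
  have "(INF t\<in>{0..}. q (0 + t *\<^sub>R y) - t * q y) = (INF t\<in>{0::real..}. 0)"
    by (rule INF_cong) (auto simp: sublinear_scale[OF q])
  then show "(INF t\<in>{0..}. q (0 + t *\<^sub>R y) - t * q y) = 0" by simp
qed simp

end

text \<open>A face of the set of linear functionals below \<open>p\<close>, described by its support functional.\<close>

definition sublinear_face :: "('a::real_vector \<Rightarrow> real) \<Rightarrow> ('a \<Rightarrow> real) \<Rightarrow> bool" where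
  "sublinear_face p q \<longleftrightarrow> sublinear q \<and> q \<le> p \<and>
    (\<forall>g h \<theta>. linear g \<longrightarrow> linear h \<longrightarrow> g \<le> p \<longrightarrow> h \<le> p \<longrightarrow> 0 < \<theta> \<longrightarrow> \<theta> < 1 \<longrightarrow>
      (\<forall>x. (1 - \<theta>) * g x + \<theta> * h x \<le> q x) \<longrightarrow> g \<le> q \<and> h \<le> q)"

lemma sublinear_face_self: "sublinear p \<Longrightarrow> sublinear_face p p"
  by (auto simp: sublinear_face_def)

text \<open>A face of a face is a face, on the level of support functionals.\<close>

lemma sublinear_face_face:
  assumes "sublinear_face p q"
  shows "sublinear_face p (face_sublinear q y)"
  unfolding sublinear_face_def
proof (intro conjI allI impI)
  have q: "sublinear q" using assms by (simp add: sublinear_face_def)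
  show "sublinear (face_sublinear q y)" by (rule sublinear_face_sublinear[OF q])
  show "face_sublinear q y \<le> p"
    using assms face_sublinear_le_self[OF q] unfolding sublinear_face_def le_fun_def
    by (meson order_trans)
  fix g h \<theta>
  assume gh: "linear g" "linear h" "g \<le> p" "h \<le> p" "0 < \<theta>" "\<theta> < (1::real)"
    and le: "\<forall>x. (1 - \<theta>) * g x + \<theta> * h x \<le> face_sublinear q y x"
  have "\<forall>x. (1 - \<theta>) * g x + \<theta> * h x \<le> q x"
    using le face_sublinear_le_self[OF q] by (meson order_trans)
  then have gq: "g \<le> q" "h \<le> q" using assms gh unfolding sublinear_face_def by blast+
  \<comment> \<open>A convex combination of \<open>g y, h y \<le> q y\<close> equals \<open>q y\<close>, so both do.\<close>
  have "(1 - \<theta>) * g y + \<theta> * h y \<ge> q y"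
    using le[rule_format, of "- y"] face_sublinear_neg[OF q, of y] gh
    by (simp add: linear_neg)
  then have "(1 - \<theta>) * (q y - g y) + \<theta> * (q y - h y) \<le> 0" by (simp add: algebra_simps)
  moreover have "(1 - \<theta>) * (q y - g y) \<ge> 0" "\<theta> * (q y - h y) \<ge> 0"
    using gq gh by (auto simp: le_fun_def)
  ultimately have "(1 - \<theta>) * (q y - g y) = 0" "\<theta> * (q y - h y) = 0" by linarith+
  then have y: "g y = q y" "h y = q y" using gh by auto
  have *: "k \<le> face_sublinear q y" if "linear k" "k \<le> q" "k y = q y" for k :: "'a \<Rightarrow> real"
    unfolding le_fun_def face_sublinear_def
  proof (intro allI cINF_greatest)
    fix x and t :: real
    show "k x \<le> q (x + t *\<^sub>R y) - t * q y"
      using le_funD[OF that(2), of "x + t *\<^sub>R y"] that(1,3)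
      by (simp add: linear_add linear_scale)
  qed simp
  show "g \<le> face_sublinear q y" "h \<le> face_sublinear q y"
    using * gh gq y by auto
qed

lemma sublinear_chain_Inf:
  assumes ne: "C \<noteq> {}" and C: "\<And>q. q \<in> C \<Longrightarrow> sublinear_face p q"
    and chain: "\<And>q q'. q \<in> C \<Longrightarrow> q' \<in> C \<Longrightarrow> q \<le> q' \<or> q' \<le> q"
  shows "sublinear_face p (\<lambda>x. INF q\<in>C. q x)"
    and "q \<in> C \<Longrightarrow> (\<lambda>x. INF q\<in>C. q x) \<le> q"
proof -
  have lin: "sublinear q" if "q \<in> C" for q using C[OF that] by (simp add: sublinear_face_def)
  have low: "- p (- x) \<le> q x" if "q \<in> C" for q x
    using C[OF that] sublinear_neg[OF lin[OF that], of x]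
    by (auto simp: sublinear_face_def le_fun_def intro: order_trans[rotated])
  have bb: "bdd_below ((\<lambda>q. q x) ` C)" for x
    by (rule bdd_belowI2[where m = "- p (- x)"]) (rule low)
  have le: "(\<lambda>x. INF q\<in>C. q x) \<le> q" if "q \<in> C" for q
    using cINF_lower[OF bb that] by (simp add: le_fun_def)
  then show "q \<in> C \<Longrightarrow> (\<lambda>x. INF q\<in>C. q x) \<le> q" .
  show "sublinear_face p (\<lambda>x. INF q\<in>C. q x)"
    unfolding sublinear_face_def
  proof (intro conjI allI impI)
    show "sublinear (\<lambda>x. INF q\<in>C. q x)"
    proof (rule sublinearI_INF[OF ne low])
      fix q q' and x y :: 'a
      assume qs: "q \<in> C" "q' \<in> C"
      show "\<exists>k\<in>C. k (x + y) \<le> q x + q' y"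
        using chain[OF qs]
      proof
        assume "q \<le> q'"
        then show ?thesis using sublinear_add[OF lin[OF qs(1)], of x y] qs
          by (intro bexI[of _ q]) (auto simp: le_fun_def intro: order_trans add_left_mono)
      next
        assume "q' \<le> q"
        then show ?thesis using sublinear_add[OF lin[OF qs(2)], of x y] qs
          by (intro bexI[of _ q']) (auto simp: le_fun_def intro: order_trans add_right_mono)
      qed
    next
      have "(INF q\<in>C. q 0) = (INF q\<in>C. 0)"
        by (rule INF_cong) (auto simp: sublinear_0[OF lin])
      then show "(INF q\<in>C. q 0) = 0" using ne by simp
    qed (use sublinear_scale[OF lin] in \<open>auto intro!: bexI\<close>)
    obtain q where "q \<in> C" using ne by blast
    then show "(\<lambda>x. INF q\<in>C. q x) \<le> p" using le C unfolding sublinear_face_def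
      by (meson order_trans)
    fix g h \<theta>
    assume gh: "linear g" "linear h" "g \<le> p" "h \<le> p" "0 < \<theta>" "\<theta> < (1::real)"
      and m: "\<forall>x. (1 - \<theta>) * g x + \<theta> * h x \<le> (INF q\<in>C. q x)"
    have *: "g \<le> q \<and> h \<le> q" if "q \<in> C" for q
    proof -
      have "\<forall>x. (1 - \<theta>) * g x + \<theta> * h x \<le> q x" using m le[OF that] unfolding le_fun_def
        by (meson order_trans)
      then show ?thesis using C[OF that] gh unfolding sublinear_face_def by blast
    qed
    show "g \<le> (\<lambda>x. INF q\<in>C. q x)" "h \<le> (\<lambda>x. INF q\<in>C. q x)"
      unfolding le_fun_def using * by (auto intro!: cINF_greatest[OF ne] simp: le_fun_def)
  qed
qed

text \<open>If no face lowers \<open>q\<close>, then \<open>q(x) \<le> q(x + y) - q(y)\<close>, so \<open>q\<close> is additive.\<close>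

lemma linear_if_sublinear_minimal:
  assumes q: "sublinear q" and min: "\<And>y. face_sublinear q y = q"
  shows "linear q"
proof -
  have add: "q (x + y) = q x + q y" for x y
  proof (rule antisym)
    show "q (x + y) \<le> q x + q y" by (rule sublinear_add[OF q])
    show "q x + q y \<le> q (x + y)"
      using face_sublinear_le[OF q, of 1 y x] by (simp add: min)
  qed
  have neg: "q (- x) = - q x" for x
    using add[of x "- x"] sublinear_0[OF q] by simp
  show ?thesis
  proof
    fix r x
    show "q (r *\<^sub>R x) = r *\<^sub>R q x"
    proof (cases "r \<ge> 0")
      case True then show ?thesis using sublinear_scale[OF q] by simp
    next
      case False
      then have "q ((- r) *\<^sub>R x) = (- r) * q x" using sublinear_scale[OF q, of "- r" x] by simp
      then show ?thesis using neg[of "r *\<^sub>R x"] by simp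
    qed
  qed (rule add)
qed

text \<open>One application of Zorn's lemma gives both the Hahn-Banach theorem and the extremality that
  the Krein-Milman theorem would add: a minimal face of the set of linear functionals below \<open>p\<close>
  has a support functional that no directional derivative can lower, so that functional is
  linear, and the face is a single extreme point.\<close>

theorem extreme_linear_below_sublinear:
  fixes p :: "'a::real_vector \<Rightarrow> real"
  assumes p: "sublinear p"
  obtains f where "linear f" "f \<le> p" "f x0 = p x0"
    "\<And>g h \<theta>. \<lbrakk>linear g; linear h; g \<le> p; h \<le> p; 0 < \<theta>; \<theta> < 1;
       \<And>x. (1 - \<theta>) * g x + \<theta> * h x = f x\<rbrakk> \<Longrightarrow> g = f \<and> h = f"
proof -
  define A where "A = {q. sublinear_face p q \<and> q \<le> face_sublinear p x0}"
  have x0A: "face_sublinear p x0 \<in> A"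
    using sublinear_face_face[OF sublinear_face_self[OF p]] by (simp add: A_def)
  have "\<exists>m\<in>A. \<forall>a\<in>A. a \<le> m \<longrightarrow> a = m"
  proof (rule predicate_Zorn[where P = "\<lambda>m a. a \<le> m"])
    show "partial_order_on A (relation_of (\<lambda>m a. a \<le> m) A)"
      by (rule partial_order_on_relation_ofI) auto
    fix C assume C: "C \<in> Chains (relation_of (\<lambda>m a. a \<le> m) A)"
    show "\<exists>u\<in>A. \<forall>a\<in>C. u \<le> a"
    proof (cases "C = {}")
      case True then show ?thesis using x0A by auto
    next
      case False
      have CA: "C \<subseteq> A" by (rule Chains_relation_of[OF C])
      have ch: "\<And>q q'. q \<in> C \<Longrightarrow> q' \<in> C \<Longrightarrow> q \<le> q' \<or> q' \<le> q"
        using C by (auto simp: Chains_def relation_of_def)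
      have sf: "\<And>q. q \<in> C \<Longrightarrow> sublinear_face p q" using CA by (auto simp: A_def)
      note I = sublinear_chain_Inf[OF False sf ch]
      obtain q where "q \<in> C" using False by blast
      then have "(\<lambda>x. INF q\<in>C. q x) \<le> face_sublinear p x0"
        using I(2)[of q] CA by (auto simp: A_def intro: order_trans)
      then show ?thesis using I by (intro bexI[of _ "\<lambda>x. INF q\<in>C. q x"]) (auto simp: A_def)
    qed
  qed
  then obtain f where f: "f \<in> A" and min: "\<And>a. a \<in> A \<Longrightarrow> a \<le> f \<Longrightarrow> a = f" by blast
  have sf: "sublinear_face p f" using f by (simp add: A_def)
  then have s: "sublinear f" and fp: "f \<le> p" by (auto simp: sublinear_face_def)
  have le: "face_sublinear f y \<le> f" for y
    using face_sublinear_le_self[OF s] by (simp add: le_fun_def)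
  have "face_sublinear f y = f" for y
    using f le[of y] by (intro min) (auto simp: A_def intro: sublinear_face_face order_trans)
  then have lin: "linear f" by (rule linear_if_sublinear_minimal[OF s])
  have eq_if_le: "g = f" if "linear g" "g \<le> f" for g
  proof
    fix x show "g x = f x"
      using le_funD[OF that(2), of x] le_funD[OF that(2), of "- x"]
      by (simp add: linear_neg[OF lin] linear_neg[OF that(1)])
  qed
  show ?thesis
  proof (rule that[OF lin fp])
    have "f (- x0) \<le> - p x0"
      using f face_sublinear_neg[OF p, of x0] by (auto simp: A_def le_fun_def intro: order_trans)
    then show "f x0 = p x0" using le_funD[OF fp, of x0] by (simp add: linear_neg[OF lin])
    fix g h \<theta>
    assume "linear g" "linear h" "g \<le> p" "h \<le> p" "0 < \<theta>" "\<theta> < (1::real)"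
       "\<And>x. (1 - \<theta>) * g x + \<theta> * h x = f x"
    then show "g = f \<and> h = f" using sf eq_if_le unfolding sublinear_face_def
      by (metis order_refl)
  qed
qed

section \<open>The dual of a normed space over the scalar field\<close>

definition dual_scale :: "'k::real_normed_algebra \<Rightarrow> ('a::real_normed_vector \<Rightarrow>\<^sub>L 'k) \<Rightarrow> ('a \<Rightarrow>\<^sub>L 'k)" where
  "dual_scale c f = blinfun_mult_right c o\<^sub>L f"

lemma dual_scale_apply [simp]: "blinfun_apply (dual_scale c f) x = c * blinfun_apply f x"
  by (simp add: dual_scale_def)

lemma norm_dual_scale [simp]:
  fixes f :: "'a::real_normed_vector \<Rightarrow>\<^sub>L 'k::real_normed_field"
  shows "norm (dual_scale c f) = norm c * norm f"
proof (rule antisym)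
  have le: "norm (dual_scale c f) \<le> norm c * norm f" for c :: 'k and f :: "'a \<Rightarrow>\<^sub>L 'k"
    by (rule norm_blinfun_bound)
      (auto simp: norm_mult mult.assoc intro!: mult_left_mono norm_blinfun)
  then show "norm (dual_scale c f) \<le> norm c * norm f" .
  show "norm c * norm f \<le> norm (dual_scale c f)"
  proof (cases "c = 0")
    case False
    have "dual_scale (inverse c) (dual_scale c f) = f"
      by (rule blinfun_eqI) (use False in simp)
    then have "norm f \<le> norm (inverse c) * norm (dual_scale c f)"
      using le[of "inverse c" "dual_scale c f"] by simp
    then show ?thesis using False by (simp add: norm_divide field_simps)
  qed simp
qed

lemma dual_scale_simps [simp]:
  fixes f :: "'a::real_normed_vector \<Rightarrow>\<^sub>L 'k::real_normed_field"
  shows "dual_scale 0 f = 0" "dual_scale 1 f = f" "dual_scale c 0 = 0"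
    "dual_scale c (dual_scale d f) = dual_scale (c * d) f"
    "dual_scale (of_real r) f = r *\<^sub>R f"
  by (auto intro!: blinfun_eqI simp: blinfun.bilinear_simps scaleR_conv_of_real)

context normed_space_over
begin

lemma smul_scaleR: "smul (of_real r * c) x = r *\<^sub>R smul c x"
  by (simp add: smul_of_real flip: scale_scale)

lemma smul_commute_scaleR: "smul c (r *\<^sub>R x) = r *\<^sub>R smul c x"
  by (simp flip: smul_of_real add: scale_left_commute)

lemma dual_spaceD: "f \<in> dual_space smul \<Longrightarrow> blinfun_apply f (smul c x) = c * blinfun_apply f x"
  by (simp add: dual_space_def)

lemma dual_space_intros [simp, intro]:
  "0 \<in> dual_space smul"
  "f \<in> dual_space smul \<Longrightarrow> g \<in> dual_space smul \<Longrightarrow> f + g \<in> dual_space smul"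
  "f \<in> dual_space smul \<Longrightarrow> g \<in> dual_space smul \<Longrightarrow> f - g \<in> dual_space smul"
  "f \<in> dual_space smul \<Longrightarrow> r *\<^sub>R f \<in> dual_space smul"
  "f \<in> dual_space smul \<Longrightarrow> dual_scale c f \<in> dual_space smul"
  by (auto simp: dual_space_def blinfun.bilinear_simps algebra_simps)

lemma dual_ball_iff: "f \<in> dual_ball smul \<longleftrightarrow> f \<in> dual_space smul \<and> norm f \<le> 1"
  by (simp add: dual_ball_def)

lemma norm_le_if_rc_re_le:
  assumes f: "f \<in> dual_space smul" and "r \<ge> 0"
    and le: "\<And>x. norm x \<le> 1 \<Longrightarrow> rc_re (blinfun_apply f x) \<le> r"
  shows "norm f \<le> r"
proof (rule norm_blinfun_bound[OF \<open>r \<ge> 0\<close>])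
  fix x
  obtain c where c: "norm c = 1" "c * blinfun_apply f x = of_real (norm (blinfun_apply f x))"
    by (rule ex_unit_rotation)
  show "norm (blinfun_apply f x) \<le> r * norm x"
  proof (cases "x = 0")
    case False
    let ?y = "(1 / norm x) *\<^sub>R smul c x"
    have "blinfun_apply f ?y = of_real (norm (blinfun_apply f x) / norm x)"
      by (simp add: blinfun.scaleR_right dual_spaceD[OF f] c scaleR_conv_of_real)
    moreover have "norm ?y \<le> 1" using False by (simp add: norm_smul c)
    ultimately have "norm (blinfun_apply f x) / norm x \<le> r" using le[of ?y] by (simp only: rc_re_of_real)
    then show ?thesis using False by (simp add: field_simps)
  qed (simp add: blinfun.zero_right)
qed

lemma obtain_almost_norming:
  assumes f: "f \<in> dual_space smul" and r: "r < norm f"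
  obtains x where "norm x \<le> 1" "r < rc_re (blinfun_apply f x)"
proof (cases "r < 0")
  case True then show ?thesis using that[of 0] by (simp add: blinfun.zero_right)
next
  case False
  then show ?thesis using norm_le_if_rc_re_le[OF f, of r] r that by (meson leD le_less_linear)
qed

lemma dual_eq_if_rc_re_eq:
  assumes f: "f \<in> dual_space smul" and g: "g \<in> dual_space smul"
    and eq: "\<And>x. rc_re (blinfun_apply f x) = rc_re (blinfun_apply g x)"
  shows "f = g"
proof -
  have "norm (f - g) \<le> 0"
    by (rule norm_le_if_rc_re_le) (use f g eq in \<open>auto simp: blinfun.diff_left\<close>)
  then show ?thesis by simp
qed

text \<open>The classical formula \<open>f(x) = l(x) - i l(ix)\<close> covers both scalar fields, since \<open>rc_unit = 0\<close> in the
  real case. Rotating \<open>f(x)\<close> onto the positive axis gives the norm bound.\<close>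

lemma complexify_functional:
  assumes lin: "linear (l :: 'a \<Rightarrow> real)" and le: "\<And>x. l x \<le> norm x"
  obtains f where "f \<in> dual_ball smul" "\<And>x. rc_re (blinfun_apply f x) = l x"
proof -
  define F :: "'a \<Rightarrow> 'k" where "F x = of_real (l x) - rc_unit * of_real (l (smul rc_unit x))" for x
  have re: "rc_re (F x) = l x" for x
    by (rule rc_re_eqI[where b = "- l (smul rc_unit x)"]) (simp add: F_def mult.commute)
  have add: "F (x + y) = F x + F y" for x y
    by (simp add: F_def linear_add[OF lin] scale_right_distrib algebra_simps)
  have real: "F (r *\<^sub>R x) = r *\<^sub>R F x" for r x
    by (simp add: F_def smul_commute_scaleR linear_scale[OF lin] scaleR_conv_of_real algebra_simps)
  have unit: "F (smul rc_unit x) = rc_unit * F x" for x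
  proof (cases "(rc_unit::'k) = 0")
    case True
    then show ?thesis by (simp add: F_def linear_0[OF lin])
  next
    case False
    then have u: "rc_unit * rc_unit = (- 1 :: 'k)" using rc_unit_cases by blast
    have "smul (rc_unit * rc_unit) x = - x" unfolding u by (simp add: scale_minus_left)
    then have 1: "l (smul rc_unit (smul rc_unit x)) = - l x"
      by (simp add: linear_neg[OF lin])
    have "rc_unit * F x = rc_unit * of_real (l x) - (rc_unit * rc_unit) * of_real (l (smul rc_unit x))"
      by (simp add: F_def algebra_simps)
    then show ?thesis unfolding u by (simp add: F_def 1 del: scale_scale)
  qed
  have hom: "F (smul c x) = c * F x" for c x
  proof -
    have "smul c x = smul (of_real (rc_re c)) x + smul (of_real (rc_im c) * rc_unit) x"
      by (subst rc_decomp'[of c]) (rule scale_left_distrib)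
    then have "F (smul c x) = rc_re c *\<^sub>R F x + rc_im c *\<^sub>R (rc_unit * F x)"
      by (simp only: add real smul_of_real smul_scaleR unit)
    also have "\<dots> = (of_real (rc_re c) + of_real (rc_im c) * rc_unit) * F x"
      by (simp add: scaleR_conv_of_real algebra_simps)
    finally show ?thesis by (simp flip: rc_decomp')
  qed
  have bd: "norm (F x) \<le> norm x" for x
  proof -
    obtain c where c: "norm c = 1" "c * F x = of_real (norm (F x))"
      by (rule ex_unit_rotation)
    have "norm (F x) = rc_re (F (smul c x))" by (simp add: hom c)
    also have "\<dots> \<le> norm (smul c x)" by (simp add: re le)
    finally show ?thesis by (simp add: norm_smul c)
  qed
  have bl: "bounded_linear F"
    by (rule bounded_linear_intro[where K = 1]) (auto simp: add real bd)
  show ?thesis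
  proof (rule that[of "Blinfun F"])
    show "Blinfun F \<in> dual_ball smul"
      by (auto simp: dual_ball_iff dual_space_def bounded_linear_Blinfun_apply[OF bl] hom
          intro!: norm_blinfun_bound bd)
  qed (simp add: bounded_linear_Blinfun_apply[OF bl] re)
qed

lemma sublinear_norm: "sublinear (norm :: 'a \<Rightarrow> real)"
  by (auto simp: sublinear_def norm_triangle_ineq)

text \<open>Taking real parts maps the dual ball bijectively onto the real-linear functionals below the norm, so
  extremality there transfers to the dual ball.\<close>

theorem extreme_norming_functional:
  obtains e where "e \<in> dual_extreme_points smul" "blinfun_apply e x = of_real (norm x)"
proof -
  obtain f where f: "linear f" "f \<le> norm" "f x = norm x" and
    ext: "\<And>g h \<theta>. \<lbrakk>linear g; linear h; g \<le> norm; h \<le> norm; 0 < \<theta>; \<theta> < 1;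
       \<And>x. (1 - \<theta>) * g x + \<theta> * h x = f x\<rbrakk> \<Longrightarrow> g = f \<and> h = f"
    using extreme_linear_below_sublinear[OF sublinear_norm, of x] by blast
  obtain e where e: "e \<in> dual_ball smul" "\<And>x. rc_re (blinfun_apply e x) = f x"
    using complexify_functional[OF f(1)] f(2) by (auto simp: le_fun_def)
  have re: "linear (\<lambda>x. rc_re (blinfun_apply g x))" "(\<lambda>x. rc_re (blinfun_apply g x)) \<le> norm"
    if "g \<in> dual_ball smul" for g
  proof -
    show "linear (\<lambda>x. rc_re (blinfun_apply g x))"
      by (rule linearI) (auto simp: blinfun.bilinear_simps)
    have "norm (blinfun_apply g x) \<le> norm x" for x
      using norm_blinfun[of g x] that mult_right_mono[of "norm g" 1 "norm x"]
      by (auto simp: dual_ball_iff)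
    then show "(\<lambda>x. rc_re (blinfun_apply g x)) \<le> norm"
      by (auto simp: le_fun_def intro: order_trans[OF rc_re_le])
  qed
  have "e extreme_point_of dual_ball smul"
    unfolding extreme_point_of_def
  proof (intro conjI ballI e(1) notI)
    fix g h assume g: "g \<in> dual_ball smul" and h: "h \<in> dual_ball smul" and "e \<in> open_segment g h"
    then obtain \<theta> where "g \<noteq> h" and \<theta>: "0 < \<theta>" "\<theta> < 1" and eq: "e = (1 - \<theta>) *\<^sub>R g + \<theta> *\<^sub>R h"
      by (auto simp: in_segment)
    have "(\<lambda>x. rc_re (blinfun_apply g x)) = f \<and> (\<lambda>x. rc_re (blinfun_apply h x)) = f"
    proof (rule ext[OF re(1)[OF g] re(1)[OF h] re(2)[OF g] re(2)[OF h] \<theta>])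
      fix x show "(1 - \<theta>) * rc_re (blinfun_apply g x) + \<theta> * rc_re (blinfun_apply h x) = f x"
        unfolding e(2)[symmetric] eq by (simp add: blinfun.bilinear_simps)
    qed
    then have "rc_re (blinfun_apply g x) = rc_re (blinfun_apply h x)" for x by (metis (mono_tags))
    then have "g = h" using g h by (intro dual_eq_if_rc_re_eq) (auto simp: dual_ball_iff)
    with \<open>g \<noteq> h\<close> show False by simp
  qed
  moreover have "blinfun_apply e x = of_real (norm x)"
  proof (cases "x = 0")
    case False
    have "norm (blinfun_apply e x) \<le> norm x"
      using norm_blinfun[of e x] e(1) mult_right_mono[of "norm e" 1 "norm x"] by (auto simp: dual_ball_iff)
    then have "blinfun_apply e x / of_real (norm x) = 1"
      using False
    proof (intro eq_1_if_rc_re_eq_1[where z = "blinfun_apply e x / of_real (norm x)"])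
      have "blinfun_apply e x / of_real (norm x) = (1 / norm x) *\<^sub>R blinfun_apply e x"
        by (simp add: scaleR_conv_of_real)
      then show "rc_re (blinfun_apply e x / of_real (norm x)) = 1" using False e(2) f(3) by simp
    qed (auto simp: norm_divide)
    then show ?thesis using False by simp
  qed (simp add: blinfun.zero_right)
  ultimately show ?thesis using that by (auto simp: dual_extreme_points_def)
qed

lemma dual_extreme_pointsD:
  assumes "e \<in> dual_extreme_points smul"
  shows "e \<in> dual_space smul" "norm e \<le> 1" "e \<in> dual_ball smul"
    "norm (blinfun_apply e x) \<le> norm x"
proof -
  show "e \<in> dual_space smul" "norm e \<le> 1" "e \<in> dual_ball smul"
    using assms by (auto simp: dual_extreme_points_def extreme_point_of_def dual_ball_iff)
  then show "norm (blinfun_apply e x) \<le> norm x"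
    using norm_blinfun[of e x] mult_right_mono[of "norm e" 1 "norm x"] by auto
qed

lemma dual_extreme_points_mid:
  assumes "e \<in> dual_extreme_points smul" "g \<in> dual_ball smul" "h \<in> dual_ball smul"
    "0 < \<theta>" "\<theta> < 1" "e = (1 - \<theta>) *\<^sub>R g + \<theta> *\<^sub>R h"
  shows "g = h"
proof (rule ccontr)
  assume "g \<noteq> h"
  then have "e \<in> open_segment g h" using assms(4-6) by (auto simp: in_segment)
  then show False using assms(1-3) by (auto simp: dual_extreme_points_def extreme_point_of_def)
qed

lemma norm_apply_le: "f \<in> dual_space smul \<Longrightarrow> norm x \<le> 1 \<Longrightarrow> norm (blinfun_apply f x) \<le> norm f"
  using norm_blinfun[of f x] mult_left_mono[of "norm x" 1 "norm f"] by simp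

lemma rc_re_apply_le: "f \<in> dual_space smul \<Longrightarrow> norm x \<le> 1 \<Longrightarrow> rc_re (blinfun_apply f x) \<le> norm f"
  using rc_re_le[of "blinfun_apply f x"] norm_apply_le[of f x] by linarith

lemma dual_scale_extreme:
  assumes e: "e \<in> dual_extreme_points smul" and c: "norm c = 1"
  shows "dual_scale c e \<in> dual_extreme_points smul"
proof -
  note eD = dual_extreme_pointsD[OF e]
  have c0: "c \<noteq> 0" using c by auto
  have "dual_scale c e extreme_point_of dual_ball smul"
    unfolding extreme_point_of_def
  proof (intro conjI ballI notI)
    show "dual_scale c e \<in> dual_ball smul" using eD c by (auto simp: dual_ball_iff)
    fix g h assume g: "g \<in> dual_ball smul" and h: "h \<in> dual_ball smul" and "dual_scale c e \<in> open_segment g h"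
    then obtain \<theta> where "g \<noteq> h" and \<theta>: "0 < \<theta>" "\<theta> < 1" and mid: "dual_scale c e = (1 - \<theta>) *\<^sub>R g + \<theta> *\<^sub>R h"
      by (auto simp: in_segment)
    have "dual_scale (inverse c) g = dual_scale (inverse c) h"
    proof (rule dual_extreme_points_mid[OF e _ _ \<theta>])
      show "dual_scale (inverse c) g \<in> dual_ball smul" "dual_scale (inverse c) h \<in> dual_ball smul"
        using g h c by (auto simp: dual_ball_iff norm_inverse)
      have "e = dual_scale (inverse c) (dual_scale c e)" using c0 by simp
      also have "\<dots> = (1 - \<theta>) *\<^sub>R dual_scale (inverse c) g + \<theta> *\<^sub>R dual_scale (inverse c) h"
        unfolding mid by (rule blinfun_eqI) (simp add: blinfun.bilinear_simps distrib_left)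
      finally show "e = (1 - \<theta>) *\<^sub>R dual_scale (inverse c) g + \<theta> *\<^sub>R dual_scale (inverse c) h" .
    qed
    then have "dual_scale c (dual_scale (inverse c) g) = dual_scale c (dual_scale (inverse c) h)" by simp
    then show False using \<open>g \<noteq> h\<close> c0 by simp
  qed
  then show ?thesis by (simp add: dual_extreme_points_def)
qed

text \<open>A point of norm less than \<open>1\<close> is the midpoint of a nontrivial segment in the direction of any
  nonzero functional, and norming functionals supply one.\<close>

lemma norm_dual_extreme_point:
  assumes "e \<in> dual_extreme_points smul" and nz: "\<exists>x::'a. x \<noteq> 0"
  shows "norm e = 1"
proof (rule ccontr)
  assume "norm e \<noteq> 1"
  then have ne: "norm e < 1" using dual_extreme_pointsD[OF assms(1)] by simp
  obtain x :: 'a where "x \<noteq> 0" using nz by blast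
  obtain f where f: "f \<in> dual_extreme_points smul" "blinfun_apply f x = of_real (norm x)"
    by (rule extreme_norming_functional)
  have "f \<noteq> 0" using f \<open>x \<noteq> 0\<close> by auto
  let ?d = "(1 - norm e) *\<^sub>R f"
  have d: "norm ?d \<le> 1 - norm e"
    using dual_extreme_pointsD[OF f(1)] ne by (simp add: mult_left_le)
  have "e - ?d = e + ?d"
  proof (rule dual_extreme_points_mid[OF assms(1), of _ _ "1/2"])
    show "e - ?d \<in> dual_ball smul" "e + ?d \<in> dual_ball smul"
      using dual_extreme_pointsD[OF f(1)] dual_extreme_pointsD[OF assms(1)] d
        norm_triangle_ineq4[of e ?d] norm_triangle_ineq[of e ?d]
      by (auto simp: dual_ball_iff)
    show "e = (1 - 1 / 2) *\<^sub>R (e - ?d) + (1 / 2) *\<^sub>R (e + ?d)"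
      by (simp add: scaleR_right_diff_distrib scaleR_right_distrib flip: scaleR_left_distrib)
  qed auto
  then have "(e + ?d) - (e - ?d) = 0" by (simp only: diff_self)
  then have "2 *\<^sub>R ?d = 0" by (simp only: scaleR_2) simp
  then show False using ne \<open>f \<noteq> 0\<close> by simp
qed

text \<open>The sublinear functional \<open>z \<mapsto> inf {\<parallel>z + t(x - c)\<parallel> - tr}\<close> already encodes the separation:
  at \<open>z = c - x\<close> the choice \<open>t = 1\<close> gives a value of at most \<open>- r\<close>.\<close>

theorem separate_point_from_convex:
  assumes "convex C" and ne: "C \<noteq> {}" and far: "\<And>c. c \<in> C \<Longrightarrow> r \<le> norm (x - c)"
  obtains f where "f \<in> dual_ball smul"
    "\<And>c. c \<in> C \<Longrightarrow> rc_re (blinfun_apply f c) + r \<le> rc_re (blinfun_apply f x)"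
proof -
  define q where "q = (\<lambda>(t, c) z. norm (z + t *\<^sub>R (x - c)) - t * r)"
  define I where "I = {0::real..} \<times> C"
  define p where "p z = (INF i\<in>I. q i z)" for z
  have low: "- norm z \<le> q i z" if i: "i \<in> I" for i z
  proof -
    obtain t c where [simp]: "i = (t, c)" and tc: "t \<ge> 0" "c \<in> C" using i by (auto simp: I_def)
    have "t * r \<le> norm (t *\<^sub>R (x - c))" using far[OF tc(2)] tc by (simp add: mult_left_mono)
    moreover have "norm (t *\<^sub>R (x - c)) \<le> norm (z + t *\<^sub>R (x - c)) + norm z"
      using norm_triangle_ineq4[of "z + t *\<^sub>R (x - c)" z] by simp
    ultimately show ?thesis by (simp add: q_def)
  qed
  have le: "p z \<le> q i z" if "i \<in> I" for i z
    unfolding p_def by (rule cINF_lower[OF bdd_belowI2[where m = "- norm z"] that]) (rule low)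
  have I0: "I \<noteq> {}" using ne by (auto simp: I_def)
  have "sublinear p"
    unfolding p_def
  proof (rule sublinearI_INF[where b = "\<lambda>z. - norm z", OF I0 low])
    fix i j z w assume "i \<in> I" "j \<in> I"
    then obtain s c t d where [simp]: "i = (s, c)" "j = (t, d)" and
      st: "s \<ge> 0" "t \<ge> 0" "c \<in> C" "d \<in> C" by (auto simp: I_def)
    show "\<exists>k\<in>I. q k (z + w) \<le> q i z + q j w"
    proof (cases "s + t = 0")
      case True
      then have "s = 0" "t = 0" using st by auto
      then show ?thesis using st norm_triangle_ineq[of z w]
        by (intro bexI[of _ "(0, c)"]) (auto simp: q_def I_def)
    next
      case False
      define m where "m = (s / (s + t)) *\<^sub>R c + (t / (s + t)) *\<^sub>R d"
      have "s / (s + t) + t / (s + t) = 1" using False by (simp flip: add_divide_distrib)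
      then have "m \<in> C" unfolding m_def using st \<open>convex C\<close> by (intro convexD) auto
      have "(s + t) *\<^sub>R m = s *\<^sub>R c + t *\<^sub>R d"
        using False by (simp add: m_def scaleR_right_distrib)
      then have "z + w + (s + t) *\<^sub>R (x - m) = (z + s *\<^sub>R (x - c)) + (w + t *\<^sub>R (x - d))"
        by (simp add: algebra_simps)
      then have "norm (z + w + (s + t) *\<^sub>R (x - m)) \<le> norm (z + s *\<^sub>R (x - c)) + norm (w + t *\<^sub>R (x - d))"
        by (metis norm_triangle_ineq)
      then show ?thesis using st \<open>m \<in> C\<close>
        by (intro bexI[of _ "(s + t, m)"]) (auto simp: q_def I_def algebra_simps)
    qed
  next
    fix i and t :: real and z assume "i \<in> I" and t: "t > 0"
    then obtain s c where [simp]: "i = (s, c)" and sc: "s \<ge> 0" "c \<in> C" by (auto simp: I_def)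
    have "t *\<^sub>R z + (t * s) *\<^sub>R (x - c) = t *\<^sub>R (z + s *\<^sub>R (x - c))"
      by (simp add: algebra_simps)
    then have "norm (t *\<^sub>R z + (t * s) *\<^sub>R (x - c)) = t * norm (z + s *\<^sub>R (x - c))"
      using t by simp
    then show "\<exists>k\<in>I. q k (t *\<^sub>R z) \<le> t * q i z"
      using t sc by (intro bexI[of _ "(t * s, c)"]) (auto simp: q_def I_def algebra_simps)
  next
    obtain c where "c \<in> C" using ne by blast
    then have "(0, c) \<in> I" by (simp add: I_def)
    show "(INF i\<in>I. q i 0) = 0"
    proof (rule antisym)
      show "(INF i\<in>I. q i 0) \<le> 0" using le[OF \<open>(0, c) \<in> I\<close>, of 0] by (simp add: p_def q_def)
      show "0 \<le> (INF i\<in>I. q i 0)" using low[of _ 0] by (intro cINF_greatest[OF I0]) auto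
    qed
  qed
  then obtain l where l: "linear l" "l \<le> p"
    using extreme_linear_below_sublinear by metis
  obtain c where "c \<in> C" using ne by blast
  have "l z \<le> norm z" for z
    using le_funD[OF l(2), of z] le[of "(0, c)" z] \<open>c \<in> C\<close> by (auto simp: q_def I_def)
  from complexify_functional[OF l(1) this] obtain f where
    f: "f \<in> dual_ball smul" "\<And>x. rc_re (blinfun_apply f x) = l x" by blast
  show ?thesis
  proof (rule that[OF f(1)])
    fix c assume "c \<in> C"
    then have "l (c - x) \<le> - r"
      using le_funD[OF l(2), of "c - x"] le[of "(1, c)" "c - x"] by (auto simp: q_def I_def)
    then show "rc_re (blinfun_apply f c) + r \<le> rc_re (blinfun_apply f x)"
      by (simp add: f(2) linear_diff[OF l(1)])
  qed
qed

text \<open>Goldstine's theorem for two functionals, where \<open>\<phi>\<close> is an element of the unit ball of the bidual. The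
  values of \<open>(f, g)\<close> on the unit ball form a convex set in a finite-dimensional space, so a hyperplane
  there would separate \<open>(\<phi> f, \<phi> g)\<close> from them; the combination \<open>h\<close> of \<open>f\<close> and \<open>g\<close> that it defines would
  satisfy \<open>Re \<phi>(h) > \<parallel>h\<parallel>\<close>.\<close>

lemma goldstine_two:
  assumes f: "f \<in> dual_space smul" and g: "g \<in> dual_space smul"
    and add: "\<And>h k. h \<in> dual_space smul \<Longrightarrow> k \<in> dual_space smul \<Longrightarrow> \<phi> (h + k) = \<phi> h + \<phi> k"
    and scale: "\<And>c h. h \<in> dual_space smul \<Longrightarrow> \<phi> (dual_scale c h) = c * \<phi> h"
    and bound: "\<And>h. h \<in> dual_space smul \<Longrightarrow> norm (\<phi> h) \<le> norm h"
    and "\<epsilon> > 0"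
  obtains y where "norm y \<le> 1" "norm (blinfun_apply f y - \<phi> f) < \<epsilon>" "norm (blinfun_apply g y - \<phi> g) < \<epsilon>"
proof (cases "(\<phi> f, \<phi> g) \<in> closure ((\<lambda>y. (blinfun_apply f y, blinfun_apply g y)) ` cball 0 1)")
  case True
  then obtain y where y: "norm y \<le> 1" "dist (blinfun_apply f y, blinfun_apply g y) (\<phi> f, \<phi> g) < \<epsilon>"
    using \<open>\<epsilon> > 0\<close> by (auto simp: closure_approachable)
  then show ?thesis using dist_fst_le[of "(blinfun_apply f y, blinfun_apply g y)" "(\<phi> f, \<phi> g)"]
      dist_snd_le[of "(blinfun_apply f y, blinfun_apply g y)" "(\<phi> f, \<phi> g)"]
    by (intro that[of y]) (auto simp: dist_norm)
next
  case False
  let ?S = "(\<lambda>y. (blinfun_apply f y, blinfun_apply g y)) ` cball 0 1"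
  have lin: "linear (\<lambda>y. (blinfun_apply f y, blinfun_apply g y))"
    by (rule linearI) (auto simp: blinfun.bilinear_simps)
  have "convex (closure ?S)"
    by (intro convex_closure convex_linear_image lin convex_cball)
  from separating_hyperplane_closed_point[OF this closed_closure False]
  obtain u b where ub: "inner u (\<phi> f, \<phi> g) < b" "\<And>z. z \<in> closure ?S \<Longrightarrow> inner u z > b" by blast
  have "linear (\<lambda>z::'k. inner (- fst u) z)" "linear (\<lambda>z::'k. inner (- snd u) z)"
    by (auto intro!: linearI simp: inner_simps)
  then obtain \<alpha> \<beta> where \<alpha>: "\<And>z. inner (- fst u) z = rc_re (\<alpha> * z)" and \<beta>: "\<And>z. inner (- snd u) z = rc_re (\<beta> * z)"
    by (metis real_functional_rep)
  define h where "h = dual_scale \<alpha> f + dual_scale \<beta> g"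
  have h: "h \<in> dual_space smul" using f g by (auto simp: h_def)
  have "\<phi> h = \<alpha> * \<phi> f + \<beta> * \<phi> g" using f g by (simp add: h_def add scale)
  then have 1: "rc_re (\<phi> h) = - inner u (\<phi> f, \<phi> g)"
    by (simp flip: \<alpha> \<beta> add: inner_prod_def)
  have 2: "rc_re (blinfun_apply h y) \<le> - b" if "norm y \<le> 1" for y
  proof -
    have "rc_re (blinfun_apply h y) = - inner u (blinfun_apply f y, blinfun_apply g y)"
      by (simp flip: \<alpha> \<beta> add: inner_prod_def h_def blinfun.add_left)
    moreover have "(blinfun_apply f y, blinfun_apply g y) \<in> closure ?S"
      using that by (intro closure_subset[THEN subsetD]) auto
    ultimately show ?thesis using ub(2) by fastforce
  qed
  have "norm h \<le> - b"
    by (rule norm_le_if_rc_re_le[OF h _ 2]) (use 2[of 0] in \<open>simp_all add: blinfun.zero_right\<close>)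
  moreover have "rc_re (\<phi> h) \<le> norm h"
    using rc_re_le[of "\<phi> h"] bound[OF h] by linarith
  ultimately have False using 1 ub(1) by linarith
  then show ?thesis ..
qed

section \<open>Weak-star compactness\<close>

text \<open>The Banach-Alaoglu theorem: the dual ball is closed in a product of discs, one for each vector.\<close>

lemma compact_dual_ball: "compact (blinfun_apply ` dual_ball smul)"
proof -
  let ?P = "PiE UNIV (\<lambda>x::'a. cball (0::'k) (norm x))"
  let ?L = "(\<Inter>x y. {h::'a \<Rightarrow> 'k. h (x + y) = h x + h y}) \<inter> (\<Inter>c x. {h::'a \<Rightarrow> 'k. h (smul c x) = c * h x})"
  have "compactin (product_topology (\<lambda>_::'a. euclidean :: 'k topology) UNIV) ?P"
    by (subst compactin_PiE) (simp add: compact_cball)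
  then have "compact ?P" by (simp add: euclidean_product_topology)
  moreover have "closed ?L"
    by (intro closed_Int closed_INT ballI closed_Collect_eq continuous_intros continuous_on_product_coordinates)
  moreover have "blinfun_apply ` dual_ball smul = ?P \<inter> ?L"
  proof (intro equalityI subsetI)
    fix h assume "h \<in> blinfun_apply ` dual_ball smul"
    then obtain f where [simp]: "h = blinfun_apply f" and f: "f \<in> dual_space smul" "norm f \<le> 1"
      by (auto simp: dual_ball_iff)
    have "norm (blinfun_apply f x) \<le> norm x" for x
      using norm_blinfun[of f x] f mult_right_mono[of "norm f" 1 "norm x"] by auto
    then show "h \<in> ?P \<inter> ?L" by (auto simp: blinfun.add_right dual_spaceD[OF f(1)])
  next
    fix h assume h: "h \<in> ?P \<inter> ?L"
    have real: "h (r *\<^sub>R x) = r *\<^sub>R h x" for r x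
      using h by (simp flip: smul_of_real add: scaleR_conv_of_real)
    have bd: "norm (h x) \<le> norm x" for x using h by (auto simp: PiE_iff)
    have bl: "bounded_linear h"
      by (rule bounded_linear_intro[where K = 1]) (use h real bd in auto)
    have "Blinfun h \<in> dual_ball smul" using h bd
      by (auto simp: dual_ball_iff dual_space_def bounded_linear_Blinfun_apply[OF bl]
          intro!: norm_blinfun_bound)
    then show "h \<in> blinfun_apply ` dual_ball smul"
      using bounded_linear_Blinfun_apply[OF bl] by (metis imageI)
  qed
  ultimately show ?thesis by (simp add: compact_Int_closed)
qed

lemma closedin_weak_star_iff:
  assumes "S \<subseteq> dual_ball smul"
  shows "closedin (weak_star_topology smul) S \<longleftrightarrow> compact (blinfun_apply ` S)"
proof
  assume "closedin (weak_star_topology smul) S"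
  then obtain U where U: "closedin strong_operator_topology U" "S = dual_space smul \<inter> U"
    by (auto simp: weak_star_topology_def closedin_subtopology)
  then have "openin (pullback_topology UNIV blinfun_apply euclidean) (UNIV - U)"
    by (simp add: closedin_def strong_operator_topology_topspace strong_operator_topology_def[symmetric])
  then obtain V where V: "open V" "UNIV - U = blinfun_apply -` V"
    by (auto simp: openin_pullback_topology)
  have "blinfun_apply ` S = blinfun_apply ` dual_ball smul \<inter> - V"
    using V(2) U(2) assms by (auto simp: dual_ball_iff)
  then show "compact (blinfun_apply ` S)"
    using V(1) by (simp add: compact_Int_closed compact_dual_ball closed_Compl)
next
  assume "compact (blinfun_apply ` S)"
  have "Hausdorff_space (product_topology (\<lambda>_::'a. euclidean :: 'k topology) UNIV)"
    by (simp add: Hausdorff_space_product_topology)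
  then have "Hausdorff_space (euclidean :: ('a \<Rightarrow> 'k) topology)"
    by (simp add: euclidean_product_topology)
  then have "closed (blinfun_apply ` S)"
    using \<open>compact (blinfun_apply ` S)\<close> by (metis compactin_imp_closedin compactin_euclidean_iff closed_closedin)
  then have "openin strong_operator_topology (blinfun_apply -` (- blinfun_apply ` S))"
    unfolding strong_operator_topology_def openin_pullback_topology
    by (auto intro!: exI[of _ "- blinfun_apply ` S"])
  moreover have "blinfun_apply -` (- blinfun_apply ` S) = UNIV - S"
    by (auto simp: blinfun_apply_inject)
  ultimately have "closedin strong_operator_topology S"
    by (simp add: closedin_def strong_operator_topology_topspace)
  moreover have "S = dual_space smul \<inter> S" using assms by (auto simp: dual_ball_iff)
  ultimately show "closedin (weak_star_topology smul) S"
    unfolding weak_star_topology_def closedin_subtopology by blast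
qed

end

section \<open>Extreme points of the dual ball as L-summands\<close>

text \<open>The measure with density \<open>w\<close> takes only the values \<open>0\<close> and \<open>1\<close>, so \<open>r\<close> has a constant sign on
  the support of \<open>w\<close>, and a function of constant sign and integral \<open>0\<close> vanishes.\<close>

lemma integral_AE_zero_if_zero_one:
  fixes r w :: "'m \<Rightarrow> real"
  assumes r: "integrable M r" "(\<integral>t. r t \<partial>M) = 0"
    and w: "integrable M w" "\<And>t. 0 \<le> w t" "(\<integral>t. w t \<partial>M) = 1"
    and r0: "\<And>t. w t = 0 \<Longrightarrow> r t = 0"
    and zero_one: "\<And>A. A \<in> sets M \<Longrightarrow> (\<integral>t. indicator A t * w t \<partial>M) \<in> {0, 1}"
  shows "AE t in M. r t = 0"
proof -
  define A where "A = {t \<in> space M. 0 < r t}"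
  have [measurable]: "r \<in> borel_measurable M" "w \<in> borel_measurable M" using r w by auto
  have A[measurable]: "A \<in> sets M" unfolding A_def by measurable
  have iA: "integrable M (\<lambda>t. indicator A t * w t)"
    using integrable_mult_indicator[OF A w(1)] by simp
  consider "(\<integral>t. indicator A t * w t \<partial>M) = 0" | "(\<integral>t. w t - indicator A t * w t \<partial>M) = 0"
    using zero_one[OF A] iA w by fastforce
  then show ?thesis
  proof cases
    case 1
    then have "AE t in M. indicator A t * w t = 0"
      by (subst (asm) integral_nonneg_eq_0_iff_AE[OF iA]) (auto simp: w(2))
    then have neg: "AE t in M. 0 \<le> - r t"
    proof (rule AE_mp, intro AE_I2 impI)
      fix t assume "t \<in> space M" "indicator A t * w t = 0"
      then show "0 \<le> - r t" using r0[of t] by (cases "0 < r t") (auto simp: A_def)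
    qed
    have "(\<integral>t. - r t \<partial>M) = 0" using r by simp
    then have "AE t in M. - r t = 0"
      by (subst (asm) integral_nonneg_eq_0_iff_AE[OF _ neg]) (auto simp: r)
    then show ?thesis by simp
  next
    case 2
    then have "AE t in M. w t - indicator A t * w t = 0"
      by (subst (asm) integral_nonneg_eq_0_iff_AE)
        (use iA w in \<open>auto split: split_indicator\<close>)
    then have pos: "AE t in M. 0 \<le> r t"
    proof (rule AE_mp, intro AE_I2 impI)
      fix t assume "t \<in> space M" "w t - indicator A t * w t = 0"
      then show "0 \<le> r t" using r0[of t] by (cases "t \<in> A") (auto simp: A_def)
    qed
    show ?thesis using r(2)
      by (subst (asm) integral_nonneg_eq_0_iff_AE[OF r(1) pos])
  qed
qed

context normed_space_over
begin

text \<open>The line of \<open>e\<close> is an L-summand of the dual, and \<open>a\<close> is the coordinate along it.\<close>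

definition L_coefficient :: "('a \<Rightarrow>\<^sub>L 'k) \<Rightarrow> (('a \<Rightarrow>\<^sub>L 'k) \<Rightarrow> 'k) \<Rightarrow> bool" where
  "L_coefficient e a \<longleftrightarrow> a e = 1 \<and>
    (\<forall>h\<in>dual_space smul. \<forall>k\<in>dual_space smul. a (h + k) = a h + a k) \<and>
    (\<forall>c. \<forall>h\<in>dual_space smul. a (dual_scale c h) = c * a h) \<and>
    (\<forall>h\<in>dual_space smul. norm h = norm (a h) + norm (h - dual_scale (a h) e))"

lemma L_coefficientD:
  assumes "L_coefficient e a"
  shows "a e = 1"
    and "h \<in> dual_space smul \<Longrightarrow> k \<in> dual_space smul \<Longrightarrow> a (h + k) = a h + a k"
    and "h \<in> dual_space smul \<Longrightarrow> a (dual_scale c h) = c * a h"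
    and "h \<in> dual_space smul \<Longrightarrow> norm h = norm (a h) + norm (h - dual_scale (a h) e)"
    and "h \<in> dual_space smul \<Longrightarrow> norm (a h) \<le> norm h"
  using assms by (auto simp: L_coefficient_def)

lemma L_coefficient_diff:
  assumes "L_coefficient e a" "h \<in> dual_space smul" "k \<in> dual_space smul"
  shows "a (h - k) = a h - a k"
  using L_coefficientD(2)[OF assms(1), of "h - k" k] assms by (simp add: algebra_simps)

text \<open>Let \<open>u\<close> represent \<open>e\<close> in \<open>L\<^sub>1(M)\<close>. Extremality makes \<open>\<bar>u\<bar> dM\<close> a measure with values in \<open>{0, 1}\<close>, so
  every integrable \<open>g\<close> is a constant multiple of \<open>u\<close> on the support of \<open>u\<close>. That constant is the
  coefficient, and the norm splits because the rest of \<open>g\<close> lives off the support.\<close>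

theorem L1_predual_extreme_coefficient:
  fixes M :: "'m measure"
  assumes L1: "L1_predual smul M" and e: "e \<in> dual_extreme_points smul" and nz: "\<exists>x::'a. x \<noteq> 0"
  obtains a where "L_coefficient e a"
proof -
  obtain T :: "('m \<Rightarrow> 'k) \<Rightarrow> ('a \<Rightarrow>\<^sub>L 'k)" where
    T: "T ` {g. integrable M g} = dual_space smul \<and>
      (\<forall>g h. integrable M g \<longrightarrow> integrable M h \<longrightarrow> T (\<lambda>t. g t + h t) = T g + T h) \<and>
      (\<forall>c g. integrable M g \<longrightarrow> (\<forall>x. blinfun_apply (T (\<lambda>t. c * g t)) x = c * blinfun_apply (T g) x)) \<and>
      (\<forall>g. integrable M g \<longrightarrow> norm (T g) = (\<integral>t. norm (g t) \<partial>M))"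
    using L1 unfolding L1_predual_def by (elim exE)
  then have rangeT: "T ` {g. integrable M g} = dual_space smul" by (elim conjE)
  have T_add: "\<And>g h. integrable M g \<Longrightarrow> integrable M h \<Longrightarrow> T (\<lambda>t. g t + h t) = T g + T h"
    and T_mult: "\<And>c g x. integrable M g \<Longrightarrow> blinfun_apply (T (\<lambda>t. c * g t)) x = c * blinfun_apply (T g) x"
    and T_norm: "\<And>g. integrable M g \<Longrightarrow> norm (T g) = (\<integral>t. norm (g t) \<partial>M)"
    using T by (elim conjE, simp)+
  have T_scale: "T (\<lambda>t. c * g t) = dual_scale c (T g)" if "integrable M g" for c g
    by (rule blinfun_eqI) (simp add: T_mult that)
  have T_diff: "T (\<lambda>t. g t - h t) = T g - T h" if "integrable M g" "integrable M h" for g h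
  proof -
    have "T (\<lambda>t. g t + (-1) * h t) = T g + T (\<lambda>t. (-1) * h t)"
      using that by (intro T_add) auto
    then show ?thesis
      using T_scale[OF that(2), of "-1"] dual_scale_simps(5)[of "-1" "T h"] by simp
  qed
  have T_eq: "AE t in M. g t = h t" if "integrable M g" "integrable M h" "T g = T h" for g h
  proof -
    have "(\<integral>t. norm (g t - h t) \<partial>M) = 0"
      using T_norm[of "\<lambda>t. g t - h t"] T_diff that by simp
    then have "AE t in M. norm (g t - h t) = 0"
      by (subst (asm) integral_nonneg_eq_0_iff_AE) (use that in auto)
    then show ?thesis by simp
  qed
  define S where "S h = (SOME g. integrable M g \<and> T g = h)" for h
  have S: "integrable M (S h)" "T (S h) = h" if "h \<in> dual_space smul" for h
  proof -
    have "\<exists>g. integrable M g \<and> T g = h" using that unfolding rangeT[symmetric] by auto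
    from someI_ex[OF this] show "integrable M (S h)" "T (S h) = h" by (auto simp: S_def)
  qed
  note eD = dual_extreme_pointsD[OF e]
  define u where "u = S e"
  define w where "w t = norm (u t)" for t
  have u: "integrable M u" "T u = e" using S eD by (auto simp: u_def)
  have w: "integrable M w" "\<And>t. 0 \<le> w t" "(\<integral>t. w t \<partial>M) = 1"
    using u T_norm[OF u(1)] norm_dual_extreme_point[OF e nz] by (auto simp: w_def[abs_def])
  have [measurable]: "u \<in> borel_measurable M" using u by auto
  \<comment> \<open>A splitting of \<open>u\<close> along \<open>A\<close> into two nonzero parts would write \<open>e\<close> as a proper convex combination.\<close>
  have zero_one: "(\<integral>t. indicator A t * w t \<partial>M) \<in> {0, 1}" if A: "A \<in> sets M" for A
  proof -
    define v where "v t = indicator A t *\<^sub>R u t" for t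
    define \<rho> where "\<rho> = (\<integral>t. indicator A t * w t \<partial>M)"
    have v: "integrable M v" unfolding v_def by (rule integrable_mult_indicator[OF A u(1)])
    have iA: "integrable M (\<lambda>t. indicator A t * w t)"
      using integrable_mult_indicator[OF A w(1)] by simp
    have nv: "norm (T v) = \<rho>"
      by (simp add: T_norm[OF v] \<rho>_def v_def w_def)
    have "norm (u t - v t) = w t - indicator A t * w t" for t
      by (auto simp: v_def w_def split: split_indicator)
    then have "norm (T (\<lambda>t. u t - v t)) = (\<integral>t. w t - indicator A t * w t \<partial>M)"
      using T_norm[of "\<lambda>t. u t - v t"] u v by simp
    then have nv': "norm (e - T v) = 1 - \<rho>"
      using w iA u v by (simp add: T_diff \<rho>_def)
    have \<rho>: "0 \<le> \<rho>" "\<rho> \<le> 1" using nv nv' norm_ge_zero by (metis, metis diff_ge_0_iff_ge norm_ge_zero)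
    show ?thesis
    proof (rule ccontr)
      assume "\<not> ?thesis"
      then have l01: "0 < \<rho>" "\<rho> < 1" using \<rho> by (auto simp: \<rho>_def)
      have Tv: "T v \<in> dual_space smul" using v rangeT by blast
      have "(1 / \<rho>) *\<^sub>R T v = (1 / (1 - \<rho>)) *\<^sub>R (e - T v)"
      proof (rule dual_extreme_points_mid[OF e, where \<theta> = "1 - \<rho>"])
        show "(1 / \<rho>) *\<^sub>R T v \<in> dual_ball smul" "(1 / (1 - \<rho>)) *\<^sub>R (e - T v) \<in> dual_ball smul"
          using l01 nv nv' Tv eD by (auto simp: dual_ball_iff)
      qed (use l01 in auto)
      then have "(\<rho> * (1 - \<rho>)) *\<^sub>R ((1 / \<rho>) *\<^sub>R T v) = (\<rho> * (1 - \<rho>)) *\<^sub>R ((1 / (1 - \<rho>)) *\<^sub>R (e - T v))"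
        by simp
      then have "(1 - \<rho>) *\<^sub>R T v = \<rho> *\<^sub>R (e - T v)" using l01 by simp
      then have "T v = \<rho> *\<^sub>R e" by (simp add: algebra_simps)
      then have "T v = T (\<lambda>t. of_real \<rho> * u t)" using u by (simp add: T_scale)
      then have "(\<integral>t. norm (v t - of_real \<rho> * u t) \<partial>M) = 0"
        using T_norm[of "\<lambda>t. v t - of_real \<rho> * u t"] T_diff[of v "\<lambda>t. of_real \<rho> * u t"] u v by simp
      moreover have "norm (v t - of_real \<rho> * u t) = (1 - 2 * \<rho>) * (indicator A t * w t) + \<rho> * w t" for t
      proof (cases "t \<in> A")
        case True
        have "u t - of_real \<rho> * u t = of_real (1 - \<rho>) * u t" by (simp add: algebra_simps)
        then have "norm (u t - of_real \<rho> * u t) = (1 - \<rho>) * w t"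
          using l01 by (simp only: norm_mult norm_of_real w_def abs_of_pos)
        then show ?thesis using True by (simp add: v_def algebra_simps)
      qed (use l01 in \<open>simp add: v_def w_def norm_mult\<close>)
      ultimately have "(1 - 2 * \<rho>) * \<rho> + \<rho> = 0"
        using iA w by (simp flip: \<rho>_def)
      then have "2 * \<rho> * (1 - \<rho>) = 0" by (simp add: algebra_simps)
      then show False using l01 by simp
    qed
  qed
  \<comment> \<open>The conjugate sign of \<open>u\<close>; division by zero makes it vanish off the support of \<open>u\<close>.\<close>
  define k where "k t = of_real (w t) / u t" for t
  have k0: "k t = 0" if "w t = 0" for t using that by (simp add: k_def)
  have [measurable]: "k \<in> borel_measurable M" unfolding k_def w_def by measurable
  have k1: "norm (k t) \<le> 1" for t by (simp add: k_def w_def norm_divide)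
  have intk: "integrable M (\<lambda>t. g t * k t)" if "integrable M g" for g
  proof (rule Bochner_Integration.integrable_bound[OF that])
    show "AE t in M. norm (g t * k t) \<le> norm (g t)"
      using k1 by (auto simp: norm_mult mult_left_le)
  qed (use that in measurable)
  define a where "a h = (\<integral>t. S h t * k t \<partial>M)" for h
  have aT: "a (T g) = (\<integral>t. g t * k t \<partial>M)" if g: "integrable M g" for g
  proof -
    have Tg: "T g \<in> dual_space smul" using g rangeT by blast
    have [measurable]: "S (T g) \<in> borel_measurable M" "g \<in> borel_measurable M" using S(1)[OF Tg] g by auto
    have "AE t in M. S (T g) t = g t"
      using S[OF Tg] g by (intro T_eq)
    then show ?thesis unfolding a_def
      by (intro integral_cong_AE) auto
  qed
  have key: "AE t in M. g t * k t = (\<integral>t. g t * k t \<partial>M) * of_real (w t)" if g: "integrable M g" for g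
  proof -
    let ?a = "\<integral>t. g t * k t \<partial>M"
    let ?d = "\<lambda>t. g t * k t - ?a * of_real (w t)"
    have id: "integrable M ?d" using intk[OF g] w by auto
    have I: "(\<integral>t. ?d t \<partial>M) = 0" using intk[OF g] w by (simp del: of_real_eq_0_iff)
    have "AE t in M. inner (?d t) b = 0" for b
    proof (rule integral_AE_zero_if_zero_one[OF _ _ w _ zero_one])
      show "integrable M (\<lambda>t. inner (?d t) b)" using id by (rule integrable_inner_left)
      have "(\<integral>t. inner (?d t) b \<partial>M) = inner (\<integral>t. ?d t \<partial>M) b"
        using id by (intro integral_inner_left) auto
      then show "(\<integral>t. inner (?d t) b \<partial>M) = 0" unfolding I by simp
    qed (use k0 in auto)
    then have "AE t in M. \<forall>b\<in>Basis. inner (?d t) b = 0"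
      by (intro AE_finite_allI) auto
    then show ?thesis
      by (rule AE_mp) (intro AE_I2 impI, simp add: euclidean_all_zero_iff)
  qed
  have "L_coefficient e a"
    unfolding L_coefficient_def
  proof (intro conjI ballI allI)
    have "u t * k t = of_real (w t)" for t by (simp add: k_def w_def)
    then show "a e = 1" using aT[OF u(1)] u(2) w by simp
    fix h assume h: "h \<in> dual_space smul"
    note Sh = S[OF h]
    show "a (dual_scale c h) = c * a h" for c
      using aT[of "\<lambda>t. c * S h t"] T_scale[OF Sh(1), of c] Sh intk[OF Sh(1)]
      by (simp add: mult.assoc a_def)
    show "a (h + h') = a h + a h'" if h': "h' \<in> dual_space smul" for h'
      using aT[of "\<lambda>t. S h t + S h' t"] T_add[OF Sh(1) S(1)[OF h']] Sh S[OF h'] intk[OF Sh(1)] intk[OF S(1)[OF h']]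
      by (simp add: algebra_simps a_def)
    have i2: "integrable M (\<lambda>t. a h * u t)" using u by simp
    have T2: "T (\<lambda>t. S h t - a h * u t) = h - dual_scale (a h) e"
      using T_diff[OF Sh(1) i2] T_scale[OF u(1), of "a h"] Sh(2) u(2) by simp
    have "AE t in M. norm (S h t) = norm (a h) * w t + norm (S h t - a h * u t)"
      using key[OF Sh(1)]
    proof (rule AE_mp, intro AE_I2 impI)
      fix t assume "S h t * k t = (\<integral>t. S h t * k t \<partial>M) * of_real (w t)"
      then have eq: "S h t * k t = a h * of_real (w t)" by (simp add: a_def)
      show "norm (S h t) = norm (a h) * w t + norm (S h t - a h * u t)"
      proof (cases "u t = 0")
        case False
        then have "S h t = a h * u t" using eq by (simp add: k_def w_def field_simps)
        then show ?thesis by (simp add: w_def norm_mult)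
      qed (simp add: w_def)
    qed
    then have "(\<integral>t. norm (S h t) \<partial>M) = (\<integral>t. norm (a h) * w t + norm (S h t - a h * u t) \<partial>M)"
      using Sh i2 w by (intro integral_cong_AE) auto
    also have "\<dots> = norm (a h) + norm (h - dual_scale (a h) e)"
      using T_norm[of "\<lambda>t. S h t - a h * u t"] T2 Sh i2 w by simp
    finally show "norm h = norm (a h) + norm (h - dual_scale (a h) e)"
      using T_norm[OF Sh(1)] Sh(2) by simp
  qed
  then show ?thesis by (rule that)
qed

text \<open>If the coefficient of \<open>e'\<close> along \<open>e\<close> were nonzero, the additive decomposition would exhibit \<open>e'\<close> as a
  convex combination of a multiple of \<open>e\<close> and something else.\<close>

lemma L_coefficient_other:
  assumes a: "L_coefficient e a" and e: "e \<in> dual_extreme_points smul"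
    and e': "e' \<in> dual_extreme_points smul"
    and n1: "norm e = 1" "norm e' = 1" and ne: "\<And>c. e' \<noteq> dual_scale c e"
  shows "a e' = 0"
proof (rule ccontr)
  assume nz: "a e' \<noteq> 0"
  note eD = dual_extreme_pointsD[OF e] dual_extreme_pointsD[OF e']
  define z where "z = e' - dual_scale (a e') e"
  have sum: "norm (a e') + norm z = 1"
    using L_coefficientD(4)[OF a eD(5)] n1 by (simp add: z_def)
  have z0: "z \<noteq> 0" using ne by (auto simp: z_def)
  have "dual_scale (a e' / of_real (norm (a e'))) e = (1 / norm z) *\<^sub>R z"
  proof (rule dual_extreme_points_mid[OF e', where \<theta> = "norm z"])
    show "dual_scale (a e' / of_real (norm (a e'))) e \<in> dual_ball smul" "(1 / norm z) *\<^sub>R z \<in> dual_ball smul"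
      using eD nz z0 n1 by (auto simp: dual_ball_iff z_def norm_divide)
    have "(1 - norm z) *\<^sub>R dual_scale (a e' / of_real (norm (a e'))) e = dual_scale (a e') e"
    proof -
      have "(1 - norm z) = norm (a e')" using sum by simp
      then show ?thesis using nz by (simp flip: dual_scale_simps(5))
    qed
    then show "e' = (1 - norm z) *\<^sub>R dual_scale (a e' / of_real (norm (a e'))) e + norm z *\<^sub>R ((1 / norm z) *\<^sub>R z)"
      using z0 by (simp add: z_def)
  qed (use sum nz z0 zero_less_norm_iff[of "a e'"] in \<open>simp, linarith\<close>)
  then have "norm z *\<^sub>R dual_scale (a e' / of_real (norm (a e'))) e = z" using z0 by simp
  then have z: "dual_scale (of_real (norm z) * (a e' / of_real (norm (a e')))) e = z"
    by (simp only: dual_scale_simps(4) flip: dual_scale_simps(5))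
  have "e' = z + dual_scale (a e') e" by (simp add: z_def)
  also have "\<dots> = dual_scale (of_real (norm z) * (a e' / of_real (norm (a e')))) e + dual_scale (a e') e"
    by (simp only: z)
  also have "\<dots> = dual_scale (of_real (norm z) * (a e' / of_real (norm (a e'))) + a e') e"
    by (rule blinfun_eqI) (simp add: blinfun.add_left distrib_right)
  finally show False using ne by blast
qed

text \<open>For subsets of \<open>dual_extreme_points\<close> this says that infinitely many one-dimensional subspaces are
  met: distinct extreme points on the same line differ by a unimodular factor and give no new
  L-summand.\<close>

definition infinitely_many_lines :: "('a \<Rightarrow>\<^sub>L 'k) set \<Rightarrow> bool" where
  "infinitely_many_lines S \<longleftrightarrow> (\<forall>F. finite F \<longrightarrow> F \<subseteq> dual_extreme_points smul \<longrightarrow>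
     (\<exists>e\<in>S. \<forall>f\<in>F. \<forall>c. e \<noteq> dual_scale c f))"

lemma infinitely_many_linesD:
  assumes "infinitely_many_lines S" "finite F" "F \<subseteq> dual_extreme_points smul"
  obtains e where "e \<in> S" "\<And>f c. f \<in> F \<Longrightarrow> e \<noteq> dual_scale c f"
proof -
  have "\<exists>e\<in>S. \<forall>f\<in>F. \<forall>c. e \<noteq> dual_scale c f"
    using assms by (simp add: infinitely_many_lines_def)
  then obtain e where "e \<in> S" "\<forall>f\<in>F. \<forall>c. e \<noteq> dual_scale c f" by (elim bexE)
  then show thesis by (intro that[of e]) simp_all
qed

lemma infinitely_many_lines_mono:
  "infinitely_many_lines S \<Longrightarrow> S \<subseteq> S' \<Longrightarrow> infinitely_many_lines S'"
  unfolding infinitely_many_lines_def by blast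

text \<open>In the bidual, \<open>\<phi>\<close> below takes the value \<open>1\<close> at \<open>e\<close> and agrees on the complementary
  summand with a point \<open>z\<close> that almost norms the component \<open>f - a(f)e\<close>; the additive norm
  makes this a contraction. Goldstine's theorem moves it into the unit ball.\<close>

lemma almost_face_norming:
  assumes e: "e \<in> dual_space smul" and a: "L_coefficient e a" and f: "f \<in> dual_space smul"
    and "\<tau> > 0" "\<kappa> > 0"
  obtains v where "norm v \<le> 1" "norm (blinfun_apply e v - 1) < \<tau>"
    "rc_re (blinfun_apply f v) > rc_re (a f) + norm (f - dual_scale (a f) e) - \<kappa>"
proof -
  note aD = L_coefficientD[OF a]
  define g where "g = f - dual_scale (a f) e"
  have g: "g \<in> dual_space smul" using e f by (auto simp: g_def)
  obtain z where z: "norm z \<le> 1" "norm g - \<kappa> / 2 < rc_re (blinfun_apply g z)"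
    using obtain_almost_norming[OF g, of "norm g - \<kappa> / 2"] \<open>\<kappa> > 0\<close> by auto
  define \<phi> where "\<phi> h = a h + blinfun_apply (h - dual_scale (a h) e) z" for h
  have bound: "norm (\<phi> h) \<le> norm h" if h: "h \<in> dual_space smul" for h
  proof -
    have "norm (\<phi> h) \<le> norm (a h) + norm (blinfun_apply (h - dual_scale (a h) e) z)"
      unfolding \<phi>_def by (rule norm_triangle_ineq)
    also have "\<dots> \<le> norm (a h) + norm (h - dual_scale (a h) e)"
      using norm_apply_le[of "h - dual_scale (a h) e" z] h e z(1) by auto
    finally show ?thesis using aD(4)[OF h] by simp
  qed
  obtain v where v: "norm v \<le> 1" "norm (blinfun_apply f v - \<phi> f) < min \<tau> (\<kappa> / 2)"
    "norm (blinfun_apply e v - \<phi> e) < min \<tau> (\<kappa> / 2)"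
    by (rule goldstine_two[OF f e _ _ bound, of "min \<tau> (\<kappa> / 2)"])
      (use \<open>\<tau> > 0\<close> \<open>\<kappa> > 0\<close> in \<open>auto simp: \<phi>_def aD(2,3) blinfun.bilinear_simps algebra_simps\<close>)
  show ?thesis
  proof (rule that[OF v(1)])
    show "norm (blinfun_apply e v - 1) < \<tau>"
      using v(3) by (simp add: \<phi>_def aD(1))
    have "rc_re (blinfun_apply f v) - rc_re (\<phi> f) > - \<kappa> / 2"
      using rc_re_ge[of "blinfun_apply f v - \<phi> f"] v(2) by simp
    then show "rc_re (blinfun_apply f v) > rc_re (a f) + norm (f - dual_scale (a f) e) - \<kappa>"
      using z(2) by (simp add: \<phi>_def g_def)
  qed
qed

text \<open>Approximate points of the face \<open>{e = 1}\<close> lie near much better ones. Otherwise a functional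
  \<open>f = a(f)e + g\<close> separates \<open>y\<close> from the better ones by a gap of \<open>2\<delta>\<close>; but the better ones reach
  \<open>Re a(f) + \<parallel>g\<parallel>\<close>, and \<open>y\<close> exceeds that by at most \<open>\<bar>a(f)\<bar>\<delta> \<le> \<delta>\<close>.\<close>

lemma almost_face_improve:
  assumes e: "e \<in> dual_space smul" and a: "L_coefficient e a"
    and y: "norm y \<le> 1" "norm (blinfun_apply e y - 1) < \<delta>" and "\<tau> > 0"
  obtains v where "norm v \<le> 1" "norm (blinfun_apply e v - 1) < \<tau>" "norm (v - y) < 2 * \<delta>"
proof (rule ccontr)
  note found = that
  assume no: "\<not> thesis"
  note aD = L_coefficientD[OF a]
  have "\<delta> > 0" using y(2) norm_ge_zero[of "blinfun_apply e y - 1"] by linarith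
  define V where "V = cball 0 1 \<inter> {v. blinfun_apply e v \<in> ball 1 \<tau>}"
  have VD: "norm v \<le> 1 \<and> norm (blinfun_apply e v - 1) < \<tau>" if "v \<in> V" for v
    using that by (simp add: V_def dist_norm norm_minus_commute)
  have VI: "v \<in> V" if "norm v \<le> 1" "norm (blinfun_apply e v - 1) < \<tau>" for v
    using that by (simp add: V_def dist_norm norm_minus_commute)
  have far: "2 * \<delta> \<le> norm (y - v)" if v: "v \<in> V" for v
    using no found[of v] VD[OF v] by (metis norm_minus_commute not_le)
  have "convex ((\<lambda>v. blinfun_apply e v) -` ball 1 \<tau>)"
    by (intro convex_linear_vimage convex_ball linearI) (auto simp: blinfun.bilinear_simps)
  then have "convex V" unfolding V_def by (intro convex_Int convex_cball) (simp add: vimage_def)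
  obtain v0 where "v0 \<in> V"
    using almost_face_norming[OF e a e \<open>\<tau> > 0\<close>, of 1] VI by auto
  then have "V \<noteq> {}" by blast
  obtain f where f: "f \<in> dual_ball smul"
    "\<And>v. v \<in> V \<Longrightarrow> rc_re (blinfun_apply f v) + 2 * \<delta> \<le> rc_re (blinfun_apply f y)"
    by (rule separate_point_from_convex[OF \<open>convex V\<close> \<open>V \<noteq> {}\<close> far]) auto
  have fD: "f \<in> dual_space smul" "norm f \<le> 1" using f by (auto simp: dual_ball_iff)
  define g where "g = f - dual_scale (a f) e"
  have g: "g \<in> dual_space smul" using e fD by (auto simp: g_def)
  obtain v where "v \<in> V" "rc_re (blinfun_apply f v) > rc_re (a f) + norm g - \<delta> / 2"
    using almost_face_norming[OF e a fD(1) \<open>\<tau> > 0\<close>, of "\<delta> / 2"] \<open>\<delta> > 0\<close> VI unfolding g_def by auto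
  then have 1: "rc_re (a f) + norm g + \<delta> < rc_re (blinfun_apply f y)"
    using f(2)[of v] \<open>\<delta> > 0\<close> by linarith
  have "blinfun_apply f y = a f + a f * (blinfun_apply e y - 1) + blinfun_apply g y"
    by (simp add: g_def blinfun.diff_left algebra_simps)
  then have "rc_re (blinfun_apply f y) = rc_re (a f) + rc_re (a f * (blinfun_apply e y - 1)) + rc_re (blinfun_apply g y)"
    by simp
  moreover have "rc_re (blinfun_apply g y) \<le> norm g"
    using rc_re_le[of "blinfun_apply g y"] norm_apply_le[OF g y(1)] by linarith
  moreover have "norm (a f * (blinfun_apply e y - 1)) \<le> 1 * \<delta>"
    unfolding norm_mult using aD(5)[OF fD(1)] fD(2) y(2) by (intro mult_mono) auto
  then have "rc_re (a f * (blinfun_apply e y - 1)) \<le> \<delta>"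
    using rc_re_le[of "a f * (blinfun_apply e y - 1)"] by linarith
  ultimately show False using 1 by linarith
qed

end

locale L1_predual_space = normed_space_over smul
  for smul :: "'k::real_or_complex \<Rightarrow> 'a::banach \<Rightarrow> 'a" +
  fixes M :: "'m measure"
  assumes infinite_dim: "infinite_dimensional smul" and L1: "L1_predual smul M"
begin

lemma nontrivial: "\<exists>x::'a. x \<noteq> 0"
proof (rule ccontr)
  assume "\<not> ?thesis"
  then have "span {} = (UNIV :: 'a set)" by (auto simp: span_empty)
  then show False using infinite_dim by (auto simp: infinite_dimensional_def)
qed

lemma norm_extreme: "e \<in> dual_extreme_points smul \<Longrightarrow> norm e = 1"
  using norm_dual_extreme_point nontrivial by blast

lemma obtain_coefficient:
  assumes "e \<in> dual_extreme_points smul"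
  obtains a where "L_coefficient e a"
  using L1_predual_extreme_coefficient[OF L1 assms nontrivial] by blast

text \<open>The coefficients of \<open>f\<close> along finitely many different lines have absolute sum at most \<open>\<parallel>f\<parallel>\<close>: removing
  the component along one line costs exactly its coefficient and does not change the others.\<close>

lemma small_L_coefficient:
  assumes inf: "infinitely_many_lines S" and S: "S \<subseteq> dual_extreme_points smul"
    and f: "f \<in> dual_space smul" and "\<eta> > 0"
  obtains e a where "e \<in> S" "L_coefficient e a" "norm (a f) < \<eta>"
proof -
  obtain a where a: "\<And>e. e \<in> dual_extreme_points smul \<Longrightarrow> L_coefficient e (a e)"
    using bchoice[of "dual_extreme_points smul" L_coefficient] obtain_coefficient by blast
  have "\<exists>F\<subseteq>S. finite F \<and> card F = n \<and> (\<forall>g\<in>dual_space smul. (\<Sum>e\<in>F. norm (a e g)) \<le> norm g)" for n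
  proof (induction n)
    case 0
    show ?case by (rule exI[of _ "{}"]) auto
  next
    case (Suc n)
    then obtain F where F: "F \<subseteq> S" "finite F" "card F = n"
      "\<And>g. g \<in> dual_space smul \<Longrightarrow> (\<Sum>e\<in>F. norm (a e g)) \<le> norm g" by blast
    obtain e where e: "e \<in> S" "\<And>f c. f \<in> F \<Longrightarrow> e \<noteq> dual_scale c f"
      using infinitely_many_linesD[OF inf F(2)] F(1) S by blast
    have eE: "e \<in> dual_extreme_points smul" using e S by blast
    note eD = dual_extreme_pointsD[OF eE]
    have "e \<notin> F" using e(2)[of e 1] by auto
    have "(\<Sum>e\<in>insert e F. norm (a e g)) \<le> norm g" if g: "g \<in> dual_space smul" for g
    proof -
      let ?g = "g - dual_scale (a e g) e"
      have "a f ?g = a f g" if "f \<in> F" for f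
      proof -
        have fE: "f \<in> dual_extreme_points smul" using that F S by blast
        have "a f e = 0"
          using L_coefficient_other[OF a[OF fE] fE eE] norm_extreme fE eE e(2)[OF that] by blast
        then show ?thesis using L_coefficient_diff[OF a[OF fE] g] L_coefficientD(3)[OF a[OF fE]] eD by auto
      qed
      then have "(\<Sum>f\<in>F. norm (a f g)) = (\<Sum>f\<in>F. norm (a f ?g))" by simp
      also have "\<dots> \<le> norm ?g" by (rule F(4)) (use g eD in auto)
      finally show ?thesis using L_coefficientD(4)[OF a[OF eE] g] \<open>e \<notin> F\<close> F(2) by simp
    qed
    then show ?case using F e \<open>e \<notin> F\<close> by (intro exI[of _ "insert e F"]) auto
  qed
  moreover obtain n :: nat where n: "norm f / \<eta> < n" using reals_Archimedean2 by blast
  ultimately obtain F where F: "F \<subseteq> S" "finite F" "card F = n" "(\<Sum>e\<in>F. norm (a e f)) \<le> norm f"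
    using f by blast
  have "\<exists>e\<in>F. norm (a e f) < \<eta>"
  proof (rule ccontr)
    assume "\<not> ?thesis"
    then have "n * \<eta> \<le> (\<Sum>e\<in>F. norm (a e f))"
      using sum_bounded_below[of F \<eta> "\<lambda>e. norm (a e f)"] F(3) by (auto simp: not_less)
    then show False using n F(4) \<open>\<eta> > 0\<close> by (simp add: field_simps)
  qed
  then obtain e where e: "e \<in> F" "norm (a e f) < \<eta>" by blast
  then have "e \<in> S" using F(1) by blast
  then have "L_coefficient e (a e)" using S by (intro a) blast
  show ?thesis by (rule that[OF \<open>e \<in> S\<close> \<open>L_coefficient e (a e)\<close> e(2)])
qed

section \<open>A sufficient condition for Delta-points\<close>

text \<open>The sign of \<open>x\<close> is flipped along a line on which \<open>f\<close> has a small coefficient and on which \<open>x\<close> is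
  almost \<open>1\<close> in modulus: \<open>f\<close> hardly notices, while the distance to \<open>x\<close> becomes almost \<open>2\<close>.\<close>

theorem delta_point_if_infinitely_many_lines:
  assumes x: "norm x \<le> 1"
    and inf: "\<And>\<delta>. \<delta> > 0 \<Longrightarrow>
      infinitely_many_lines {e \<in> dual_extreme_points smul. norm (blinfun_apply e x) > 1 - \<delta>}"
  shows "delta_point smul x"
  unfolding delta_point_def
proof (intro conjI allI ballI impI)
  have *: "1 - \<delta> \<le> norm x" if d: "\<delta> > 0" for \<delta>
  proof -
    obtain e where "e \<in> dual_extreme_points smul" "norm (blinfun_apply e x) > 1 - \<delta>"
      using infinitely_many_linesD[OF inf[OF d], of "{}"] by auto
    then show ?thesis using dual_extreme_pointsD(4)[of e x] by linarith
  qed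
  have "1 \<le> norm x"
  proof (rule field_le_epsilon)
    fix \<delta> :: real assume "0 < \<delta>"
    then show "1 \<le> norm x + \<delta>" using *[of \<delta>] by simp
  qed
  then show "x \<in> sphere 0 1" using x by simp
  fix \<epsilon> :: real and f and \<alpha> :: real
  assume "\<epsilon> > 0" and f: "f \<in> dual_space smul" and "\<alpha> > 0" and xs: "x \<in> slice f \<alpha>"
  define s where "s = (SUP z\<in>cball 0 1. rc_re (blinfun_apply f z)) - \<alpha>"
  define \<gamma> where "\<gamma> = rc_re (blinfun_apply f x) - s"
  have "\<gamma> > 0" using xs by (simp add: slice_def \<gamma>_def s_def)
  define \<eta> where "\<eta> = min (\<gamma> / 3) (\<epsilon> / 4)"
  have \<eta>: "\<eta> > 0" "\<eta> \<le> \<gamma> / 3" "\<eta> \<le> \<epsilon> / 4" using \<open>\<gamma> > 0\<close> \<open>\<epsilon> > 0\<close> by (auto simp: \<eta>_def)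
  have e4: "0 < \<epsilon> / 4" using \<open>\<epsilon> > 0\<close> by simp
  obtain e a where ea: "e \<in> {e \<in> dual_extreme_points smul. norm (blinfun_apply e x) > 1 - \<epsilon> / 4}"
    "L_coefficient e a" "norm (a f) < \<eta>"
    by (rule small_L_coefficient[OF inf[OF e4] Collect_restrict f \<eta>(1)])
  have e: "e \<in> dual_extreme_points smul" and ex: "norm (blinfun_apply e x) > 1 - \<epsilon> / 4" using ea by auto
  note eD = dual_extreme_pointsD[OF e] and aD = L_coefficientD[OF ea(2)]
  have ex1: "norm (blinfun_apply e x) \<le> 1" using eD(4)[of x] x by linarith
  \<comment> \<open>The element of the bidual that is \<open>-x\<close> on the line of \<open>e\<close> and \<open>x\<close> on its complement.\<close>
  define \<phi> where "\<phi> h = blinfun_apply h x - 2 * a h * blinfun_apply e x" for h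
  have bound: "norm (\<phi> h) \<le> norm h" if h: "h \<in> dual_space smul" for h
  proof -
    have "\<phi> h = blinfun_apply (h - dual_scale (a h) e) x - a h * blinfun_apply e x"
      by (simp add: \<phi>_def blinfun.diff_left)
    then have "norm (\<phi> h) \<le> norm (blinfun_apply (h - dual_scale (a h) e) x) + norm (a h * blinfun_apply e x)"
      by (simp only: norm_triangle_ineq4)
    also have "\<dots> \<le> norm (h - dual_scale (a h) e) + norm (a h)"
      using norm_apply_le[of "h - dual_scale (a h) e" x] h eD(1) x ex1
      by (intro add_mono) (auto simp: norm_mult intro!: mult_left_le)
    finally show ?thesis using aD(4)[OF h] by simp
  qed
  obtain y where y: "norm y \<le> 1" "norm (blinfun_apply f y - \<phi> f) < \<eta>" "norm (blinfun_apply e y - \<phi> e) < \<eta>"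
    by (rule goldstine_two[OF f eD(1) _ _ bound \<eta>(1)])
      (auto simp: \<phi>_def aD(2,3) blinfun.add_left algebra_simps)
  show "\<exists>y\<in>slice f \<alpha>. norm (x - y) > 2 - \<epsilon>"
  proof (intro bexI)
    have "norm (a f * blinfun_apply e x) \<le> norm (a f)"
      using ex1 by (simp add: norm_mult mult_left_le)
    then have "rc_re (a f * blinfun_apply e x) < \<eta>"
      using rc_re_le[of "a f * blinfun_apply e x"] ea(3) by linarith
    moreover have "rc_re (\<phi> f) = rc_re (blinfun_apply f x) - 2 * rc_re (a f * blinfun_apply e x)"
      using rc_re_of_real_mult[of 2 "a f * blinfun_apply e x"] by (simp add: \<phi>_def mult.assoc)
    moreover have "rc_re (blinfun_apply f y) - rc_re (\<phi> f) > - \<eta>"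
      using rc_re_ge[of "blinfun_apply f y - \<phi> f"] y(2) by simp
    ultimately have "rc_re (blinfun_apply f y) > rc_re (blinfun_apply f x) - 3 * \<eta>" by linarith
    then have "rc_re (blinfun_apply f y) > s" using \<eta>(2) by (simp add: \<gamma>_def)
    then show "y \<in> slice f \<alpha>" using y(1) by (simp add: slice_def s_def)
    have "norm (2 * blinfun_apply e x) \<le> norm (blinfun_apply e (x - y)) + norm (blinfun_apply e y - \<phi> e)"
      using norm_triangle_ineq[of "blinfun_apply e (x - y)" "blinfun_apply e y - \<phi> e"]
      by (simp add: \<phi>_def aD(1) blinfun.diff_right)
    moreover have "norm (blinfun_apply e (x - y)) \<le> norm (x - y)" by (rule eD(4))
    ultimately show "norm (x - y) > 2 - \<epsilon>" using y(3) ex \<eta>(3) \<open>\<epsilon> > 0\<close> by (simp add: norm_mult)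
  qed
qed

section \<open>The face of the unit ball exposed by an extreme functional\<close>

text \<open>Successive improvement with defects \<open>\<delta>, \<delta>/2, \<delta>/4, ...\<close> converges by completeness, and the steps sum
  up to at most \<open>4\<delta>\<close>.\<close>

lemma face_near_almost_face:
  assumes e: "e \<in> dual_space smul" and a: "L_coefficient e a"
    and y: "norm y \<le> 1" "norm (blinfun_apply e y - 1) < \<delta>"
  obtains z where "norm z \<le> 1" "blinfun_apply e z = 1" "norm (z - y) \<le> 4 * \<delta>"
proof -
  have "\<delta> > 0" using y(2) norm_ge_zero[of "blinfun_apply e y - 1"] by linarith
  let ?P = "\<lambda>n v. norm v \<le> 1 \<and> norm (blinfun_apply e v - 1) < \<delta> * (1/2) ^ n \<and> (n = 0 \<longrightarrow> v = y)"
  obtain v where v: "\<And>n. ?P n (v n)" and step: "\<And>n. norm (v (Suc n) - v n) < 2 * (\<delta> * (1/2) ^ n)"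
  proof (rule dependent_nat_choice[of ?P "\<lambda>n v w. norm (w - v) < 2 * (\<delta> * (1/2) ^ n)", THEN exE])
    show "\<exists>x. ?P 0 x" using y by auto
    fix v n assume "?P n v"
    then obtain w where "norm w \<le> 1" "norm (blinfun_apply e w - 1) < \<delta> * (1/2) ^ Suc n"
      "norm (w - v) < 2 * (\<delta> * (1/2) ^ n)"
      using almost_face_improve[OF e a, of v "\<delta> * (1/2) ^ n" "\<delta> * (1/2) ^ Suc n"] \<open>\<delta> > 0\<close> by auto
    then show "\<exists>w. ?P (Suc n) w \<and> norm (w - v) < 2 * (\<delta> * (1/2) ^ n)" by auto
  qed auto
  have geo: "(\<lambda>n. 2 * (\<delta> * (1/2) ^ n)) sums (4 * \<delta>)"
    using sums_mult[OF geometric_sums[of "1/2 :: real"], of "2 * \<delta>"] by (simp add: mult.assoc)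
  have sn: "summable (\<lambda>n. norm (v (Suc n) - v n))"
    by (rule summable_comparison_test'[OF sums_summable[OF geo], of 0]) (use step in \<open>auto intro: less_imp_le\<close>)
  then have s: "summable (\<lambda>n. v (Suc n) - v n)" by (rule summable_norm_cancel)
  define z where "z = y + (\<Sum>n. v (Suc n) - v n)"
  have "(\<lambda>n. y + (\<Sum>i<n. v (Suc i) - v i)) \<longlonglongrightarrow> z"
    unfolding z_def by (intro tendsto_add tendsto_const summable_LIMSEQ s)
  then have lim: "v \<longlonglongrightarrow> z" using v[of 0] by (simp add: sum_lessThan_telescope)
  show ?thesis
  proof (rule that)
    show "norm z \<le> 1" by (rule LIMSEQ_le_const2[OF tendsto_norm[OF lim]]) (use v in auto)
    have "(\<lambda>n. norm (blinfun_apply e (v n) - 1)) \<longlonglongrightarrow> norm (blinfun_apply e z - 1)"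
      by (intro tendsto_intros lim)
    moreover have "(\<lambda>n. norm (blinfun_apply e (v n) - 1)) \<longlonglongrightarrow> 0"
    proof (rule tendsto_sandwich[OF _ _ tendsto_const])
      show "(\<lambda>n. \<delta> * (1/2) ^ n) \<longlonglongrightarrow> 0"
        by (rule tendsto_mult_right_zero) (simp add: LIMSEQ_realpow_zero)
    qed (use v in \<open>auto intro!: always_eventually less_imp_le\<close>)
    ultimately show "blinfun_apply e z = 1" using LIMSEQ_unique by fastforce
    have "norm (\<Sum>n. v (Suc n) - v n) \<le> (\<Sum>n. norm (v (Suc n) - v n))" by (rule summable_norm[OF sn])
    also have "\<dots> \<le> (\<Sum>n. 2 * (\<delta> * (1/2) ^ n))"
      by (rule suminf_le[OF _ sn sums_summable[OF geo]]) (use step in \<open>auto intro: less_imp_le\<close>)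
    also have "\<dots> = 4 * \<delta>" using sums_unique[OF geo] by simp
    finally show "norm (z - y) \<le> 4 * \<delta>" by (simp add: z_def)
  qed
qed

text \<open>The points found by \<open>almost_face_norming\<close> can be moved into the face with little change of \<open>f\<close>.\<close>

lemma face_norming:
  assumes e: "e \<in> dual_space smul" "norm e \<le> 1" and a: "L_coefficient e a" and f: "f \<in> dual_space smul"
    and "\<kappa> > 0"
  obtains z where "norm z \<le> 1" "blinfun_apply e z = 1"
    "rc_re (blinfun_apply f z) > rc_re (a f) + norm (f - dual_scale (a f) e) - \<kappa>"
proof -
  define \<tau> where "\<tau> = \<kappa> / (8 * (norm f + 1))"
  have fp: "norm f + 1 > 0" using norm_ge_zero[of f] by linarith
  then have \<tau>: "\<tau> > 0" using \<open>\<kappa> > 0\<close> by (simp add: \<tau>_def)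
  obtain v where v: "norm v \<le> 1" "norm (blinfun_apply e v - 1) < \<tau>"
    "rc_re (blinfun_apply f v) > rc_re (a f) + norm (f - dual_scale (a f) e) - \<kappa> / 2"
    using almost_face_norming[OF e(1) a f \<tau>, of "\<kappa> / 2"] \<open>\<kappa> > 0\<close> by auto
  obtain z where z: "norm z \<le> 1" "blinfun_apply e z = 1" "norm (z - v) \<le> 4 * \<tau>"
    using face_near_almost_face[OF e(1) a v(1,2)] by blast
  have "norm (blinfun_apply f (z - v)) \<le> norm f * (4 * \<tau>)"
    using norm_blinfun[of f "z - v"] z(3) by (meson mult_left_mono norm_ge_zero order_trans)
  also have "\<dots> \<le> (norm f + 1) * (4 * \<tau>)" using \<tau> by (intro mult_right_mono) auto
  also have "\<dots> = \<kappa> / 2"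
  proof -
    have "N * (4 * (\<kappa> / (8 * N))) = \<kappa> / 2" if "N > 0" for N :: real using that by simp
    from this[OF fp] show ?thesis by (simp only: \<tau>_def)
  qed
  finally have "rc_re (blinfun_apply f z) - rc_re (blinfun_apply f v) \<ge> - \<kappa> / 2"
    using rc_re_ge[of "blinfun_apply f (z - v)"] by (simp add: blinfun.diff_right)
  then show ?thesis using that[OF z(1,2)] v(3) by simp
qed

text \<open>A functional \<open>f\<close> separating a point of the ball from the closed convex hull of the \<open>\<Delta>\<close>-points can be
  rotated so that \<open>a(f) = \<bar>a(f)\<bar>\<close>; then its supremum over the rotated face is \<open>\<bar>a(f)\<bar> + \<parallel>f - a(f)e\<parallel> = \<parallel>f\<parallel>\<close>.\<close>

theorem convex_DLD2P_if_delta_face: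
  assumes e: "e \<in> dual_extreme_points smul"
    and inf: "\<And>y \<delta>. \<lbrakk>norm y \<le> 1; blinfun_apply e y = 1; \<delta> > 0\<rbrakk> \<Longrightarrow>
      infinitely_many_lines {e \<in> dual_extreme_points smul. norm (blinfun_apply e y) > 1 - \<delta>}"
  shows "convex_DLD2P smul"
proof -
  let ?D = "{x. delta_point smul x}"
  note eD = dual_extreme_pointsD[OF e]
  obtain a where a: "L_coefficient e a" by (rule obtain_coefficient[OF e])
  note aD = L_coefficientD[OF a]
  have delta: "delta_point smul (smul c y)" if "norm y \<le> 1" "blinfun_apply e y = 1" "norm c = 1" for c y
  proof (rule delta_point_if_infinitely_many_lines)
    show "norm (smul c y) \<le> 1" using that by (simp add: norm_smul)
    fix \<delta> :: real assume "\<delta> > 0"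
    from inf[OF that(1,2) this] show
      "infinitely_many_lines {e \<in> dual_extreme_points smul. norm (blinfun_apply e (smul c y)) > 1 - \<delta>}"
      by (rule infinitely_many_lines_mono)
        (auto simp: dual_spaceD[OF dual_extreme_pointsD(1)] norm_mult that(3))
  qed
  have "closure (convex hull ?D) \<subseteq> cball 0 1"
    by (intro closure_minimal hull_minimal) (auto simp: delta_point_def)
  moreover have "cball 0 1 \<subseteq> closure (convex hull ?D)"
  proof
    fix x :: 'a assume "x \<in> cball 0 1"
    then have x: "norm x \<le> 1" by simp
    show "x \<in> closure (convex hull ?D)"
    proof (rule ccontr)
      assume "x \<notin> closure (convex hull ?D)"
      then obtain r where r: "r > 0" "\<And>c. c \<in> convex hull ?D \<Longrightarrow> r \<le> norm (x - c)"
        by (auto simp: closure_approachable dist_norm norm_minus_commute not_less)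
      obtain z where "norm z \<le> 1" "blinfun_apply e z = 1"
        using face_norming[OF eD(1,2) a eD(1), of 1] by auto
      then have "delta_point smul (smul 1 z)" by (intro delta) auto
      then have ne: "convex hull ?D \<noteq> {}" by auto
      obtain f where f: "f \<in> dual_ball smul"
        "\<And>c. c \<in> convex hull ?D \<Longrightarrow> rc_re (blinfun_apply f c) + r \<le> rc_re (blinfun_apply f x)"
        by (rule separate_point_from_convex[OF convex_convex_hull ne r(2)]) auto
      have fD: "f \<in> dual_space smul" using f by (auto simp: dual_ball_iff)
      obtain c where c: "norm c = 1" "c * a f = of_real (norm (a f))" by (rule ex_unit_rotation)
      let ?f = "dual_scale c f"
      have cf: "?f \<in> dual_space smul" using fD by auto
      have af: "a ?f = of_real (norm (a f))" using aD(3)[OF fD] c by simp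
      have "norm f = norm ?f" using c by simp
      also have "\<dots> = norm (a f) + norm (?f - dual_scale (a ?f) e)"
        using aD(4)[OF cf] af by simp
      finally have nf: "norm f = rc_re (a ?f) + norm (?f - dual_scale (a ?f) e)" using af by simp
      obtain z where z: "norm z \<le> 1" "blinfun_apply e z = 1" "rc_re (blinfun_apply ?f z) > norm f - r"
        using face_norming[OF eD(1,2) a cf \<open>r > 0\<close>] nf by auto
      have "smul c z \<in> convex hull ?D" using delta[OF z(1,2) c(1)] by (simp add: hull_inc)
      from f(2)[OF this] have "rc_re (blinfun_apply ?f z) + r \<le> rc_re (blinfun_apply f x)"
        by (simp add: dual_spaceD[OF fD])
      also have "\<dots> \<le> norm f"
        using rc_re_le[of "blinfun_apply f x"] norm_apply_le[OF fD x] by linarith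
      finally show False using z(3) by simp
    qed
  qed
  ultimately show ?thesis unfolding convex_DLD2P_def by (intro antisym)
qed

end

section \<open>Weak-star closed extreme boundary\<close>

text \<open>The span of \<open>B\<close> complements the common kernel of \<open>F\<close>: a further functional adds one vector to \<open>B\<close> unless
  it already vanishes on that kernel. So functionals that separate points bound the dimension.\<close>

lemma (in normed_space_over) finite_functionals_complement:
  assumes "finite F" "F \<subseteq> dual_space smul"
  shows "\<exists>B. finite B \<and> (\<forall>x. \<exists>b\<in>span B. \<forall>f\<in>F. blinfun_apply f (x - b) = 0)"
  using assms
proof (induction F)
  case empty
  have "\<exists>b\<in>span {}. \<forall>f\<in>{}. blinfun_apply f (x - b) = 0" for x
    by (intro bexI[of _ 0]) (auto intro: span_zero)
  then show ?case by (intro exI[of _ "{}"]) simp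
next
  case (insert e F)
  then obtain B where B: "finite B" "\<And>x. \<exists>b\<in>span B. \<forall>f\<in>F. blinfun_apply f (x - b) = 0" by auto
  have e: "e \<in> dual_space smul" and F: "F \<subseteq> dual_space smul" using insert.prems by auto
  show ?case
  proof (cases "\<exists>z. blinfun_apply e z \<noteq> 0 \<and> (\<forall>f\<in>F. blinfun_apply f z = 0)")
    case True
    then obtain z where z: "blinfun_apply e z \<noteq> 0" "\<And>f. f \<in> F \<Longrightarrow> blinfun_apply f z = 0" by blast
    have "\<exists>b\<in>span (insert z B). \<forall>f\<in>insert e F. blinfun_apply f (x - b) = 0" for x
    proof -
      obtain b where b: "b \<in> span B" "\<forall>f\<in>F. blinfun_apply f (x - b) = 0" using B(2) by blast
      let ?c = "blinfun_apply e (x - b) / blinfun_apply e z"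
      have "b \<in> span (insert z B)" using b(1) span_mono[OF subset_insertI] by blast
      then have "b + smul ?c z \<in> span (insert z B)"
        by (rule span_add[OF _ span_scale[OF span_base]]) simp
      moreover have "blinfun_apply f (x - (b + smul ?c z)) = blinfun_apply f (x - b) - ?c * blinfun_apply f z"
        if "f \<in> dual_space smul" for f
        by (simp add: blinfun.bilinear_simps dual_spaceD[OF that] del: times_divide_eq_left)
      ultimately show ?thesis using b(2) z e F by (intro bexI[of _ "b + smul ?c z"]) auto
    qed
    then show ?thesis using B(1) by (intro exI[of _ "insert z B"]) auto
  next
    case False
    then have "\<exists>b\<in>span B. \<forall>f\<in>insert e F. blinfun_apply f (x - b) = 0" for x
      using B(2)[of x] by auto
    then show ?thesis using B(1) by blast
  qed
qed

context L1_predual_space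
begin

text \<open>Extreme points norm every vector, so if they lay on finitely many lines, finitely many of them
  would separate points.\<close>

lemma infinitely_many_lines_dual_extreme_points:
  "infinitely_many_lines (dual_extreme_points smul)"
  unfolding infinitely_many_lines_def
proof (intro allI impI, rule ccontr)
  fix F assume F: "finite F" "F \<subseteq> dual_extreme_points smul"
    and no: "\<not> (\<exists>e\<in>dual_extreme_points smul. \<forall>f\<in>F. \<forall>c. e \<noteq> dual_scale c f)"
  have "F \<subseteq> dual_space smul" using F(2) dual_extreme_pointsD(1) by blast
  from finite_functionals_complement[OF F(1) this] obtain B where
    B: "finite B" "\<forall>x. \<exists>b\<in>span B. \<forall>f\<in>F. blinfun_apply f (x - b) = 0" by (elim exE conjE)
  have "x \<in> span B" for x
  proof -
    obtain b where b: "b \<in> span B" "\<forall>f\<in>F. blinfun_apply f (x - b) = 0" using B(2) by blast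
    obtain e where e: "e \<in> dual_extreme_points smul" "blinfun_apply e (x - b) = of_real (norm (x - b))"
      by (rule extreme_norming_functional)
    then obtain f c where "f \<in> F" "e = dual_scale c f" using no by blast
    then have "norm (x - b) = 0" using b(2) e(2) by simp
    then show ?thesis using b(1) by simp
  qed
  then show False using infinite_dim B(1) by (auto simp: infinite_dimensional_def)
qed

text \<open>Compactness yields an extreme point \<open>e\<close> such that every weak-star neighbourhood of \<open>e\<close> meets
  infinitely many of the lines. For \<open>y\<close> with \<open>e(y) = 1\<close>, the functionals with \<open>\<bar>h(y)\<bar> > 1 - \<delta>\<close> form such a
  neighbourhood.\<close>

theorem convex_DLD2P_if_closed_extreme_points:
  assumes cl: "closedin (weak_star_topology smul) (dual_extreme_points smul)"
  shows "convex_DLD2P smul"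
proof -
  let ?E = "dual_extreme_points smul"
  have "?E \<subseteq> dual_ball smul" using dual_extreme_pointsD(3) by blast
  then have K: "compact (blinfun_apply ` ?E)" using closedin_weak_star_iff cl by blast
  \<comment> \<open>Otherwise finitely many of the exceptional neighbourhoods would cover the compact boundary.\<close>
  have "\<exists>e\<in>?E. \<forall>U. open U \<longrightarrow> blinfun_apply e \<in> U \<longrightarrow> infinitely_many_lines {e \<in> ?E. blinfun_apply e \<in> U}"
  proof (rule ccontr)
    assume neg: "\<not> ?thesis"
    have "\<exists>U F. open U \<and> blinfun_apply e \<in> U \<and> finite F \<and> F \<subseteq> ?E \<and>
        (\<forall>e'\<in>?E. blinfun_apply e' \<in> U \<longrightarrow> (\<exists>f\<in>F. \<exists>c. e' = dual_scale c f))" if e: "e \<in> ?E" for e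
    proof -
      obtain U where U: "open U" "blinfun_apply e \<in> U" "\<not> infinitely_many_lines {e \<in> ?E. blinfun_apply e \<in> U}"
        using neg e by meson
      obtain F where "finite F" "F \<subseteq> ?E" "\<not> (\<exists>e\<in>{e \<in> ?E. blinfun_apply e \<in> U}. \<forall>f\<in>F. \<forall>c. e \<noteq> dual_scale c f)"
        using U(3) unfolding infinitely_many_lines_def by meson
      then show ?thesis using U(1,2) by (intro exI[of _ U] exI[of _ F]) simp
    qed
    then have "\<forall>e\<in>?E. \<exists>U F. open U \<and> blinfun_apply e \<in> U \<and> finite F \<and> F \<subseteq> ?E \<and>
        (\<forall>e'\<in>?E. blinfun_apply e' \<in> U \<longrightarrow> (\<exists>f\<in>F. \<exists>c. e' = dual_scale c f))" by (intro ballI)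
    then obtain U F where UF: "\<forall>e\<in>?E. open (U e) \<and> blinfun_apply e \<in> U e \<and> finite (F e) \<and> F e \<subseteq> ?E \<and>
        (\<forall>e'\<in>?E. blinfun_apply e' \<in> U e \<longrightarrow> (\<exists>f\<in>F e. \<exists>c. e' = dual_scale c f))"
      by (simp only: bchoice_iff) (elim exE)
    then have U: "\<And>e. e \<in> ?E \<Longrightarrow> open (U e)" "\<And>e. e \<in> ?E \<Longrightarrow> blinfun_apply e \<in> U e"
      and F: "\<And>e. e \<in> ?E \<Longrightarrow> finite (F e)" "\<And>e. e \<in> ?E \<Longrightarrow> F e \<subseteq> ?E"
      "\<And>e e'. e \<in> ?E \<Longrightarrow> e' \<in> ?E \<Longrightarrow> blinfun_apply e' \<in> U e \<Longrightarrow> \<exists>f\<in>F e. \<exists>c. e' = dual_scale c f"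
      by simp_all
    obtain D where D: "D \<subseteq> ?E" "finite D" "blinfun_apply ` ?E \<subseteq> (\<Union>e\<in>D. U e)"
      by (rule compactE_image[OF K, of ?E U]) (use U in auto)
    have "finite (\<Union>e\<in>D. F e)" "(\<Union>e\<in>D. F e) \<subseteq> ?E" using D(1,2) F(1,2) by blast+
    then have "\<exists>e'\<in>?E. \<forall>f\<in>(\<Union>e\<in>D. F e). \<forall>c. e' \<noteq> dual_scale c f"
      by (rule infinitely_many_lines_dual_extreme_points[unfolded infinitely_many_lines_def, rule_format])
    then obtain e' where e': "e' \<in> ?E" "\<forall>f\<in>(\<Union>e\<in>D. F e). \<forall>c. e' \<noteq> dual_scale c f"
      by (elim bexE)
    obtain e where e: "e \<in> D" "blinfun_apply e' \<in> U e" using D(3) e'(1) by blast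
    obtain f c where f: "f \<in> F e" "e' = dual_scale c f" using F(3)[of e e'] D(1) e e'(1) by blast
    then have "f \<in> (\<Union>e\<in>D. F e)" using e(1) by blast
    from spec[OF bspec[OF e'(2) this], of c] f(2) show False by simp
  qed
  then obtain e where e: "e \<in> ?E" and
    acc: "\<And>U. open U \<Longrightarrow> blinfun_apply e \<in> U \<Longrightarrow> infinitely_many_lines {e \<in> ?E. blinfun_apply e \<in> U}"
    by blast
  show ?thesis
  proof (rule convex_DLD2P_if_delta_face[OF e])
    fix y and \<delta> :: real assume y: "blinfun_apply e y = 1" and "\<delta> > 0"
    let ?U = "{h :: 'a \<Rightarrow> 'k. 1 - \<delta> < norm (h y)}"
    have "open ?U"
      by (intro open_Collect_less continuous_intros continuous_on_product_coordinates)
    from acc[OF this] show "infinitely_many_lines {e \<in> ?E. norm (blinfun_apply e y) > 1 - \<delta>}"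
      using y \<open>\<delta> > 0\<close> by simp
  qed
qed

end

section \<open>Smooth Delta-points\<close>

text \<open>Smulian's lemma: functionals in the dual ball that almost norm a point \<open>x\<close> of smoothness converge
  weak-star to the norming functional \<open>e\<close>. Among those that differ from \<open>e\<close> at \<open>y\<close> by at least \<open>\<delta>\<close>, weak-star
  compactness provides one that is best at \<open>x\<close>, and by uniqueness it does not attain the norm there.\<close>

lemma (in normed_space_over) smulian:
  assumes x: "norm x = 1" and uniq: "\<And>f. f \<in> dual_space smul \<Longrightarrow> norm f = 1 \<Longrightarrow> blinfun_apply f x = 1 \<Longrightarrow> f = e"
    and "\<delta> > 0"
  obtains \<tau> where "\<tau> > 0" "\<And>h. h \<in> dual_ball smul \<Longrightarrow> norm (blinfun_apply h x - 1) < \<tau> \<Longrightarrow>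
    norm (blinfun_apply h y - blinfun_apply e y) < \<delta>"
proof -
  let ?K = "blinfun_apply ` dual_ball smul \<inter> {h. \<delta> \<le> norm (h y - blinfun_apply e y)}"
  have "closed {h :: 'a \<Rightarrow> 'k. \<delta> \<le> norm (h y - blinfun_apply e y)}"
    by (intro closed_Collect_le continuous_intros continuous_on_product_coordinates)
  then have K: "compact ?K" by (intro compact_Int_closed compact_dual_ball)
  show ?thesis
  proof (cases "?K = {}")
    case True
    show ?thesis
    proof (rule that[of 1])
      fix h assume "h \<in> dual_ball smul"
      then have "blinfun_apply h \<notin> {h. \<delta> \<le> norm (h y - blinfun_apply e y)}" using True by blast
      then show "norm (blinfun_apply h y - blinfun_apply e y) < \<delta>" by simp
    qed simp
  next
    case False
    have "continuous_on ?K (\<lambda>h. norm (h x - 1))"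
      by (intro continuous_intros continuous_on_subset[OF continuous_on_product_coordinates]) auto
    from continuous_attains_inf[OF K False this] obtain h0 where
      h0: "h0 \<in> ?K" "\<And>h. h \<in> ?K \<Longrightarrow> norm (h0 x - 1) \<le> norm (h x - 1)" by blast
    then obtain g where g: "h0 = blinfun_apply g" "g \<in> dual_space smul" "norm g \<le> 1" by (auto simp: dual_ball_iff)
    have "norm (h0 x - 1) \<noteq> 0"
    proof
      assume "norm (h0 x - 1) = 0"
      then have gx: "blinfun_apply g x = 1" by (simp add: g(1))
      then have "norm g = 1" using norm_blinfun[of g x] x g(3) by simp
      then have "g = e" using uniq g(2) gx by blast
      then show False using h0(1) g(1) \<open>\<delta> > 0\<close> by simp
    qed
    then have pos: "norm (h0 x - 1) > 0" by simp
    show ?thesis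
    proof (rule that[OF pos])
      fix h assume h: "h \<in> dual_ball smul" "norm (blinfun_apply h x - 1) < norm (h0 x - 1)"
      show "norm (blinfun_apply h y - blinfun_apply e y) < \<delta>"
      proof (rule ccontr)
        assume "\<not> ?thesis"
        then have "blinfun_apply h \<in> ?K" using h(1) by simp
        from h0(2)[OF this] show False using h(2) by simp
      qed
    qed
  qed
qed

context L1_predual_space
begin

text \<open>Given finitely many extreme points, those that are not multiples of the norming functional \<open>e\<close> have
  modulus at most some \<open>1 - \<gamma> < 1\<close> at \<open>x\<close>. A better norming extreme functional off the line of \<open>e\<close> therefore lies on a
  new line, and by Smulian's lemma it is close to \<open>1\<close> at every point of the face of \<open>e\<close>.\<close>

theorem convex_DLD2P_if_smooth_delta_point:
  assumes delta: "delta_point smul x" and smooth: "smooth_norm_at smul x"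
  shows "convex_DLD2P smul"
proof -
  let ?E = "dual_extreme_points smul"
  have x: "norm x = 1" using delta by (simp add: delta_point_def)
  obtain e where e: "e \<in> dual_space smul" "norm e = 1" "blinfun_apply e x = 1"
    and uniq: "\<And>f. f \<in> dual_space smul \<Longrightarrow> norm f = 1 \<Longrightarrow> blinfun_apply f x = 1 \<Longrightarrow> f = e"
    using smooth unfolding smooth_norm_at_def by blast
  obtain e' where e': "e' \<in> ?E" "blinfun_apply e' x = of_real (norm x)"
    by (rule extreme_norming_functional)
  have "e' = e" using e' x norm_extreme dual_extreme_pointsD(1) by (intro uniq) auto
  then have eE: "e \<in> ?E" using e'(1) by simp
  have rel: "\<exists>c. f = dual_scale c e" if "f \<in> ?E" "norm (blinfun_apply f x) = 1" for f
  proof -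
    let ?c = "blinfun_apply f x"
    have "?c \<noteq> 0" using that(2) by auto
    have "dual_scale (inverse ?c) f = e"
      using that norm_extreme[OF that(1)] dual_extreme_pointsD(1)[OF that(1)] \<open>?c \<noteq> 0\<close>
      by (intro uniq) (auto simp: norm_inverse)
    then have "dual_scale ?c e = dual_scale ?c (dual_scale (inverse ?c) f)" by simp
    then show ?thesis using \<open>?c \<noteq> 0\<close> by (intro exI[of _ ?c]) simp
  qed
  show ?thesis
  proof (rule convex_DLD2P_if_delta_face[OF eE])
    fix y and \<delta> :: real assume y: "norm y \<le> 1" "blinfun_apply e y = 1" and "\<delta> > 0"
    obtain \<tau> where \<tau>: "\<tau> > 0" "\<And>h. h \<in> dual_ball smul \<Longrightarrow> norm (blinfun_apply h x - 1) < \<tau> \<Longrightarrow>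
      norm (blinfun_apply h y - blinfun_apply e y) < \<delta>"
      using smulian[OF x uniq \<open>\<delta> > 0\<close>, of y] by blast
    show "infinitely_many_lines {e \<in> ?E. norm (blinfun_apply e y) > 1 - \<delta>}"
      unfolding infinitely_many_lines_def
    proof (intro allI impI)
      fix F assume F: "finite F" "F \<subseteq> ?E"
      let ?F = "{f \<in> F. norm (blinfun_apply f x) < 1}"
      define \<gamma> where "\<gamma> = Min (insert 1 ((\<lambda>f. 1 - norm (blinfun_apply f x)) ` ?F))"
      have \<gamma>: "\<gamma> > 0" "\<And>f. f \<in> ?F \<Longrightarrow> \<gamma> \<le> 1 - norm (blinfun_apply f x)"
        using F(1) by (auto simp: \<gamma>_def)
      \<comment> \<open>\<open>\<tau>\<^sup>2 / 4\<close> because \<open>Re z > 1 - \<epsilon>\<close> in the unit disc only gives \<open>\<bar>z - 1\<bar>\<^sup>2 \<le> 2\<epsilon>\<close>.\<close>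
      define \<epsilon> where "\<epsilon> = min (min \<gamma> (\<tau>\<^sup>2 / 4)) 1"
      have \<epsilon>: "\<epsilon> > 0" "\<epsilon> \<le> \<gamma>" "\<epsilon> \<le> \<tau>\<^sup>2 / 4" "\<epsilon> \<le> 1" using \<gamma> \<tau>(1) by (auto simp: \<epsilon>_def)
      \<comment> \<open>The \<open>\<Delta>\<close>-condition for a slice around \<open>x\<close> cut by \<open>e\<close> itself gives a point far from
        \<open>x\<close>; an extreme functional witnessing that distance is no multiple of \<open>e\<close>.\<close>
      have bdd: "bdd_above ((\<lambda>z. rc_re (blinfun_apply e z)) ` cball 0 1)"
        using rc_re_apply_le[OF e(1)] by (intro bdd_aboveI2[where M = "norm e"]) simp
      have sup_ge: "1 \<le> (SUP z\<in>cball 0 1. rc_re (blinfun_apply e z))"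
        using cSUP_upper[OF _ bdd, of x] x e(3) by simp
      have sup_le: "(SUP z\<in>cball 0 1. rc_re (blinfun_apply e z)) \<le> 1"
        using rc_re_apply_le[OF e(1)] e(2) by (intro cSUP_least) auto
      have "x \<in> slice e (1 / 8)" using sup_le x e(3) by (simp add: slice_def)
      then obtain z where z: "z \<in> slice e (1 / 8)" "norm (x - z) > 2 - \<epsilon>"
        using delta e(1) \<epsilon>(1) unfolding delta_point_def by (metis zero_less_divide_1_iff zero_less_numeral)
      have z1: "norm z \<le> 1" and ez: "rc_re (blinfun_apply e z) > 1 - 1 / 8"
        using z(1) sup_ge by (auto simp: slice_def)
      obtain h where h: "h \<in> ?E" "blinfun_apply h (x - z) = of_real (norm (x - z))"
        by (rule extreme_norming_functional)
      note hD = dual_extreme_pointsD[OF h(1)]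
      have "rc_re (blinfun_apply h x) - rc_re (blinfun_apply h z) = norm (x - z)"
        using arg_cong[OF h(2), of rc_re] by (simp add: blinfun.diff_right)
      moreover have "- rc_re (blinfun_apply h z) \<le> 1"
        using rc_re_ge[of "blinfun_apply h z"] hD(4)[of z] z1 by linarith
      ultimately have hx: "rc_re (blinfun_apply h x) > 1 - \<epsilon>" using z(2) by linarith
      have hx1: "norm (blinfun_apply h x) \<le> 1" using hD(4)[of x] x by simp
      have "(norm (blinfun_apply h x - 1))\<^sup>2 \<le> 2 * \<epsilon>"
        using norm_diff_1_sq_le[OF hx1, of \<epsilon>] hx by simp
      also have "\<dots> < \<tau>\<^sup>2" using \<epsilon> \<tau>(1) by (simp add: power2_eq_square)
      finally have "norm (blinfun_apply h x - 1) < \<tau>" using \<tau>(1) power_less_imp_less_base by fastforce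
      then have "norm (blinfun_apply h y - 1) < \<delta>" using \<tau>(2)[OF hD(3)] y(2) by simp
      then have hy: "norm (blinfun_apply h y) > 1 - \<delta>"
        using norm_triangle_ineq2[of 1 "1 - blinfun_apply h y"] by (simp add: norm_minus_commute)
      have not_e: "h \<noteq> dual_scale c e" for c
      proof
        assume hc: "h = dual_scale c e"
        then have "norm c = 1" using norm_extreme[OF h(1)] e(2) by simp
        have "norm (x - z) = norm (blinfun_apply h (x - z))" using h(2) by simp
        also have "\<dots> = norm (blinfun_apply e (x - z))"
          by (simp only: hc dual_scale_apply norm_mult \<open>norm c = 1\<close> mult_1)
        also have "\<dots> = norm (blinfun_apply e z - 1)"
          using e(3) by (simp add: blinfun.diff_right norm_minus_commute)
        finally have eq: "norm (x - z) = norm (blinfun_apply e z - 1)" .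
        have "norm (blinfun_apply e z) \<le> 1" using norm_apply_le[OF e(1) z1] e(2) by simp
        then have "(norm (blinfun_apply e z - 1))\<^sup>2 \<le> 2 * (1 / 8)"
          using ez by (intro norm_diff_1_sq_le) auto
        moreover have "1\<^sup>2 \<le> (norm (x - z))\<^sup>2" using z(2) \<epsilon>(4) by (intro power_mono) auto
        ultimately show False using eq by simp
      qed
      have "h \<noteq> dual_scale c f" if f: "f \<in> F" for f c
      proof
        assume hc: "h = dual_scale c f"
        have fE: "f \<in> ?E" using f F by blast
        have c1: "norm c = 1" using hc norm_extreme[OF h(1)] norm_extreme[OF fE] by simp
        have "norm (blinfun_apply f x) \<le> 1" using dual_extreme_pointsD(4)[OF fE, of x] x by simp
        moreover have "norm (blinfun_apply f x) \<noteq> 1"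
        proof
          assume "norm (blinfun_apply f x) = 1"
          then obtain d where "f = dual_scale d e" using rel[OF fE] by blast
          then show False using not_e[of "c * d"] hc by simp
        qed
        ultimately have "\<gamma> \<le> 1 - norm (blinfun_apply f x)" using \<gamma>(2) f by simp
        moreover have "norm (blinfun_apply h x) = norm (blinfun_apply f x)" using hc c1 by (simp add: norm_mult)
        ultimately show False using hx rc_re_le[of "blinfun_apply h x"] \<epsilon>(2) by linarith
      qed
      then show "\<exists>e\<in>{e \<in> ?E. norm (blinfun_apply e y) > 1 - \<delta>}. \<forall>f\<in>F. \<forall>c. e \<noteq> dual_scale c f"
        using h(1) hy by blast
    qed
  qed
qed

end

section \<open>Spaces of continuous functions\<close>

lemma apply_Bcontfun:
  fixes f :: "'t::topological_space \<Rightarrow> 'b::real_normed_vector"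
  assumes "continuous_on UNIV f" "\<And>t. norm (f t) \<le> B"
  shows "apply_bcontfun (Bcontfun f) = f"
proof (rule Bcontfun_inverse)
  show "f \<in> bcontfun"
    using assms by (auto simp: bcontfun_def bounded_iff)
qed

lemma compact_closed_subset:
  assumes "closed A" "compact K" "A \<subseteq> K"
  shows "compact A"
proof -
  have "K \<inter> A = A" using assms(3) by blast
  then show ?thesis using compact_Int_closed[OF assms(2,1)] by simp
qed

lemma C0_mult:
  fixes u :: "'t::t2_space \<Rightarrow>\<^sub>C 'k::real_or_complex"
  assumes u: "u \<in> C0" and \<psi>: "continuous_on UNIV \<psi>" "\<And>t. \<bar>\<psi> t\<bar> \<le> B"
  obtains v where "v \<in> C0" "\<And>t. apply_bcontfun v t = of_real (\<psi> t) * apply_bcontfun u t"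
proof -
  let ?f = "\<lambda>t. of_real (\<psi> t) * apply_bcontfun u t"
  have B: "B \<ge> 0" using \<psi>(2)[of undefined] by linarith
  have le: "norm (?f t) \<le> B * norm (apply_bcontfun u t)" for t
    using \<psi>(2)[of t] by (simp add: norm_mult mult_right_mono)
  have cont: "continuous_on UNIV ?f"
    by (intro continuous_intros \<psi>(1)) simp
  have "norm (?f t) \<le> B * norm u" for t
    using le[of t] norm_bounded[of u t] B by (meson mult_left_mono order_trans)
  from apply_Bcontfun[OF cont this] have app: "apply_bcontfun (Bcontfun ?f) = ?f" .
  have "Bcontfun ?f \<in> C0"
    unfolding C0_def mem_Collect_eq app
  proof (intro allI impI)
    fix e :: real assume "e > 0"
    have "closed {t. e \<le> norm (?f t)}"
      by (intro closed_Collect_le continuous_on_norm cont continuous_on_const)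
    moreover have "compact {t. e / (B + 1) \<le> norm (apply_bcontfun u t)}"
      using u \<open>e > 0\<close> B by (simp add: C0_def)
    moreover have "{t. e \<le> norm (?f t)} \<subseteq> {t. e / (B + 1) \<le> norm (apply_bcontfun u t)}"
    proof safe
      fix t assume "e \<le> norm (?f t)"
      then have "e \<le> B * norm (apply_bcontfun u t)" using le[of t] by linarith
      also have "\<dots> \<le> (B + 1) * norm (apply_bcontfun u t)" by (intro mult_right_mono) auto
      finally show "e / (B + 1) \<le> norm (apply_bcontfun u t)" using B by (simp add: field_simps)
    qed
    ultimately show "compact {t. e \<le> norm (?f t)}"
      by (rule compact_closed_subset)
  qed
  then show ?thesis by (rule that) (simp add: app)
qed

text \<open>A Urysohn function for a neighbourhood that lies in a compact set vanishes at infinity.\<close>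

lemma C0_bump:
  fixes p :: "'t::t2_space"
  assumes lc: "locally_compact_space (euclidean :: 't topology)" and U: "open U" "p \<in> U"
  obtains \<phi> :: "'t \<Rightarrow> real" and u :: "'t \<Rightarrow>\<^sub>C 'k::real_or_complex"
  where "u \<in> C0" "\<And>t. apply_bcontfun u t = of_real (\<phi> t)" "\<And>t. 0 \<le> \<phi> t" "\<And>t. \<phi> t \<le> 1" "\<phi> p = 1"
    "\<And>t. t \<notin> U \<Longrightarrow> \<phi> t = 0"
proof -
  have "Hausdorff_space (euclidean :: 't topology)"
    unfolding Hausdorff_space_def
  proof (intro allI impI)
    fix x y :: 't assume "x \<in> topspace euclidean \<and> y \<in> topspace euclidean \<and> x \<noteq> y"
    then obtain A B where "open A" "open B" "x \<in> A" "y \<in> B" "A \<inter> B = {}"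
      using hausdorff[of x y] by auto
    then show "\<exists>A B. openin euclidean A \<and> openin euclidean B \<and> x \<in> A \<and> y \<in> B \<and> disjnt A B"
      by (intro exI[of _ A] exI[of _ B]) (simp add: disjnt_def)
  qed
  then have cr: "completely_regular_space (euclidean :: 't topology)"
    using locally_compact_regular_imp_completely_regular_space lc by blast
  obtain V K where VK: "open V" "compact K" "p \<in> V" "V \<subseteq> K"
    using lc[unfolded locally_compact_space_def, rule_format, of p] by auto
  have "closedin euclidean (- (U \<inter> V)) \<and> p \<in> topspace euclidean - (- (U \<inter> V))"
    using U VK by (simp add: closed_Un closed_Compl)
  then obtain f :: "'t \<Rightarrow> real" where f: "continuous_map euclidean (top_of_set {0..1}) f"
    "f p = 0" "f ` (- (U \<inter> V)) \<subseteq> {1}"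
    using cr[unfolded completely_regular_space_def, rule_format, of "- (U \<inter> V)" p] by auto
  have f01: "0 \<le> f t" "f t \<le> 1" for t
    using f(1) by (auto simp: continuous_map_in_subtopology image_subset_iff Pi_iff)
  have cf: "continuous_on UNIV f" using f(1) by (simp add: continuous_map_in_subtopology)
  define \<phi> where "\<phi> t = 1 - f t" for t
  have c\<phi>: "continuous_on UNIV (\<lambda>t. of_real (\<phi> t) :: 'k)"
    unfolding \<phi>_def by (intro continuous_intros cf)
  have "norm (of_real (\<phi> t) :: 'k) \<le> 1" for t unfolding norm_of_real using f01[of t] by (simp add: \<phi>_def)
  from apply_Bcontfun[OF c\<phi> this] have app: "apply_bcontfun (Bcontfun (\<lambda>t. of_real (\<phi> t) :: 'k)) = (\<lambda>t. of_real (\<phi> t))" .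
  have out: "\<phi> t = 0" if "t \<notin> U \<inter> V" for t using f(3) that by (auto simp: \<phi>_def)
  show ?thesis
  proof (rule that[of "Bcontfun (\<lambda>t. of_real (\<phi> t))" \<phi>])
    show "Bcontfun (\<lambda>t. of_real (\<phi> t) :: 'k) \<in> C0"
      unfolding C0_def mem_Collect_eq app
    proof (intro allI impI)
      fix e :: real assume "e > 0"
      have "closed {t. e \<le> norm (of_real (\<phi> t) :: 'k)}"
        by (intro closed_Collect_le continuous_on_norm c\<phi> continuous_on_const)
      moreover have "{t. e \<le> norm (of_real (\<phi> t) :: 'k)} \<subseteq> K"
      proof safe
        fix t assume "e \<le> norm (of_real (\<phi> t) :: 'k)"
        then have "\<phi> t \<noteq> 0" using \<open>e > 0\<close> by auto
        then show "t \<in> K" using out[of t] VK(4) by blast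
      qed
      ultimately show "compact {t. e \<le> norm (of_real (\<phi> t) :: 'k)}"
        by (rule compact_closed_subset[OF _ VK(2)])
    qed
    show "\<phi> p = 1" by (simp add: \<phi>_def f(2))
    show "t \<notin> U \<Longrightarrow> \<phi> t = 0" for t using out by blast
    show "apply_bcontfun (Bcontfun (\<lambda>t. of_real (\<phi> t))) t = (of_real (\<phi> t) :: 'k)" for t
      by (simp only: app)
    show "0 \<le> \<phi> t" "\<phi> t \<le> 1" for t using f01[of t] by (simp_all add: \<phi>_def)
  qed
qed

lemma C0_compact_space:
  assumes "compact (UNIV :: 't::t2_space set)"
  shows "(C0 :: ('t \<Rightarrow>\<^sub>C 'k::real_or_complex) set) = UNIV"
proof -
  have "compact {t. e \<le> norm (apply_bcontfun u t)}" for e and u :: "'t \<Rightarrow>\<^sub>C 'k"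
  proof -
    have "closed {t. e \<le> norm (apply_bcontfun u t)}"
      by (intro closed_Collect_le continuous_on_norm continuous_on_const) simp
    then show ?thesis using assms by (rule compact_closed_subset) simp
  qed
  then show ?thesis by (auto simp: C0_def)
qed

locale C0_space = normed_space_over smul
  for smul :: "'k::real_or_complex \<Rightarrow> 'a::real_normed_vector \<Rightarrow> 'a" +
  fixes J :: "'a \<Rightarrow> ('t::t2_space \<Rightarrow>\<^sub>C 'k)"
  assumes locally_compact: "locally_compact_space (euclidean :: 't topology)"
    and range_J: "range J = C0"
    and J_add: "J (x + y) = J x + J y"
    and J_smul: "apply_bcontfun (J (smul c x)) t = c * apply_bcontfun (J x) t"
    and norm_J: "norm (J x) = norm x"
begin

lemma J_apply_add [simp]: "apply_bcontfun (J (x + y)) t = apply_bcontfun (J x) t + apply_bcontfun (J y) t"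
  by (simp add: J_add)

lemma J_apply_scaleR [simp]: "apply_bcontfun (J (r *\<^sub>R x)) t = r *\<^sub>R apply_bcontfun (J x) t"
  using J_smul[of "of_real r" x t] by (simp add: smul_of_real scaleR_conv_of_real)

lemma J_apply_diff [simp]: "apply_bcontfun (J (x - y)) t = apply_bcontfun (J x) t - apply_bcontfun (J y) t"
  using J_apply_add[of x "(-1) *\<^sub>R y" t] J_apply_scaleR[of "-1" y t] by simp

lemma J_apply_0 [simp]: "apply_bcontfun (J 0) t = 0"
  using J_apply_scaleR[of 0 0 t] by simp

lemma J_apply_sum: "apply_bcontfun (J (\<Sum>i\<in>A. x i)) t = (\<Sum>i\<in>A. apply_bcontfun (J (x i)) t)"
  by (induction A rule: infinite_finite_induct) auto

lemma norm_J_apply_le: "norm (apply_bcontfun (J x) t) \<le> norm x"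
  using norm_bounded[of "J x" t] norm_J by simp

lemma norm_leI: "(\<And>t. norm (apply_bcontfun (J x) t) \<le> b) \<Longrightarrow> norm x \<le> b"
  using norm_bound[of "J x" b] norm_J by simp

lemma J_eqI:
  assumes "\<And>t. apply_bcontfun (J x) t = apply_bcontfun (J y) t"
  shows "x = y"
proof -
  have "norm (x - y) \<le> 0" by (rule norm_leI) (simp add: assms)
  then show ?thesis by simp
qed

lemma obtain_mult:
  assumes "continuous_on UNIV \<psi>" "\<And>t. \<bar>\<psi> t\<bar> \<le> B"
  obtains y where "\<And>t. apply_bcontfun (J y) t = of_real (\<psi> t) * apply_bcontfun (J x) t"
proof -
  have "J x \<in> C0" using range_J by blast
  then show thesis
  proof (rule C0_mult[OF _ assms])
    fix v assume v: "v \<in> C0" "\<And>t. apply_bcontfun v t = of_real (\<psi> t) * apply_bcontfun (J x) t"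
    obtain y where "v = J y" using v(1) range_J by blast
    then show thesis using v(2) by (intro that[of y]) simp
  qed
qed

lemma obtain_bump:
  assumes "open U" "p \<in> U"
  obtains \<phi> x where "\<And>t. apply_bcontfun (J x) t = of_real (\<phi> t)" "\<And>t. 0 \<le> \<phi> t" "\<And>t. \<phi> t \<le> 1"
    "\<phi> p = 1" "\<And>t. t \<notin> U \<Longrightarrow> \<phi> t = 0"
proof -
  obtain \<phi> :: "'t \<Rightarrow> real" and u :: "'t \<Rightarrow>\<^sub>C 'k" where u: "u \<in> C0" "\<And>t. apply_bcontfun u t = of_real (\<phi> t)" "\<And>t. 0 \<le> \<phi> t" "\<And>t. \<phi> t \<le> 1" "\<phi> p = 1"
    "\<And>t. t \<notin> U \<Longrightarrow> \<phi> t = 0"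
    by (rule C0_bump[OF locally_compact assms, where 'k = 'k]) (rule that)
  obtain x where "u = J x" using u(1) range_J by blast
  then show ?thesis using u by (intro that[of x \<phi>]) simp_all
qed

definition ev :: "'t \<Rightarrow> 'a \<Rightarrow>\<^sub>L 'k" where
  "ev t = Blinfun (\<lambda>x. apply_bcontfun (J x) t)"

lemma ev_apply [simp]: "blinfun_apply (ev t) x = apply_bcontfun (J x) t"
proof -
  have "bounded_linear (\<lambda>x. apply_bcontfun (J x) t)"
    by (rule bounded_linear_intro[where K = 1]) (auto intro: norm_J_apply_le)
  then show ?thesis by (simp add: ev_def bounded_linear_Blinfun_apply)
qed

lemma ev_dual_ball: "ev t \<in> dual_ball smul"
  by (auto simp: dual_ball_iff dual_space_def J_smul intro!: norm_blinfun_bound norm_J_apply_le)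

text \<open>Evaluations are extreme: if \<open>x\<close> vanishes at \<open>p\<close>, then a function \<open>v\<close> with \<open>v p = 1\<close> and
  \<open>\<bar>v\<bar> + \<bar>x\<bar> \<le> 1\<close> exists, and a functional of norm one with value \<open>1\<close> at \<open>v\<close> has to vanish at \<open>x\<close>.\<close>

theorem ev_extreme: "ev p \<in> dual_extreme_points smul"
proof -
  obtain \<phi> x0 where x0: "\<And>t. apply_bcontfun (J x0) t = of_real (\<phi> t)" "\<And>t. 0 \<le> \<phi> t" "\<And>t. \<phi> t \<le> 1" "\<phi> p = 1"
    by (rule obtain_bump[OF open_UNIV UNIV_I[of p]]) (rule that)
  have nx0: "norm x0 \<le> 1" by (rule norm_leI) (use x0 in simp)
  have eq: "g = ev p" if g: "g \<in> dual_ball smul" and one: "\<And>v. norm v \<le> 1 \<Longrightarrow> apply_bcontfun (J v) p = 1 \<Longrightarrow> blinfun_apply g v = 1" for g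
  proof -
    have gD: "g \<in> dual_space smul" "norm g \<le> 1" using g by (auto simp: dual_ball_iff)
    have g_le: "rc_re (blinfun_apply g v) \<le> 1" if "norm v \<le> 1" for v
      using rc_re_le[of "blinfun_apply g v"] norm_blinfun[of g v] gD(2) that mult_mono[of "norm g" 1 "norm v" 1] by simp
    have zero1: "blinfun_apply g x = 0" if x: "norm x \<le> 1" "apply_bcontfun (J x) p = 0" for x
    proof -
      have c1: "continuous_on UNIV (\<lambda>t. 1 - norm (apply_bcontfun (J x) t))"
        by (intro continuous_intros) simp
      have nx: "norm (apply_bcontfun (J x) t) \<le> 1" for t using norm_J_apply_le[of x t] x(1) by linarith
      have "\<bar>1 - norm (apply_bcontfun (J x) t)\<bar> \<le> 1" for t using nx[of t] by simp
      then obtain v where v: "\<And>t. apply_bcontfun (J v) t = of_real (1 - norm (apply_bcontfun (J x) t)) * apply_bcontfun (J x0) t"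
        using obtain_mult[OF c1] by metis
      have nv: "norm (apply_bcontfun (J v) t) \<le> 1 - norm (apply_bcontfun (J x) t)" for t
      proof -
        have "norm (apply_bcontfun (J v) t) = (1 - norm (apply_bcontfun (J x) t)) * \<phi> t"
          unfolding v x0(1) norm_mult norm_of_real using nx[of t] x0(2)[of t] by simp
        then show ?thesis using mult_left_le[OF x0(3)[of t], of "1 - norm (apply_bcontfun (J x) t)"] nx[of t] by simp
      qed
      obtain c where c: "norm c = 1" "c * blinfun_apply g x = of_real (norm (blinfun_apply g x))"
        by (rule ex_unit_rotation)
      have "norm (v + smul c x) \<le> 1"
      proof (rule norm_leI)
        fix t
        have "norm (apply_bcontfun (J v) t + c * apply_bcontfun (J x) t) \<le> norm (apply_bcontfun (J v) t) + norm (apply_bcontfun (J x) t)"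
          using norm_triangle_ineq[of "apply_bcontfun (J v) t" "c * apply_bcontfun (J x) t"] c(1) by (simp add: norm_mult)
        then show "norm (apply_bcontfun (J (v + smul c x)) t) \<le> 1" using nv[of t] by (simp add: J_smul)
      qed
      moreover have "blinfun_apply g v = 1"
      proof (rule one)
        show "norm v \<le> 1" by (rule norm_leI) (use nv norm_ge_zero in \<open>smt (verit)\<close>)
        show "apply_bcontfun (J v) p = 1" by (simp add: v x0 x(2))
      qed
      ultimately have "1 + norm (blinfun_apply g x) \<le> 1"
        using g_le[of "v + smul c x"] by (simp add: blinfun.add_right dual_spaceD[OF gD(1)] c(2))
      then show ?thesis by simp
    qed
    have zero: "blinfun_apply g x = 0" if x: "apply_bcontfun (J x) p = 0" for x
    proof (cases "x = 0")
      case False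
      have "blinfun_apply g ((1 / norm x) *\<^sub>R x) = 0"
        by (rule zero1) (use x in simp_all)
      then show ?thesis using False by (simp add: blinfun.scaleR_right)
    qed (simp add: blinfun.zero_right)
    show "g = ev p"
    proof (rule blinfun_eqI)
      fix x
      let ?c = "apply_bcontfun (J x) p"
      have "blinfun_apply g (x - smul ?c x0) = 0" by (rule zero) (simp add: J_smul x0)
      moreover have "blinfun_apply g x0 = 1" by (rule one[OF nx0]) (simp add: x0)
      ultimately show "blinfun_apply g x = blinfun_apply (ev p) x"
        by (simp add: blinfun.diff_right dual_spaceD[OF gD(1)])
    qed
  qed
  have "ev p extreme_point_of dual_ball smul"
    unfolding extreme_point_of_def
  proof (intro conjI ballI ev_dual_ball notI)
    fix g h assume g: "g \<in> dual_ball smul" and h: "h \<in> dual_ball smul" and "ev p \<in> open_segment g h"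
    then obtain \<theta> where "g \<noteq> h" and \<theta>: "0 < \<theta>" "\<theta> < 1" and mid: "ev p = (1 - \<theta>) *\<^sub>R g + \<theta> *\<^sub>R h"
      by (auto simp: in_segment)
    have *: "blinfun_apply g v = 1 \<and> blinfun_apply h v = 1" if v: "norm v \<le> 1" "apply_bcontfun (J v) p = 1" for v
    proof -
      have le: "norm (blinfun_apply k v) \<le> 1" if "k \<in> dual_ball smul" for k
        using norm_blinfun[of k v] v(1) that mult_mono[of "norm k" 1 "norm v" 1] by (simp add: dual_ball_iff)
      have "(1 - \<theta>) *\<^sub>R blinfun_apply g v + \<theta> *\<^sub>R blinfun_apply h v = 1"
        using arg_cong[OF mid, of "\<lambda>k. blinfun_apply k v"] v(2) by (simp add: blinfun.bilinear_simps)
      then have "rc_re ((1 - \<theta>) *\<^sub>R blinfun_apply g v + \<theta> *\<^sub>R blinfun_apply h v) = rc_re (1 :: 'k)" by simp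
      then have "(1 - \<theta>) * rc_re (blinfun_apply g v) + \<theta> * rc_re (blinfun_apply h v) = 1" by simp
      then have "(1 - \<theta>) * (1 - rc_re (blinfun_apply g v)) + \<theta> * (1 - rc_re (blinfun_apply h v)) = 0"
        by (simp add: algebra_simps)
      moreover have r: "rc_re (blinfun_apply g v) \<le> 1" "rc_re (blinfun_apply h v) \<le> 1"
        using rc_re_le[of "blinfun_apply g v"] rc_re_le[of "blinfun_apply h v"] le[OF g] le[OF h] by linarith+
      moreover have "(1 - \<theta>) * (1 - rc_re (blinfun_apply g v)) \<ge> 0" "\<theta> * (1 - rc_re (blinfun_apply h v)) \<ge> 0"
        using r \<theta> by simp_all
      ultimately have "(1 - \<theta>) * (1 - rc_re (blinfun_apply g v)) = 0" "\<theta> * (1 - rc_re (blinfun_apply h v)) = 0"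
        by linarith+
      then have "rc_re (blinfun_apply g v) = 1" "rc_re (blinfun_apply h v) = 1" using \<theta> by simp_all
      then show ?thesis using eq_1_if_rc_re_eq_1 le[OF g] le[OF h] by blast
    qed
    have "g = ev p" "h = ev p" using eq[OF g] eq[OF h] * by blast+
    then show False using \<open>g \<noteq> h\<close> by simp
  qed
  then show ?thesis by (simp add: dual_extreme_points_def)
qed

lemma ev_not_multiple:
  assumes "s \<noteq> t"
  shows "ev t \<noteq> dual_scale c (ev s)"
proof
  assume eq: "ev t = dual_scale c (ev s)"
  have "open (- {s})" "t \<in> - {s}" using assms by auto
  from obtain_bump[OF this] obtain \<phi> x where x: "\<And>r. apply_bcontfun (J x) r = of_real (\<phi> r)" "\<phi> t = 1" "\<And>r. r \<notin> - {s} \<Longrightarrow> \<phi> r = 0"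
    by metis
  have "\<phi> s = 0" by (rule x(3)) simp
  then show False using arg_cong[OF eq, of "\<lambda>k. blinfun_apply k x"] x(1,2) by simp
qed

text \<open>Different evaluations lie on different lines, so each line accounts for at most one point of \<open>N\<close>.\<close>

lemma infinitely_many_lines_ev:
  assumes "infinite N"
  shows "infinitely_many_lines (ev ` N)"
  unfolding infinitely_many_lines_def
proof (intro allI impI, rule ccontr)
  fix F assume F: "finite F" "F \<subseteq> dual_extreme_points smul"
    and "\<not> (\<exists>e\<in>ev ` N. \<forall>f\<in>F. \<forall>c. e \<noteq> dual_scale c f)"
  then have no: "\<forall>t\<in>N. \<exists>f\<in>F. \<exists>c. ev t = dual_scale c f" by simp
  have "finite {t. \<exists>c. ev t = dual_scale c f}" for f
  proof -
    have "s = t" if s: "ev s = dual_scale c f" and t: "ev t = dual_scale d f" for s t c d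
    proof (rule ccontr)
      assume "s \<noteq> t"
      have "c \<noteq> 0"
      proof
        assume "c = 0"
        then have "ev s = dual_scale 0 (ev t)" using s by simp
        then show False using ev_not_multiple[of t s 0] \<open>s \<noteq> t\<close> by simp
      qed
      then have "ev t = dual_scale (d / c) (ev s)" using s t by simp
      then show False using ev_not_multiple[OF \<open>s \<noteq> t\<close>] by blast
    qed
    then have "\<exists>s. {t. \<exists>c. ev t = dual_scale c f} \<subseteq> {s}" by blast
    then show ?thesis by (meson finite.emptyI finite.insertI finite_subset)
  qed
  then have "finite (\<Union>f\<in>F. {t. \<exists>c. ev t = dual_scale c f})" using F(1) by blast
  moreover have "N \<subseteq> (\<Union>f\<in>F. {t. \<exists>c. ev t = dual_scale c f})" using no by blast
  ultimately show False using assms finite_subset by blast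
qed

text \<open>Multiplication by a bounded continuous function acts on \<open>C\<^sub>0\<close> and is transported along \<open>J\<close>; for
  other \<open>\<psi>\<close> the value is arbitrary.\<close>

definition pointwise_mult :: "('t \<Rightarrow> real) \<Rightarrow> 'a \<Rightarrow> 'a" where
  "pointwise_mult \<psi> x = (SOME y. \<forall>t. apply_bcontfun (J y) t = of_real (\<psi> t) * apply_bcontfun (J x) t)"

lemma J_mult:
  assumes "continuous_on UNIV \<psi>" "\<And>t. \<bar>\<psi> t\<bar> \<le> B"
  shows "apply_bcontfun (J (pointwise_mult \<psi> x)) t = of_real (\<psi> t) * apply_bcontfun (J x) t"
proof -
  obtain y where "\<And>t. apply_bcontfun (J y) t = of_real (\<psi> t) * apply_bcontfun (J x) t"
    by (rule obtain_mult[OF assms]) (rule that)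
  then have "\<exists>y. \<forall>t. apply_bcontfun (J y) t = of_real (\<psi> t) * apply_bcontfun (J x) t" by (intro exI allI)
  from someI_ex[OF this] show ?thesis by (simp add: pointwise_mult_def)
qed

lemma J_mult01:
  assumes "continuous_on UNIV \<psi>" "\<And>t. 0 \<le> \<psi> t" "\<And>t. \<psi> t \<le> 1"
  shows "apply_bcontfun (J (pointwise_mult \<psi> x)) t = of_real (\<psi> t) * apply_bcontfun (J x) t"
  by (rule J_mult[where B = 1]) (use assms in auto)

text \<open>An extreme functional \<open>e\<close> splits along \<open>\<psi>\<close> into the functionals \<open>x \<mapsto> e(\<psi> x)\<close> and \<open>x \<mapsto> e((1 - \<psi>) x)\<close>.
  Their norms add up to at most \<open>1\<close>, because \<open>\<psi> x + (1 - \<psi>) y\<close> stays in the unit ball, so extremality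
  makes both of them multiples of \<open>e\<close>.\<close>

lemma extreme_mult:
  assumes e: "e \<in> dual_extreme_points smul" and n1: "norm e = 1"
    and \<psi>: "continuous_on UNIV \<psi>" "\<And>t. 0 \<le> \<psi> t" "\<And>t. \<psi> t \<le> 1"
  obtains r :: real where "0 \<le> r" "r \<le> 1" "\<And>x. blinfun_apply e (pointwise_mult \<psi> x) = of_real r * blinfun_apply e x"
proof -
  note eD = dual_extreme_pointsD[OF e]
  define part where "part \<omega> = Blinfun (\<lambda>x. blinfun_apply e (pointwise_mult \<omega> x))" for \<omega>
  have part: "part \<omega> \<in> dual_space smul" "blinfun_apply (part \<omega>) x = blinfun_apply e (pointwise_mult \<omega> x)"
    if \<omega>: "continuous_on UNIV \<omega>" "\<And>t. 0 \<le> \<omega> t" "\<And>t. \<omega> t \<le> 1" for \<omega> x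
  proof -
    note Jm = J_mult01[OF \<omega>]
    have add: "pointwise_mult \<omega> (x + y) = pointwise_mult \<omega> x + pointwise_mult \<omega> y" for x y
      by (rule J_eqI) (simp add: Jm distrib_left)
    have sc: "pointwise_mult \<omega> (smul c x) = smul c (pointwise_mult \<omega> x)" for c x
      by (rule J_eqI) (simp add: Jm J_smul)
    have nm: "norm (pointwise_mult \<omega> x) \<le> norm x" for x
    proof (rule norm_leI)
      fix t
      have "norm (apply_bcontfun (J (pointwise_mult \<omega> x)) t) = \<omega> t * norm (apply_bcontfun (J x) t)"
        using \<omega>(2)[of t] by (simp add: Jm norm_mult)
      also have "\<dots> \<le> 1 * norm x" using \<omega>(2,3) norm_J_apply_le[of x t] by (intro mult_mono) auto
      finally show "norm (apply_bcontfun (J (pointwise_mult \<omega> x)) t) \<le> norm x" by simp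
    qed
    have bl: "bounded_linear (\<lambda>x. blinfun_apply e (pointwise_mult \<omega> x))"
    proof (rule bounded_linear_intro[where K = 1])
      show "blinfun_apply e (pointwise_mult \<omega> (r *\<^sub>R x)) = r *\<^sub>R blinfun_apply e (pointwise_mult \<omega> x)" for r x
        using sc[of "of_real r" x] by (simp add: smul_of_real blinfun.scaleR_right)
      show "norm (blinfun_apply e (pointwise_mult \<omega> x)) \<le> norm x * 1" for x
        using eD(4)[of "pointwise_mult \<omega> x"] nm[of x] by linarith
    qed (simp add: add blinfun.add_right)
    show "blinfun_apply (part \<omega>) x = blinfun_apply e (pointwise_mult \<omega> x)" for x
      by (simp add: part_def bounded_linear_Blinfun_apply[OF bl])
    show "part \<omega> \<in> dual_space smul"
      by (simp add: part_def bounded_linear_Blinfun_apply[OF bl] dual_space_def sc dual_spaceD[OF eD(1)])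
  qed
  define \<psi>' where "\<psi>' t = 1 - \<psi> t" for t
  have \<psi>': "continuous_on UNIV \<psi>'" "\<And>t. 0 \<le> \<psi>' t" "\<And>t. \<psi>' t \<le> 1"
    using \<psi> by (auto simp: \<psi>'_def[abs_def] intro!: continuous_intros)
  let ?f = "part \<psi>" and ?g = "part \<psi>'"
  note f = part[OF \<psi>] and g = part[OF \<psi>']
  have sum: "e = ?f + ?g"
  proof (rule blinfun_eqI)
    fix x
    have "x = pointwise_mult \<psi> x + pointwise_mult \<psi>' x"
      by (rule J_eqI) (simp add: J_mult01[OF \<psi>] J_mult01[OF \<psi>'] \<psi>'_def algebra_simps)
    then have "blinfun_apply e x = blinfun_apply e (pointwise_mult \<psi> x + pointwise_mult \<psi>' x)" by simp
    then show "blinfun_apply e x = blinfun_apply (?f + ?g) x"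
      by (simp add: f g blinfun.add_left blinfun.add_right)
  qed
  have "norm ?f + norm ?g \<le> 1"
  proof (rule field_le_epsilon)
    fix \<kappa> :: real assume "\<kappa> > 0"
    obtain x where x: "norm x \<le> 1" "norm ?f - \<kappa> / 2 < rc_re (blinfun_apply ?f x)"
      by (rule obtain_almost_norming[OF f(1), of "norm ?f - \<kappa> / 2"]) (use \<open>\<kappa> > 0\<close> in auto)
    obtain y where y: "norm y \<le> 1" "norm ?g - \<kappa> / 2 < rc_re (blinfun_apply ?g y)"
      by (rule obtain_almost_norming[OF g(1), of "norm ?g - \<kappa> / 2"]) (use \<open>\<kappa> > 0\<close> in auto)
    have "norm (pointwise_mult \<psi> x + pointwise_mult \<psi>' y) \<le> 1"
    proof (rule norm_leI)
      fix t
      have "norm (of_real (\<psi> t) * apply_bcontfun (J x) t + of_real (\<psi>' t) * apply_bcontfun (J y) t)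
        \<le> \<psi> t * norm (apply_bcontfun (J x) t) + \<psi>' t * norm (apply_bcontfun (J y) t)"
        using \<psi>(2)[of t] \<psi>'(2)[of t] by (intro norm_triangle_le) (simp add: norm_mult)
      also have "\<dots> \<le> \<psi> t * 1 + \<psi>' t * 1"
        using \<psi>(2)[of t] \<psi>'(2)[of t] norm_J_apply_le[of x t] norm_J_apply_le[of y t] x(1) y(1)
        by (intro add_mono mult_left_mono) auto
      finally show "norm (apply_bcontfun (J (pointwise_mult \<psi> x + pointwise_mult \<psi>' y)) t) \<le> 1"
        by (simp add: J_mult01[OF \<psi>] J_mult01[OF \<psi>'] \<psi>'_def)
    qed
    then have "norm (blinfun_apply e (pointwise_mult \<psi> x + pointwise_mult \<psi>' y)) \<le> 1" using eD(4)[of "pointwise_mult \<psi> x + pointwise_mult \<psi>' y"] by linarith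
    then have "rc_re (blinfun_apply e (pointwise_mult \<psi> x + pointwise_mult \<psi>' y)) \<le> 1"
      using rc_re_le[of "blinfun_apply e (pointwise_mult \<psi> x + pointwise_mult \<psi>' y)"] by linarith
    then show "norm ?f + norm ?g \<le> 1 + \<kappa>"
      using x(2) y(2) by (simp add: f(2) g(2) blinfun.add_right)
  qed
  moreover have "1 \<le> norm ?f + norm ?g" using norm_triangle_ineq[of ?f ?g] sum n1 by simp
  ultimately have one: "norm ?f + norm ?g = 1" by simp
  have "?f = norm ?f *\<^sub>R e"
  proof (cases "norm ?f = 0 \<or> norm ?g = 0")
    case True
    then show ?thesis
    proof
      assume "norm ?f = 0" then show ?thesis by simp
    next
      assume "norm ?g = 0"
      then have "e = ?f" using sum by simp
      then show ?thesis using n1 by simp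
    qed
  next
    case False
    then have pos: "norm ?f > 0" "norm ?g > 0" by auto
    have eq: "(1 / norm ?f) *\<^sub>R ?f = (1 / norm ?g) *\<^sub>R ?g"
    proof (rule dual_extreme_points_mid[OF e, where \<theta> = "norm ?g"])
      show "(1 / norm ?f) *\<^sub>R ?f \<in> dual_ball smul" "(1 / norm ?g) *\<^sub>R ?g \<in> dual_ball smul"
        using f(1) g(1) pos by (auto simp: dual_ball_iff)
      have "1 - norm ?g = norm ?f" using one by simp
      then show "e = (1 - norm ?g) *\<^sub>R (1 / norm ?f) *\<^sub>R ?f + norm ?g *\<^sub>R (1 / norm ?g) *\<^sub>R ?g"
        using pos sum by simp
    qed (use pos one in linarith)+
    have "norm ?g *\<^sub>R (1 / norm ?f) *\<^sub>R ?f = ?g" unfolding eq using pos by simp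
    then have "e = norm ?f *\<^sub>R (1 / norm ?f) *\<^sub>R ?f + norm ?g *\<^sub>R (1 / norm ?f) *\<^sub>R ?f"
      using sum pos by simp
    also have "\<dots> = (1 / norm ?f) *\<^sub>R ?f" by (simp only: one scaleR_one flip: scaleR_left_distrib)
    finally have "e = (1 / norm ?f) *\<^sub>R ?f" .
    then have "norm ?f *\<^sub>R e = norm ?f *\<^sub>R ((1 / norm ?f) *\<^sub>R ?f)" by simp
    then show ?thesis using pos by simp
  qed
  then have "blinfun_apply ?f x = blinfun_apply (norm ?f *\<^sub>R e) x" for x by simp
  then have "blinfun_apply e (pointwise_mult \<psi> x) = of_real (norm ?f) * blinfun_apply e x" for x
    by (simp add: f(2) blinfun.scaleR_left scaleR_conv_of_real)
  then show ?thesis using that[of "norm ?f"] one norm_ge_zero[of ?g] by auto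
qed

text \<open>By \<open>extreme_mult\<close>, multiplication by \<open>\<psi>\<close> acts on \<open>e\<close> as multiplication by a number \<open>r\<close>. Then
  \<open>(\<psi> - r)\<^sup>2\<close> annihilates \<open>e\<close>. A point \<open>t\<close> at which all annihilating \<open>\<psi>\<close> vanish exists by compactness, and
  therefore \<open>r = \<psi>(t)\<close>.\<close>

theorem extreme_is_ev:
  assumes cpt: "compact (UNIV :: 't set)" and e: "e \<in> dual_extreme_points smul" and n1: "norm e = 1"
  obtains c t where "norm c = 1" "e = dual_scale c (ev t)"
proof -
  note eD = dual_extreme_pointsD[OF e]
  define I where "I = {\<psi>. continuous_on UNIV \<psi> \<and> (\<forall>t. 0 \<le> \<psi> t \<and> \<psi> t \<le> 1) \<and> (\<forall>x. blinfun_apply e (pointwise_mult \<psi> x) = 0)}"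
  have I: "continuous_on UNIV \<psi>" "\<And>t. 0 \<le> \<psi> t" "\<And>t. \<psi> t \<le> 1" "\<And>x. blinfun_apply e (pointwise_mult \<psi> x) = 0" if "\<psi> \<in> I" for \<psi>
    using that by (auto simp: I_def)
  \<comment> \<open>Without a common zero, a finite sum of functions in \<open>I\<close> would be invertible and \<open>e\<close> would vanish.\<close>
  have "\<exists>t. \<forall>\<psi>\<in>I. \<psi> t = 0"
  proof (rule ccontr)
    assume "\<not> ?thesis"
    then have nz: "\<exists>\<psi>\<in>I. \<psi> t \<noteq> 0" for t by blast
    have op: "open {t. 0 < \<psi> t}" if "\<psi> \<in> I" for \<psi>
      by (intro open_Collect_less continuous_on_const I(1)[OF that])
    have cover: "UNIV \<subseteq> (\<Union>\<psi>\<in>I. {t. 0 < \<psi> t})"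
    proof
      fix t :: 't
      obtain \<psi> where "\<psi> \<in> I" "\<psi> t \<noteq> 0" using nz by blast
      then show "t \<in> (\<Union>\<psi>\<in>I. {t. 0 < \<psi> t})" using I(2)[of \<psi> t] by (auto simp: less_le)
    qed
    obtain D where D: "D \<subseteq> I" "finite D" "UNIV \<subseteq> (\<Union>\<psi>\<in>D. {t. 0 < \<psi> t})"
      by (rule compactE_image[OF cpt _ cover]) (rule op)
    define S where "S t = (\<Sum>\<psi>\<in>D. \<psi> t)" for t
    have cS: "continuous_on UNIV S" unfolding S_def[abs_def] using D(1) I(1) by (intro continuous_on_sum) auto
    have S0: "S t > 0" for t
    proof -
      obtain \<psi> where "\<psi> \<in> D" "0 < \<psi> t" using D(3) by blast
      then show ?thesis unfolding S_def using D(1,2) I(2) by (intro sum_pos2[of _ \<psi>]) auto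
    qed
    obtain t0 where t0: "\<And>t. S t0 \<le> S t"
      using continuous_attains_inf[OF cpt _ cS] by auto
    have cinv: "continuous_on UNIV (\<lambda>t. 1 / S t)"
      using S0 by (intro continuous_intros cS) (metis less_irrefl)
    have binv: "\<bar>1 / S t\<bar> \<le> 1 / S t0" for t using S0[of t] S0[of t0] t0[of t] by (simp add: frac_le)
    have "blinfun_apply e x = 0" for x
    proof -
      let ?y = "pointwise_mult (\<lambda>t. 1 / S t) x"
      have "x = (\<Sum>\<psi>\<in>D. pointwise_mult \<psi> ?y)"
      proof (rule J_eqI)
        fix t
        have "apply_bcontfun (J (\<Sum>\<psi>\<in>D. pointwise_mult \<psi> ?y)) t = (\<Sum>\<psi>\<in>D. of_real (\<psi> t) * apply_bcontfun (J ?y) t)"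
          unfolding J_apply_sum using D(1) I by (intro sum.cong) (auto intro!: J_mult01)
        also have "\<dots> = of_real (S t) * (of_real (1 / S t) * apply_bcontfun (J x) t)"
          unfolding J_mult[OF cinv binv] by (simp only: S_def of_real_sum sum_distrib_right)
        also have "\<dots> = of_real (S t * (1 / S t)) * apply_bcontfun (J x) t"
          by (simp only: of_real_mult mult.assoc)
        also have "S t * (1 / S t) = 1" using S0[of t] by simp
        finally show "apply_bcontfun (J x) t = apply_bcontfun (J (\<Sum>\<psi>\<in>D. pointwise_mult \<psi> ?y)) t" by simp
      qed
      then have "blinfun_apply e x = (\<Sum>\<psi>\<in>D. blinfun_apply e (pointwise_mult \<psi> ?y))" by (metis blinfun.sum_right)
      then show ?thesis using D(1) I(4) by (simp add: subset_iff)
    qed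
    then have "e = 0" by (intro blinfun_eqI) simp
    then show False using n1 by simp
  qed
  then obtain t where t: "\<And>\<psi>. \<psi> \<in> I \<Longrightarrow> \<psi> t = 0" by blast
  have char: "blinfun_apply e (pointwise_mult \<psi> x) = of_real (\<psi> t) * blinfun_apply e x"
    if \<psi>: "continuous_on UNIV \<psi>" "\<And>t. 0 \<le> \<psi> t" "\<And>t. \<psi> t \<le> 1" for \<psi> x
  proof -
    obtain r where r: "0 \<le> r" "r \<le> 1" "\<And>x. blinfun_apply e (pointwise_mult \<psi> x) = of_real r * blinfun_apply e x"
      using extreme_mult[OF e n1 \<psi>] by metis
    define \<omega> where "\<omega> s = (\<psi> s - r)\<^sup>2" for s
    have abs1: "\<bar>\<psi> s - r\<bar> \<le> 1" for s using \<psi>(2,3)[of s] r by auto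
    have c1: "continuous_on UNIV \<omega>" unfolding \<omega>_def[abs_def] by (intro continuous_intros \<psi>(1))
    have c0: "continuous_on UNIV (\<lambda>s. \<psi> s - r)" by (intro continuous_intros \<psi>(1))
    have \<omega>01: "0 \<le> \<omega> s" "\<omega> s \<le> 1" for s using abs1[of s] by (auto simp: \<omega>_def abs_square_le_1)
    have z: "blinfun_apply e (pointwise_mult (\<lambda>s. \<psi> s - r) x) = 0" for x
    proof -
      have "pointwise_mult (\<lambda>s. \<psi> s - r) x = pointwise_mult \<psi> x - r *\<^sub>R x"
        by (rule J_eqI) (simp add: J_mult[OF c0 abs1] J_mult01[OF \<psi>] algebra_simps scaleR_conv_of_real)
      then show ?thesis by (simp add: blinfun.diff_right blinfun.scaleR_right r(3) scaleR_conv_of_real)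
    qed
    have "blinfun_apply e (pointwise_mult \<omega> x) = 0" for x
    proof -
      have "pointwise_mult \<omega> x = pointwise_mult (\<lambda>s. \<psi> s - r) (pointwise_mult (\<lambda>s. \<psi> s - r) x)"
        by (rule J_eqI) (simp add: J_mult[OF c0 abs1] J_mult01[OF c1 \<omega>01] \<omega>_def power2_eq_square)
      then show ?thesis by (simp add: z)
    qed
    then have "\<omega> \<in> I" using c1 \<omega>01 by (simp add: I_def)
    then have "\<psi> t = r" using t[of \<omega>] by (simp add: \<omega>_def)
    then show ?thesis using r(3) by simp
  qed
  have vanish: "blinfun_apply e x = 0" if x: "apply_bcontfun (J x) t = 0" for x
  proof -
    have "norm (blinfun_apply e x) \<le> 0 + \<epsilon>" if "\<epsilon> > 0" for \<epsilon>
    proof -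
      \<comment> \<open>Vanishes at \<open>t\<close> and satisfies \<open>\<bar>(1 - \<psi>) x\<bar> = \<epsilon>\<bar>x\<bar> / (\<bar>x\<bar> + \<epsilon>) \<le> \<epsilon>\<close>.\<close>
      define \<psi> where "\<psi> s = norm (apply_bcontfun (J x) s) / (norm (apply_bcontfun (J x) s) + \<epsilon>)" for s
      have pos: "norm (apply_bcontfun (J x) s) + \<epsilon> > 0" for s using \<open>\<epsilon> > 0\<close> norm_ge_zero[of "apply_bcontfun (J x) s"] by linarith
      have c: "continuous_on UNIV \<psi>" unfolding \<psi>_def[abs_def]
        by (intro continuous_intros) (use pos in \<open>auto simp: less_le\<close>)
      have \<psi>01: "0 \<le> \<psi> s" "\<psi> s \<le> 1" for s using pos[of s] \<open>\<epsilon> > 0\<close> by (auto simp: \<psi>_def)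
      have "blinfun_apply e (pointwise_mult \<psi> x) = 0" unfolding char[OF c \<psi>01] using x by (simp add: \<psi>_def)
      then have "blinfun_apply e x = blinfun_apply e (x - pointwise_mult \<psi> x)" by (simp add: blinfun.diff_right)
      also have "norm \<dots> \<le> norm (x - pointwise_mult \<psi> x)" by (rule eD(4))
      also have "\<dots> \<le> \<epsilon>"
      proof (rule norm_leI)
        fix s
        let ?n = "norm (apply_bcontfun (J x) s)"
        have "apply_bcontfun (J (x - pointwise_mult \<psi> x)) s = of_real (1 - \<psi> s) * apply_bcontfun (J x) s"
          by (simp add: J_mult01[OF c \<psi>01] algebra_simps)
        then have "norm (apply_bcontfun (J (x - pointwise_mult \<psi> x)) s) = (1 - \<psi> s) * ?n"
          using \<psi>01[of s] by (simp only: norm_mult norm_of_real)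
        also have "\<dots> = \<epsilon> * (?n / (?n + \<epsilon>))" using pos[of s] by (simp add: \<psi>_def field_simps)
        also have "\<dots> \<le> \<epsilon>" using pos[of s] \<open>\<epsilon> > 0\<close> by (intro mult_left_le) auto
        finally show "norm (apply_bcontfun (J (x - pointwise_mult \<psi> x)) s) \<le> \<epsilon>" .
      qed
      finally show ?thesis by simp
    qed
    then have "norm (blinfun_apply e x) \<le> 0" by (rule field_le_epsilon)
    then show ?thesis by simp
  qed
  obtain \<phi> x0 where x0: "\<And>s. apply_bcontfun (J x0) s = of_real (\<phi> s)" "\<And>s. 0 \<le> \<phi> s" "\<And>s. \<phi> s \<le> 1" "\<phi> t = 1"
    by (rule obtain_bump[OF open_UNIV UNIV_I[of t]]) (rule that)
  have eq: "e = dual_scale (blinfun_apply e x0) (ev t)"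
  proof (rule blinfun_eqI)
    fix x
    have "blinfun_apply e (x - smul (apply_bcontfun (J x) t) x0) = 0"
      by (rule vanish) (simp add: J_smul x0)
    then show "blinfun_apply e x = blinfun_apply (dual_scale (blinfun_apply e x0) (ev t)) x"
      by (simp add: blinfun.diff_right dual_spaceD[OF eD(1)] mult.commute)
  qed
  have "norm x0 \<le> 1" by (rule norm_leI) (use x0 in simp)
  then have "norm (blinfun_apply e x0) \<le> 1" using eD(4)[of x0] by linarith
  moreover have "1 \<le> norm (blinfun_apply e x0)"
  proof -
    have "1 = norm (blinfun_apply e x0) * norm (ev t)" using eq n1 by (metis norm_dual_scale)
    also have "\<dots> \<le> norm (blinfun_apply e x0)" using ev_dual_ball[of t] by (intro mult_left_le) (auto simp: dual_ball_iff)
    finally show ?thesis .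
  qed
  ultimately show ?thesis using that[OF _ eq] by simp
qed

text \<open>The set of extreme points is a continuous image of the compact space of pairs of a unimodular scalar
  and a point.\<close>

theorem closedin_dual_extreme_points:
  assumes cpt: "compact (UNIV :: 't set)" and nz: "\<exists>x::'a. x \<noteq> 0"
  shows "closedin (weak_star_topology smul) (dual_extreme_points smul)"
proof -
  let ?G = "\<lambda>(c, t) x. c * apply_bcontfun (J x) t"
  have "continuous_on (sphere 0 1 \<times> UNIV) ?G"
    unfolding case_prod_unfold
    by (intro continuous_on_coordinatewise_then_product continuous_intros
        continuous_on_compose2[OF continuous_on_apply_bcontfun[of UNIV]]) auto
  then have "compact (?G ` (sphere 0 1 \<times> UNIV))"
    by (intro compact_continuous_image compact_Times compact_sphere cpt)
  moreover have "blinfun_apply ` dual_extreme_points smul = ?G ` (sphere 0 1 \<times> UNIV)"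
  proof (intro equalityI subsetI)
    fix h assume "h \<in> blinfun_apply ` dual_extreme_points smul"
    then obtain e where e: "h = blinfun_apply e" "e \<in> dual_extreme_points smul" by blast
    obtain c t where "norm c = 1" "e = dual_scale c (ev t)"
      by (rule extreme_is_ev[OF cpt e(2) norm_dual_extreme_point[OF e(2) nz]])
    then show "h \<in> ?G ` (sphere 0 1 \<times> UNIV)"
      using e(1) by (intro image_eqI[of _ _ "(c, t)"]) (auto simp: fun_eq_iff)
  next
    fix h assume "h \<in> ?G ` (sphere 0 1 \<times> UNIV)"
    then obtain c t where "norm c = 1" "h = (\<lambda>x. c * apply_bcontfun (J x) t)" by auto
    then show "h \<in> blinfun_apply ` dual_extreme_points smul"
      using dual_scale_extreme[OF ev_extreme[of t]] by (intro image_eqI[of _ _ "dual_scale c (ev t)"]) (auto simp: fun_eq_iff)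
  qed
  moreover have "dual_extreme_points smul \<subseteq> dual_ball smul" using dual_extreme_pointsD(3) by blast
  ultimately show ?thesis by (simp add: closedin_weak_star_iff)
qed

end

section \<open>The sufficient conditions for the convex-DLD2P\<close>

locale C0_L1_predual = C0_space smul J + L1_predual_space smul M
  for smul :: "'k::real_or_complex \<Rightarrow> 'a::banach \<Rightarrow> 'a" and J :: "'a \<Rightarrow> ('t::t2_space \<Rightarrow>\<^sub>C 'k)" and M :: "'m measure"
begin

text \<open>A function with value \<open>1\<close> at \<open>p\<close> has modulus above \<open>1 - \<delta>\<close> on a neighbourhood of \<open>p\<close>, which is infinite, and
  the evaluations at its points lie on different lines.\<close>

theorem convex_DLD2P_if_accumulation_point:
  assumes p: "(p::'t) islimpt UNIV"
  shows "convex_DLD2P smul"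
proof (rule convex_DLD2P_if_delta_face[OF ev_extreme[of p]])
  fix y and \<delta> :: real assume y: "blinfun_apply (ev p) y = 1" and "\<delta> > 0"
  let ?N = "{t. 1 - \<delta> < norm (apply_bcontfun (J y) t)}"
  have "open ?N" by (intro open_Collect_less continuous_intros) simp
  moreover have "p \<in> ?N" using y \<open>\<delta> > 0\<close> by simp
  ultimately have N: "open ?N" "p \<in> ?N" by blast+
  have "infinite ?N"
  proof
    assume "finite ?N"
    then have "closed (?N - {p})" by (intro finite_imp_closed finite_Diff)
    then have "open (?N - (?N - {p}))" using N(1) by (rule open_Diff[rotated])
    moreover have "p \<in> ?N - (?N - {p})" using N(2) by blast
    ultimately obtain t where "t \<in> ?N - (?N - {p})" "t \<noteq> p" using p unfolding islimpt_def by meson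
    then show False by blast
  qed
  then have "infinitely_many_lines (ev ` ?N)" by (rule infinitely_many_lines_ev)
  then show "infinitely_many_lines {e \<in> dual_extreme_points smul. norm (blinfun_apply e y) > 1 - \<delta>}"
    by (rule infinitely_many_lines_mono) (auto simp: ev_extreme)
qed

end

theorem corollary3p10:
  fixes smul :: "'k::real_or_complex \<Rightarrow> 'a::banach \<Rightarrow> 'a"
    and M :: "'m measure"
  assumes "normed_space_over smul"
    and "infinite_dimensional smul"
    and "L1_predual smul M"
  shows
    "(closedin (weak_star_topology smul) (dual_extreme_points smul) \<longrightarrow> convex_DLD2P smul) \<and>
     (compact (UNIV :: 'c::t2_space set) \<and>
        isometrically_isomorphic_to smul (UNIV :: ('c \<Rightarrow>\<^sub>C 'k) set) \<longrightarrow>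
        closedin (weak_star_topology smul) (dual_extreme_points smul) \<and> convex_DLD2P smul) \<and>
     ((\<exists>x. delta_point smul x \<and> smooth_norm_at smul x) \<longrightarrow> convex_DLD2P smul) \<and>
     (locally_compact_space (euclidean :: 'l::t2_space topology) \<and>
        (\<exists>p :: 'l. p islimpt UNIV) \<and>
        isometrically_isomorphic_to smul (C0 :: ('l \<Rightarrow>\<^sub>C 'k) set) \<longrightarrow>
        convex_DLD2P smul)"
proof -
  interpret normed_space_over smul by (rule assms(1))
  interpret L1_predual_space smul M
    by unfold_locales (rule assms(2), rule assms(3))
  have a: "convex_DLD2P smul" if "closedin (weak_star_topology smul) (dual_extreme_points smul)"
    using that by (rule convex_DLD2P_if_closed_extreme_points)
  moreover have "closedin (weak_star_topology smul) (dual_extreme_points smul)"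
    if cpt: "compact (UNIV :: 'c set)" and iso: "isometrically_isomorphic_to smul (UNIV :: ('c \<Rightarrow>\<^sub>C 'k) set)"
  proof -
    obtain J :: "'a \<Rightarrow> ('c \<Rightarrow>\<^sub>C 'k)" where J: "range J = UNIV" "\<forall>x y. J (x + y) = J x + J y"
      "\<forall>c x t. apply_bcontfun (J (smul c x)) t = c * apply_bcontfun (J x) t" "\<forall>x. norm (J x) = norm x"
      using iso unfolding isometrically_isomorphic_to_def by (elim exE conjE)
    have "compact_space (euclidean :: 'c topology)" using cpt by (simp add: compact_space_def)
    then have "locally_compact_space (euclidean :: 'c topology)" by (rule compact_imp_locally_compact_space)
    then interpret C0_space smul J
      using J C0_compact_space[OF cpt, where 'k = 'k] by unfold_locales simp_all
    show ?thesis by (rule closedin_dual_extreme_points[OF cpt nontrivial])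
  qed
  moreover have "convex_DLD2P smul" if "delta_point smul x" "smooth_norm_at smul x" for x
    using that by (rule convex_DLD2P_if_smooth_delta_point)
  moreover have "convex_DLD2P smul"
    if lc: "locally_compact_space (euclidean :: 'l topology)" and p: "p islimpt (UNIV :: 'l set)"
      and iso: "isometrically_isomorphic_to smul (C0 :: ('l \<Rightarrow>\<^sub>C 'k) set)" for p
  proof -
    obtain J :: "'a \<Rightarrow> ('l \<Rightarrow>\<^sub>C 'k)" where J: "range J = C0" "\<forall>x y. J (x + y) = J x + J y"
      "\<forall>c x t. apply_bcontfun (J (smul c x)) t = c * apply_bcontfun (J x) t" "\<forall>x. norm (J x) = norm x"
      using iso unfolding isometrically_isomorphic_to_def by (elim exE conjE)
    interpret C0_space smul J
      using lc J by unfold_locales simp_all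
    interpret C0_L1_predual smul J M by unfold_locales
    show ?thesis by (rule convex_DLD2P_if_accumulation_point[OF p])
  qed
  ultimately show ?thesis by (intro conjI impI) (elim conjE exE; assumption | blast)+
qed

end
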